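(* For $n\in\mathbb{N}$ let $\mathcal{B}_n=\mathbb{F}_2[\alpha_1,\ldots,\alpha_{n-1},\alpha_n^{\pm1}]$ and $\mathcal{B}_n^+=\mathbb{F}_2[\alpha_1,\ldots,\alpha_n]$, with $\alpha_0=1$ (so $\mathcal{B}_0=\mathcal{B}_0^+=\mathbb{F}_2$). Then: (1) The graded monoid functor $\mathcal{M}$ is represented by a connected graded bialgebra $\mathcal{B}$ with components $\mathcal{B}_n$, where $\sum_{i=0}^n\alpha_ix^{2^i}\in\mathcal{M}_n(\mathcal{B}_n)$ is the universal element. (2) For each $n\in\mathbb{N}$, the commutative algebra $\mathcal{B}_n$ is graded, with $|\alpha_i|=1-2^i$, so that the expression $\sum_i\alpha_ix^{2^i}$ is homogeneous of degree $1$ when $x$ is given degree $1$. (3) The inclusion of graded monoid functors $\mathcal{M}\hookrightarrow\mathcal{M}^+$ is represented by a sub graded bialgebra $\mathcal{B}^+\hookrightarrow\mathcal{B}$ with components $\mathcal{B}^+_n$. (4) For each $n\in\mathbb{N}$, the algebra $\mathcal{B}_n^+$ is a graded coconnected algebra (concentrated in non-positive degrees, with degree $0$ part $\mathbb{F}_2$), and $\mathcal{B}_n\cong\mathcal{B}_n^+[\alpha_n^{-1}]$.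
   Context: A graded monoid consists of sets $(M_n)_{n\in\mathbb{N}}$ with associative products $M_i\times M_j\to M_{i+j}$ and a unit in $M_0$. A graded monoid functor is a functor from commutative $\mathbb{F}_2$-algebras to graded monoids. For a commutative $\mathbb{F}_2$-algebra $A$, $$\mathcal{M}_n(A)=\Big\{\sum_{i=0}^n\alpha_ix^{2^i}\ \Big|\ \alpha_i\in A,\ \alpha_0=1,\ \alpha_n\in A^\times\Big\},\qquad \mathcal{M}^+_n(A)=\Big\{\sum_{i=0}^n\alpha_ix^{2^i}\ \Big|\ \alpha_i\in A,\ \alpha_0=1\Big\},$$ with product $(f,g)\mapsto f\circ g$ (composition of polynomials) and unit $x$ in degree $0$; $\mathcal{M}\hookrightarrow\mathcal{M}^+$ forgets the invertibility condition. An $\mathbb{N}$-graded bialgebra over $\mathbb{F}_2$ is a family $(B_n)_{n\in\mathbb{N}}$ of commutative $\mathbb{F}_2$-algebras with algebra morphisms $\Delta_{i,j}:B_{i+j}\to B_i\otimes B_j$ and a counit $B_0\to\mathbb{F}_2$, which are coassociative and counital; it is connected if $B_0\cong\mathbb{F}_2$. It represents a graded monoid functor $M$ if $M_n(A)\cong\mathrm{Hom}_{\mathbb{F}_2\text{-alg}}(B_n,A)$ naturally in $A$ for all $n$, compatibly with units and products, with the convention that $\Delta_{i,j}$ corresponds to composing with the first tensor factor as the inner polynomial: if $g\in M_i(A)$ and $h\in M_j(A)$ correspond to $\phi:B_i\to A$ and $\psi:B_j\to A$, then $h\circ g\in M_{i+j}(A)$ corresponds to $(\phi\cdot\psi)\circ\Delta_{i,j}$,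 where $\phi\cdot\psi:B_i\otimes B_j\to A$ is $a\otimes b\mapsto\phi(a)\psi(b)$. Thus $\Delta_{1,1}(\alpha_1)=\alpha_1\otimes1+1\otimes\alpha_1$ and $\Delta_{1,1}(\alpha_2)=\alpha_1^2\otimes\alpha_1$. *)

theory Defs
  imports
    "HOL-Algebra.UnivPoly"
    "HOL-Algebra.QuotRing"
    "HOL-Library.Poly_Mapping"
    "HOL-Library.Z2"
    "HOL-Library.FuncSet"
begin

section \<open>Commutative algebras over the field with two elements\<close>

definition F2 :: "(bit, bit) module" where
  "F2 = \<lparr>carrier = UNIV, mult = (*), one = 1, zero = 0, add = (+), smult = (*)\<rparr>"

abbreviation F2_algebra :: "(bit, 'a) module \<Rightarrow> bool" where
  "F2_algebra A \<equiv> algebra F2 A"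

text \<open>
  Morphisms are required to be \<^const>\<open>extensional\<close>, so that two morphisms are equal in HOL exactly
  if they agree on the carrier; they are composed with \<^const>\<open>compose\<close>.
\<close>

definition alg_hom :: "(bit, 'a) module \<Rightarrow> (bit, 'b) module \<Rightarrow> ('a \<Rightarrow> 'b) set" where
  "alg_hom A B = {f \<in> ring_hom A B \<inter> extensional (carrier A).
     \<forall>c\<in>carrier F2. \<forall>a\<in>carrier A. f (c \<odot>\<^bsub>A\<^esub> a) = c \<odot>\<^bsub>B\<^esub> f a}"

definition alg_iso :: "(bit, 'a) module \<Rightarrow> (bit, 'b) module \<Rightarrow> ('a \<Rightarrow> 'b) set" where
  "alg_iso A B = {f \<in> alg_hom A B. bij_betw f (carrier A) (carrier B)}"

definition alg_id :: "(bit, 'a) module \<Rightarrow> 'a \<Rightarrow> 'a" where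
  "alg_id A = (\<lambda>a\<in>carrier A. a)"

definition alg_unit :: "(bit, 'a) module \<Rightarrow> bit \<Rightarrow> 'a" where
  "alg_unit A = (\<lambda>c. c \<odot>\<^bsub>A\<^esub> \<one>\<^bsub>A\<^esub>)"

text \<open>The ring \<open>R\<close> made into an algebra by means of a ring homomorphism \<open>\<eta>\<close> from \<^const>\<open>F2\<close> to \<open>R\<close>.\<close>

definition alg_of :: "'a ring \<Rightarrow> (bit \<Rightarrow> 'a) \<Rightarrow> (bit, 'a) module" where
  "alg_of R \<eta> = \<lparr>carrier = carrier R, mult = mult R, one = one R, zero = zero R, add = add R,
     smult = (\<lambda>c x. \<eta> c \<otimes>\<^bsub>R\<^esub> x)\<rparr>"


section \<open>Tensor products\<close>

text \<open>
  The tensor product of \<open>A\<close> and \<open>B\<close> over \<^const>\<open>F2\<close> is the monoid algebra of the multiplicative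
  monoid of \<open>A \<times> B\<close>, modulo the ideal generated by the relations of bilinearity.
\<close>

definition free_alg :: "(bit, 'a) module \<Rightarrow> (bit, 'b) module \<Rightarrow> (('a \<times> 'b) \<Rightarrow>\<^sub>0 bit) ring" where
  "free_alg A B = \<lparr>
     carrier = {p. Poly_Mapping.keys p \<subseteq> carrier A \<times> carrier B},
     mult = (\<lambda>p q. \<Sum>x\<in>Poly_Mapping.keys p. \<Sum>y\<in>Poly_Mapping.keys q.
        Poly_Mapping.single (fst x \<otimes>\<^bsub>A\<^esub> fst y, snd x \<otimes>\<^bsub>B\<^esub> snd y)
          (Poly_Mapping.lookup p x * Poly_Mapping.lookup q y)),
     one = Poly_Mapping.single (\<one>\<^bsub>A\<^esub>, \<one>\<^bsub>B\<^esub>) 1,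
     zero = 0,
     add = (+)\<rparr>"

definition bilinear_rels :: "(bit, 'a) module \<Rightarrow> (bit, 'b) module \<Rightarrow> (('a \<times> 'b) \<Rightarrow>\<^sub>0 bit) set" where
  "bilinear_rels A B =
     {Poly_Mapping.single (a \<oplus>\<^bsub>A\<^esub> a', b) 1 - Poly_Mapping.single (a, b) 1
        - Poly_Mapping.single (a', b) 1
      | a a' b. a \<in> carrier A \<and> a' \<in> carrier A \<and> b \<in> carrier B} \<union>
     {Poly_Mapping.single (a, b \<oplus>\<^bsub>B\<^esub> b') 1 - Poly_Mapping.single (a, b) 1
        - Poly_Mapping.single (a, b') 1
      | a b b'. a \<in> carrier A \<and> b \<in> carrier B \<and> b' \<in> carrier B} \<union>
     {Poly_Mapping.single (c \<odot>\<^bsub>A\<^esub> a, b) 1 - Poly_Mapping.single (a, b) c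
      | c a b. c \<in> carrier F2 \<and> a \<in> carrier A \<and> b \<in> carrier B} \<union>
     {Poly_Mapping.single (a, c \<odot>\<^bsub>B\<^esub> b) 1 - Poly_Mapping.single (a, b) c
      | c a b. c \<in> carrier F2 \<and> a \<in> carrier A \<and> b \<in> carrier B}"

definition tensor_ideal :: "(bit, 'a) module \<Rightarrow> (bit, 'b) module \<Rightarrow> (('a \<times> 'b) \<Rightarrow>\<^sub>0 bit) set" where
  "tensor_ideal A B = Idl\<^bsub>free_alg A B\<^esub> (bilinear_rels A B)"

type_synonym ('a, 'b) tens = "(('a \<times> 'b) \<Rightarrow>\<^sub>0 bit) set"

definition tensor :: "(bit, 'a) module \<Rightarrow> (bit, 'b) module \<Rightarrow> (bit, ('a, 'b) tens) module" where
  "tensor A B = alg_of (free_alg A B Quot tensor_ideal A B)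
     (\<lambda>c. tensor_ideal A B +>\<^bsub>free_alg A B\<^esub> Poly_Mapping.single (\<one>\<^bsub>A\<^esub>, \<one>\<^bsub>B\<^esub>) c)"

definition pure :: "(bit, 'a) module \<Rightarrow> (bit, 'b) module \<Rightarrow> 'a \<Rightarrow> 'b \<Rightarrow> ('a, 'b) tens" where
  "pure A B a b = tensor_ideal A B +>\<^bsub>free_alg A B\<^esub> Poly_Mapping.single (a, b) 1"

definition tensor_inl :: "(bit, 'a) module \<Rightarrow> (bit, 'b) module \<Rightarrow> 'a \<Rightarrow> ('a, 'b) tens" where
  "tensor_inl A B = (\<lambda>a\<in>carrier A. pure A B a \<one>\<^bsub>B\<^esub>)"

definition tensor_inr :: "(bit, 'a) module \<Rightarrow> (bit, 'b) module \<Rightarrow> 'b \<Rightarrow> ('a, 'b) tens" where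
  "tensor_inr A B = (\<lambda>b\<in>carrier B. pure A B \<one>\<^bsub>A\<^esub> b)"

text \<open>
  In the next three definitions the morphism is determined by its values on pure tensors, which
  span the tensor product.
\<close>

definition tensor_pair :: "(bit, 'a) module \<Rightarrow> (bit, 'b) module \<Rightarrow> (bit, 'c) module \<Rightarrow>
    ('a \<Rightarrow> 'c) \<Rightarrow> ('b \<Rightarrow> 'c) \<Rightarrow> ('a, 'b) tens \<Rightarrow> 'c" where
  "tensor_pair A B C \<phi> \<psi> = (THE h. h \<in> alg_hom (tensor A B) C \<and>
     (\<forall>a\<in>carrier A. \<forall>b\<in>carrier B. h (pure A B a b) = \<phi> a \<otimes>\<^bsub>C\<^esub> \<psi> b))"

definition tensor_map :: "(bit, 'a) module \<Rightarrow> (bit, 'b) module \<Rightarrow> (bit, 'c) module \<Rightarrow>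
    (bit, 'd) module \<Rightarrow> ('a \<Rightarrow> 'c) \<Rightarrow> ('b \<Rightarrow> 'd) \<Rightarrow> ('a, 'b) tens \<Rightarrow> ('c, 'd) tens" where
  "tensor_map A B A' B' f g = (THE h. h \<in> alg_hom (tensor A B) (tensor A' B') \<and>
     (\<forall>a\<in>carrier A. \<forall>b\<in>carrier B. h (pure A B a b) = pure A' B' (f a) (g b)))"

definition tensor_assoc :: "(bit, 'a) module \<Rightarrow> (bit, 'b) module \<Rightarrow> (bit, 'c) module \<Rightarrow>
    (('a, 'b) tens, 'c) tens \<Rightarrow> ('a, ('b, 'c) tens) tens" where
  "tensor_assoc A B C =
     (THE h. h \<in> alg_hom (tensor (tensor A B) C) (tensor A (tensor B C)) \<and>
       (\<forall>a\<in>carrier A. \<forall>b\<in>carrier B. \<forall>c\<in>carrier C.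
          h (pure (tensor A B) C (pure A B a b) c) = pure A (tensor B C) a (pure B C b c)))"


section \<open>Graded bialgebras\<close>

definition graded_bialgebra :: "(nat \<Rightarrow> (bit, 'b) module) \<Rightarrow>
    (nat \<Rightarrow> nat \<Rightarrow> 'b \<Rightarrow> ('b, 'b) tens) \<Rightarrow> ('b \<Rightarrow> bit) \<Rightarrow> bool" where
  "graded_bialgebra B \<Delta> \<epsilon> \<longleftrightarrow>
     (\<forall>n. F2_algebra (B n)) \<and>
     (\<forall>i j. \<Delta> i j \<in> alg_hom (B (i + j)) (tensor (B i) (B j))) \<and>
     \<epsilon> \<in> alg_hom (B 0) F2 \<and>
     (\<forall>i j k. \<forall>b\<in>carrier (B (i + j + k)).
        tensor_assoc (B i) (B j) (B k)
          (tensor_map (B (i + j)) (B k) (tensor (B i) (B j)) (B k) (\<Delta> i j) (alg_id (B k))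
            (\<Delta> (i + j) k b)) =
        tensor_map (B i) (B (j + k)) (B i) (tensor (B j) (B k)) (alg_id (B i)) (\<Delta> j k)
          (\<Delta> i (j + k) b)) \<and>
     (\<forall>n. \<forall>b\<in>carrier (B n).
        tensor_map (B 0) (B n) F2 (B n) \<epsilon> (alg_id (B n)) (\<Delta> 0 n b) = pure F2 (B n) 1 b \<and>
        tensor_map (B n) (B 0) (B n) F2 (alg_id (B n)) \<epsilon> (\<Delta> n 0 b) = pure (B n) F2 b 1)"

definition connected_bialgebra :: "(nat \<Rightarrow> (bit, 'b) module) \<Rightarrow> bool" where
  "connected_bialgebra B \<longleftrightarrow> alg_iso (B 0) F2 \<noteq> {}"

text \<open>
  For \<open>B' n\<close> a subset of \<open>B n\<close>, the inclusion is \<^term>\<open>alg_id (B' n)\<close>; that it is a morphism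
  to \<open>B n\<close> says that \<open>B' n\<close> is contained in \<open>B n\<close>, with the induced operations.
\<close>

definition sub_graded_bialgebra :: "(nat \<Rightarrow> (bit, 'b) module) \<Rightarrow>
    (nat \<Rightarrow> nat \<Rightarrow> 'b \<Rightarrow> ('b, 'b) tens) \<Rightarrow> ('b \<Rightarrow> bit) \<Rightarrow> (nat \<Rightarrow> (bit, 'b) module) \<Rightarrow>
    (nat \<Rightarrow> nat \<Rightarrow> 'b \<Rightarrow> ('b, 'b) tens) \<Rightarrow> ('b \<Rightarrow> bit) \<Rightarrow> bool" where
  "sub_graded_bialgebra B' \<Delta>' \<epsilon>' B \<Delta> \<epsilon> \<longleftrightarrow>
     graded_bialgebra B' \<Delta>' \<epsilon>' \<and> graded_bialgebra B \<Delta> \<epsilon> \<and>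
     (\<forall>n. alg_id (B' n) \<in> alg_hom (B' n) (B n)) \<and>
     (\<forall>i j. \<forall>b\<in>carrier (B' (i + j)).
        tensor_map (B' i) (B' j) (B i) (B j) (alg_id (B' i)) (alg_id (B' j)) (\<Delta>' i j b)
          = \<Delta> i j b) \<and>
     (\<forall>b\<in>carrier (B' 0). \<epsilon>' b = \<epsilon> b)"


section \<open>Graded monoid functors\<close>

definition graded_monoid :: "(nat \<Rightarrow> 'x set) \<Rightarrow> ('x \<Rightarrow> 'x \<Rightarrow> 'x) \<Rightarrow> 'x \<Rightarrow> bool" where
  "graded_monoid X m e \<longleftrightarrow>
     e \<in> X 0 \<and>
     (\<forall>i j. \<forall>x\<in>X i. \<forall>y\<in>X j. m x y \<in> X (i + j)) \<and>
     (\<forall>i j k. \<forall>x\<in>X i. \<forall>y\<in>X j. \<forall>z\<in>X k. m (m x y) z = m x (m y z)) \<and>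
     (\<forall>i. \<forall>x\<in>X i. m e x = x \<and> m x e = x)"

text \<open>
  The data of a graded monoid functor on the category of those algebras whose carrier lies in the
  type \<open>'a\<close>. The type plays the role of a universe: it is arbitrary, and any set of algebras
  is, up to isomorphism, contained in one such type. For each algebra, \<open>gm_mult\<close> is a single function
  which restricts to the products in all pairs of degrees.
\<close>

record ('a, 'x) gm_functor =
  gm_obj :: "(bit, 'a) module \<Rightarrow> nat \<Rightarrow> 'x set"
  gm_map :: "(bit, 'a) module \<Rightarrow> ('a \<Rightarrow> 'a) \<Rightarrow> 'x \<Rightarrow> 'x"
  gm_mult :: "(bit, 'a) module \<Rightarrow> 'x \<Rightarrow> 'x \<Rightarrow> 'x"
  gm_unit :: "(bit, 'a) module \<Rightarrow> 'x"

definition graded_monoid_functor :: "('a, 'x) gm_functor \<Rightarrow> bool" where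
  "graded_monoid_functor F \<longleftrightarrow>
     (\<forall>A. F2_algebra A \<longrightarrow> graded_monoid (gm_obj F A) (gm_mult F A) (gm_unit F A)) \<and>
     (\<forall>A A'. F2_algebra A \<longrightarrow> F2_algebra A' \<longrightarrow> (\<forall>f\<in>alg_hom A A'.
        (\<forall>n. \<forall>x\<in>gm_obj F A n. gm_map F A f x \<in> gm_obj F A' n) \<and>
        (\<forall>i j. \<forall>x\<in>gm_obj F A i. \<forall>y\<in>gm_obj F A j.
           gm_map F A f (gm_mult F A x y) = gm_mult F A' (gm_map F A f x) (gm_map F A f y)) \<and>
        gm_map F A f (gm_unit F A) = gm_unit F A')) \<and>
     (\<forall>A. F2_algebra A \<longrightarrow> (\<forall>n. \<forall>x\<in>gm_obj F A n. gm_map F A (alg_id A) x = x)) \<and>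
     (\<forall>A A' A''. F2_algebra A \<longrightarrow> F2_algebra A' \<longrightarrow> F2_algebra A'' \<longrightarrow>
        (\<forall>f\<in>alg_hom A A'. \<forall>g\<in>alg_hom A' A''. \<forall>n. \<forall>x\<in>gm_obj F A n.
           gm_map F A (compose (carrier A) g f) x = gm_map F A' g (gm_map F A f x)))"

text \<open>\<open>F\<close> is a subfunctor of \<open>G\<close>, so that there is an inclusion of graded monoid functors.\<close>

definition gm_subfunctor :: "('a, 'x) gm_functor \<Rightarrow> ('a, 'x) gm_functor \<Rightarrow> bool" where
  "gm_subfunctor F G \<longleftrightarrow>
     (\<forall>A. F2_algebra A \<longrightarrow>
        (\<forall>n. gm_obj F A n \<subseteq> gm_obj G A n) \<and>
        gm_unit F A = gm_unit G A \<and>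
        (\<forall>i j. \<forall>x\<in>gm_obj F A i. \<forall>y\<in>gm_obj F A j. gm_mult F A x y = gm_mult G A x y)) \<and>
     (\<forall>A A'. F2_algebra A \<longrightarrow> F2_algebra A' \<longrightarrow> (\<forall>f\<in>alg_hom A A'.
        \<forall>n. \<forall>x\<in>gm_obj F A n. gm_map F A f x = gm_map G A f x))"

text \<open>
  \<open>\<Phi> A n\<close> is the natural bijection from the algebra morphisms \<open>B n \<rightarrow> A\<close> to the degree \<open>n\<close> part of \<open>F A\<close>.
  In the last clause the first tensor factor corresponds to the right factor of the product
  (the inner polynomial).
\<close>

definition represents :: "(nat \<Rightarrow> (bit, 'b) module) \<Rightarrow>
    (nat \<Rightarrow> nat \<Rightarrow> 'b \<Rightarrow> ('b, 'b) tens) \<Rightarrow> ('b \<Rightarrow> bit) \<Rightarrow>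
    ((bit, 'a) module \<Rightarrow> nat \<Rightarrow> ('b \<Rightarrow> 'a) \<Rightarrow> 'x) \<Rightarrow> ('a, 'x) gm_functor \<Rightarrow> bool" where
  "represents B \<Delta> \<epsilon> \<Phi> F \<longleftrightarrow>
     (\<forall>A. F2_algebra A \<longrightarrow> (\<forall>n. bij_betw (\<Phi> A n) (alg_hom (B n) A) (gm_obj F A n))) \<and>
     (\<forall>A A'. F2_algebra A \<longrightarrow> F2_algebra A' \<longrightarrow>
        (\<forall>f\<in>alg_hom A A'. \<forall>n. \<forall>\<phi>\<in>alg_hom (B n) A.
           \<Phi> A' n (compose (carrier (B n)) f \<phi>) = gm_map F A f (\<Phi> A n \<phi>))) \<and>
     (\<forall>A. F2_algebra A \<longrightarrow>
        \<Phi> A 0 (compose (carrier (B 0)) (alg_unit A) \<epsilon>) = gm_unit F A) \<and>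
     (\<forall>A. F2_algebra A \<longrightarrow>
        (\<forall>i j. \<forall>\<phi>\<in>alg_hom (B i) A. \<forall>\<psi>\<in>alg_hom (B j) A.
           \<Phi> A (i + j)
             (compose (carrier (B (i + j))) (tensor_pair (B i) (B j) A \<phi> \<psi>) (\<Delta> i j)) =
           gm_mult F A (\<Phi> A j \<psi>) (\<Phi> A i \<phi>)))"

text \<open>
  The natural transformation represented by the inclusions of \<open>B' n\<close> in \<open>B n\<close> is the inclusion of the
  functor represented via \<open>\<Phi>\<close> in the functor represented via \<open>\<Phi>'\<close>.
\<close>

definition represents_inclusion :: "(nat \<Rightarrow> (bit, 'b) module) \<Rightarrow>
    ((bit, 'a) module \<Rightarrow> nat \<Rightarrow> ('b \<Rightarrow> 'a) \<Rightarrow> 'x) \<Rightarrow> (nat \<Rightarrow> (bit, 'b) module) \<Rightarrow>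
    ((bit, 'a) module \<Rightarrow> nat \<Rightarrow> ('b \<Rightarrow> 'a) \<Rightarrow> 'x) \<Rightarrow> bool" where
  "represents_inclusion B' \<Phi>' B \<Phi> \<longleftrightarrow>
     (\<forall>A. F2_algebra A \<longrightarrow> (\<forall>n. \<forall>\<phi>\<in>alg_hom (B n) A.
        \<Phi>' A n (compose (carrier (B' n)) \<phi> (alg_id (B' n))) = \<Phi> A n \<phi>))"


section \<open>Additive polynomials under composition\<close>

definition up_compose :: "(bit, 'a) module \<Rightarrow> (nat \<Rightarrow> 'a) \<Rightarrow> (nat \<Rightarrow> 'a) \<Rightarrow> nat \<Rightarrow> 'a" where
  "up_compose A f g = eval A (UP A) (\<lambda>a. monom (UP A) a 0) g f"

definition up_map :: "(bit, 'a) module \<Rightarrow> ('a \<Rightarrow> 'b) \<Rightarrow> (nat \<Rightarrow> 'a) \<Rightarrow> nat \<Rightarrow> 'b" where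
  "up_map A f p = (\<lambda>k. f (coeff (UP A) p k))"

definition up_X :: "(bit, 'a) module \<Rightarrow> nat \<Rightarrow> 'a" where
  "up_X A = monom (UP A) \<one>\<^bsub>A\<^esub> 1"

definition additive_poly :: "(bit, 'a) module \<Rightarrow> nat \<Rightarrow> (nat \<Rightarrow> 'a) \<Rightarrow> nat \<Rightarrow> 'a" where
  "additive_poly A n a = (\<Oplus>\<^bsub>UP A\<^esub>i\<in>{0..n}. monom (UP A) (a i) (2 ^ i))"

definition M_plus_set :: "(bit, 'a) module \<Rightarrow> nat \<Rightarrow> (nat \<Rightarrow> 'a) set" where
  "M_plus_set A n = {additive_poly A n a | a. (\<forall>i\<le>n. a i \<in> carrier A) \<and> a 0 = \<one>\<^bsub>A\<^esub>}"

definition M_set :: "(bit, 'a) module \<Rightarrow> nat \<Rightarrow> (nat \<Rightarrow> 'a) set" where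
  "M_set A n = {additive_poly A n a | a.
     (\<forall>i\<le>n. a i \<in> carrier A) \<and> a 0 = \<one>\<^bsub>A\<^esub> \<and> a n \<in> Units A}"

definition M_plus :: "('a, nat \<Rightarrow> 'a) gm_functor" where
  "M_plus = \<lparr>gm_obj = M_plus_set, gm_map = up_map, gm_mult = up_compose, gm_unit = up_X\<rparr>"

definition M :: "('a, nat \<Rightarrow> 'a) gm_functor" where
  "M = \<lparr>gm_obj = M_set, gm_map = up_map, gm_mult = up_compose, gm_unit = up_X\<rparr>"


section \<open>The representing bialgebras\<close>

text \<open>
  The type of Laurent polynomials over \<^const>\<open>F2\<close> in countably many variables; the monomial
  \<open>m\<close> has exponent \<^term>\<open>Poly_Mapping.lookup m i\<close> at the variable with index \<open>i\<close>.
\<close>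

type_synonym laurent = "(nat \<Rightarrow>\<^sub>0 int) \<Rightarrow>\<^sub>0 bit"

definition laurent_subalg :: "laurent set \<Rightarrow> (bit, laurent) module" where
  "laurent_subalg S = \<lparr>carrier = S, mult = (*), one = 1, zero = 0, add = (+),
     smult = (\<lambda>c p. Poly_Mapping.single 0 c * p)\<rparr>"

definition B :: "nat \<Rightarrow> (bit, laurent) module" where
  "B n = laurent_subalg {p. \<forall>m\<in>Poly_Mapping.keys p.
     Poly_Mapping.keys m \<subseteq> {1..n} \<and> (\<forall>i<n. Poly_Mapping.lookup m i \<ge> 0)}"

definition B_plus :: "nat \<Rightarrow> (bit, laurent) module" where
  "B_plus n = laurent_subalg {p. \<forall>m\<in>Poly_Mapping.keys p.
     Poly_Mapping.keys m \<subseteq> {1..n} \<and> (\<forall>i. Poly_Mapping.lookup m i \<ge> 0)}"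

definition \<alpha> :: "nat \<Rightarrow> laurent" where
  "\<alpha> i = (if i = 0 then 1 else Poly_Mapping.single (Poly_Mapping.single i 1) 1)"

text \<open>
  In the following definitions \<open>C\<close> is \<^const>\<open>B\<close> or \<^const>\<open>B_plus\<close>. A morphism \<open>C n \<rightarrow> A\<close> classifies the
  image of the universal polynomial.
\<close>

definition univ_poly :: "(nat \<Rightarrow> (bit, laurent) module) \<Rightarrow> nat \<Rightarrow> nat \<Rightarrow> laurent" where
  "univ_poly C n = additive_poly (C n) n \<alpha>"

definition classified :: "(nat \<Rightarrow> (bit, laurent) module) \<Rightarrow> (bit, 'a) module \<Rightarrow> nat \<Rightarrow>
    (laurent \<Rightarrow> 'a) \<Rightarrow> nat \<Rightarrow> 'a" where
  "classified C A n \<phi> = up_map (C n) \<phi> (univ_poly C n)"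

text \<open>
  The coproduct is the morphism which classifies the composite of the two universal polynomials over
  the tensor product, that of the first factor being the inner one. On the generators it is given by
  \<open>\<Delta> (\<alpha> k) = (\<Sum> s + t = k. \<alpha> s ^ (2 ^ t) \<otimes> \<alpha> t)\<close>, with \<open>s \<le> i\<close> and \<open>t \<le> j\<close>.
\<close>

definition comult :: "(nat \<Rightarrow> (bit, laurent) module) \<Rightarrow> nat \<Rightarrow> nat \<Rightarrow>
    laurent \<Rightarrow> (laurent, laurent) tens" where
  "comult C i j = (THE \<Delta>. \<Delta> \<in> alg_hom (C (i + j)) (tensor (C i) (C j)) \<and>
     classified C (tensor (C i) (C j)) (i + j) \<Delta> =
     up_compose (tensor (C i) (C j))
       (classified C (tensor (C i) (C j)) j (tensor_inr (C i) (C j)))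
       (classified C (tensor (C i) (C j)) i (tensor_inl (C i) (C j))))"

definition counit :: "(nat \<Rightarrow> (bit, laurent) module) \<Rightarrow> laurent \<Rightarrow> bit" where
  "counit C = (THE \<epsilon>. \<epsilon> \<in> alg_hom (C 0) F2 \<and> classified C F2 0 \<epsilon> = up_X F2)"


section \<open>Algebras graded by the integers\<close>

definition graded_algebra :: "(bit, 'a) module \<Rightarrow> (int \<Rightarrow> 'a set) \<Rightarrow> bool" where
  "graded_algebra A G \<longleftrightarrow>
     F2_algebra A \<and>
     (\<forall>d. submodule (G d) F2 A) \<and>
     (\<forall>a\<in>carrier A. \<exists>!c. (\<forall>d. c d \<in> G d) \<and> finite {d. c d \<noteq> \<zero>\<^bsub>A\<^esub>} \<and>
        a = (\<Oplus>\<^bsub>A\<^esub>d\<in>{d. c d \<noteq> \<zero>\<^bsub>A\<^esub>}. c d)) \<and>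
     \<one>\<^bsub>A\<^esub> \<in> G 0 \<and>
     (\<forall>d e. \<forall>a\<in>G d. \<forall>b\<in>G e. a \<otimes>\<^bsub>A\<^esub> b \<in> G (d + e))"

definition coconnected :: "(bit, 'a) module \<Rightarrow> (int \<Rightarrow> 'a set) \<Rightarrow> bool" where
  "coconnected A G \<longleftrightarrow> (\<forall>d>0. G d = {\<zero>\<^bsub>A\<^esub>}) \<and> bij_betw (alg_unit A) (carrier F2) (G 0)"

text \<open>Homogeneity of a polynomial in one variable of degree \<open>1\<close>.\<close>

definition homogeneous_poly :: "(bit, 'a) module \<Rightarrow> (int \<Rightarrow> 'a set) \<Rightarrow> int \<Rightarrow> (nat \<Rightarrow> 'a) \<Rightarrow> bool"
  where
  "homogeneous_poly A G d p \<longleftrightarrow> p \<in> carrier (UP A) \<and> (\<forall>k. coeff (UP A) p k \<in> G (d - int k))"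


section \<open>Localization\<close>

text \<open>The localization of \<open>A\<close> which inverts \<open>s\<close>, as the quotient of \<open>A[T]\<close> by \<open>s T - 1\<close>.\<close>

definition loc_ideal :: "(bit, 'a) module \<Rightarrow> 'a \<Rightarrow> (nat \<Rightarrow> 'a) set" where
  "loc_ideal A s = PIdl\<^bsub>UP A\<^esub> (monom (UP A) s 1 \<ominus>\<^bsub>UP A\<^esub> \<one>\<^bsub>UP A\<^esub>)"

definition loc_map :: "(bit, 'a) module \<Rightarrow> 'a \<Rightarrow> 'a \<Rightarrow> (nat \<Rightarrow> 'a) set" where
  "loc_map A s a = loc_ideal A s +>\<^bsub>UP A\<^esub> monom (UP A) a 0"

definition localization :: "(bit, 'a) module \<Rightarrow> 'a \<Rightarrow> (bit, (nat \<Rightarrow> 'a) set) module" where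
  "localization A s = alg_of (UP A Quot loc_ideal A s) (\<lambda>c. loc_map A s (alg_unit A c))"

end

(*
A morphism B_n -> A is determined by the images of the generators alpha_1, ..., alpha_n, and these
may be prescribed arbitrarily as long as alpha_n goes to a unit; so B_n represents M_n. Over a ring
of characteristic 2 the composite of additive polynomials is additive, with leading coefficient
a_n b_m^(2^n), so composition gives a graded monoid. The bialgebra axioms are proved by the Yoneda
principle: two morphisms out of B_n agree as soon as they classify the same polynomial, and the two
sides of each axiom classify the same iterated composite over the (triple) tensor product. The
isomorphism with the localization is obtained by playing the universal properties of B_n and of the
localization against each other.
*)

theory Submission
  imports Defs
begin

section \<open>Algebras over the field with two elements\<close>

text \<open>Over the field with two elements a formal sum is the indicator of its finite support.
  Scalars therefore disappear from almost every argument, and additivity is proved by adjoining one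
  basis element at a time, where an element that is already present cancels. This serves both the
  monoid algebra that presents a tensor product and the Laurent polynomials. The maps between tensor
  products, the coproduct and the counit are definite descriptions: nothing can be said about them
  until the morphism described is known to exist and to be unique. For tensor products this comes
  from the presentation by generators and relations. For coproduct and counit it comes from the
  bijection between morphisms and polynomials, which is therefore proved for algebras over arbitrary
  types and not only over the type \<open>'a\<close> of the theorem: the Yoneda argument takes
  tensor products as test algebras.\<close>

lemma cring_F2: "cring F2"
proof (rule cringI)
  show "abelian_group F2"
    by (rule abelian_groupI) (auto simp: F2_def ac_simps intro: exI[of _ "- x" for x])
  show "Group.comm_monoid F2"
    by (rule comm_monoidI) (auto simp: F2_def)
qed (auto simp: F2_def algebra_simps)

lemma bit_cases: "(c::bit) = 0 \<or> c = 1"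
  by (cases c) auto

text \<open>\<open>algebra F2 A\<close> has two rings as structures. Here \<open>A\<close> is the
  only implicit structure, so ring notation and ring lemmas refer to it directly.\<close>

locale f2_algebra = cring A for A :: "(bit, 'a) module" (structure) +
  assumes F2_algebra: "F2_algebra A"
begin

text \<open>The only scalars are 0 and 1, so the module structure carries no information beyond the
  ring structure.\<close>

lemma smult_eq: "a \<in> carrier A \<Longrightarrow> c \<odot> a = (if c = 1 then a else \<zero>)"
proof -
  assume a: "a \<in> carrier A"
  interpret algebra F2 A by (rule F2_algebra)
  show ?thesis
    using bit_cases[of c] smult_l_null[OF a] smult_one[OF a] by (auto simp: F2_def)
qed

lemma add_self: "a \<in> carrier A \<Longrightarrow> a \<oplus> a = \<zero>"
proof -
  assume a: "a \<in> carrier A"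
  interpret algebra F2 A by (rule F2_algebra)
  have "(1 + 1 :: bit) \<odot> a = a \<oplus> a"
    using smult_l_distr[of 1 1 a] smult_one[OF a] a by (simp add: F2_def)
  then show ?thesis
    using smult_l_null[OF a] by (simp add: F2_def)
qed

lemma minus_eq_self: "a \<in> carrier A \<Longrightarrow> \<ominus> a = a"
  by (simp add: add_self minus_equality)

end

lemma f2_algebraI: "F2_algebra A \<Longrightarrow> f2_algebra A"
  by (simp add: f2_algebra.intro f2_algebra_axioms.intro algebra.M_cring)

text \<open>Converse to \<open>smult_eq\<close> and \<open>add_self\<close>: the module laws reduce
  to a case distinction on scalars, in which 1 + 1 = 0 is matched by characteristic two.\<close>

lemma F2_algebraI:
  assumes "cring A" "\<And>a. a \<in> carrier A \<Longrightarrow> a \<oplus>\<^bsub>A\<^esub> a = \<zero>\<^bsub>A\<^esub>"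
    and sm: "\<And>c a. a \<in> carrier A \<Longrightarrow> c \<odot>\<^bsub>A\<^esub> a = (if c = 1 then a else \<zero>\<^bsub>A\<^esub>)"
  shows "F2_algebra A"
proof -
  interpret cring A by fact
  show ?thesis
  proof (rule algebraI[OF cring_F2 \<open>cring A\<close>])
    fix c d :: bit and x assume x: "x \<in> carrier A"
    show "(c \<oplus>\<^bsub>F2\<^esub> d) \<odot>\<^bsub>A\<^esub> x = c \<odot>\<^bsub>A\<^esub> x \<oplus>\<^bsub>A\<^esub> d \<odot>\<^bsub>A\<^esub> x"
      using x assms(2) bit_cases[of c] bit_cases[of d] by (auto simp: sm F2_def)
    show "(c \<otimes>\<^bsub>F2\<^esub> d) \<odot>\<^bsub>A\<^esub> x = c \<odot>\<^bsub>A\<^esub> (d \<odot>\<^bsub>A\<^esub> x)"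
      using x bit_cases[of c] bit_cases[of d] by (auto simp: sm F2_def)
  qed (auto simp: sm F2_def)
qed

lemma F2_algebra_F2: "F2_algebra F2"
proof (rule F2_algebraI[OF cring_F2])
  show "c \<odot>\<^bsub>F2\<^esub> a = (if c = 1 then a else \<zero>\<^bsub>F2\<^esub>)" for c a
    using bit_cases[of c] by (auto simp: F2_def)
qed (auto simp: F2_def)

text \<open>Compatibility with the scalars 0 and 1 is preservation of zero and a triviality, so
  linearity never has to be checked by hand.\<close>

lemma alg_hom_iff:
  assumes "F2_algebra A" "F2_algebra A'"
  shows "f \<in> alg_hom A A' \<longleftrightarrow> f \<in> ring_hom A A' \<and> f \<in> extensional (carrier A)"
proof -
  interpret A: f2_algebra A by (rule f2_algebraI) fact
  interpret A': f2_algebra A' by (rule f2_algebraI) fact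
  have "f (c \<odot>\<^bsub>A\<^esub> a) = c \<odot>\<^bsub>A'\<^esub> f a" if "f \<in> ring_hom A A'" "a \<in> carrier A" for c a
    using that ring_hom_zero[OF that(1) A.ring_axioms A'.ring_axioms]
    by (simp add: A.smult_eq A'.smult_eq ring_hom_closed)
  then show ?thesis
    by (auto simp: alg_hom_def)
qed

lemma alg_hom_ring_hom: "f \<in> alg_hom A A' \<Longrightarrow> f \<in> ring_hom A A'"
  by (simp add: alg_hom_def)

lemma alg_hom_closed: "f \<in> alg_hom A A' \<Longrightarrow> a \<in> carrier A \<Longrightarrow> f a \<in> carrier A'"
  by (rule ring_hom_closed[OF alg_hom_ring_hom])

lemma alg_hom_eqI:
  assumes "f \<in> alg_hom A A'" "g \<in> alg_hom A A'" "\<And>a. a \<in> carrier A \<Longrightarrow> f a = g a"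
  shows "f = g"
  using assms by (auto simp: alg_hom_def intro: extensionalityI)

lemma alg_hom_compose:
  assumes "f \<in> alg_hom A A'" "g \<in> alg_hom A' A''"
    "F2_algebra A"
  shows "compose (carrier A) g f \<in> alg_hom A A''"
proof -
  interpret f2_algebra A by (rule f2_algebraI) fact
  have "compose (carrier A) g f \<in> ring_hom A A''"
    using assms(1,2)[THEN alg_hom_ring_hom]
    by (auto intro!: ring_hom_memI simp: compose_def ring_hom_closed ring_hom_add ring_hom_mult ring_hom_one)
  moreover have "c \<odot>\<^bsub>A\<^esub> a \<in> carrier A" if "a \<in> carrier A" for c a
    using that by (simp add: smult_eq)
  ultimately show ?thesis
    using assms(1,2) ring_hom_closed[of f A A']
    by (auto simp: alg_hom_def compose_eq)
qed

lemma alg_hom_alg_id: "F2_algebra A \<Longrightarrow> alg_id A \<in> alg_hom A A"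
proof -
  assume A: "F2_algebra A"
  then interpret f2_algebra A by (rule f2_algebraI)
  show ?thesis
    using A by (auto simp: alg_hom_iff alg_id_def intro!: ring_hom_memI)
qed

lemma alg_id_apply [simp]: "a \<in> carrier A \<Longrightarrow> alg_id A a = a"
  by (simp add: alg_id_def)

lemma ring_hom_cring_alg_hom:
  assumes "F2_algebra A" "F2_algebra A'" "f \<in> alg_hom A A'"
  shows "ring_hom_cring A A' f"
proof -
  interpret A: f2_algebra A by (rule f2_algebraI) fact
  interpret A': f2_algebra A' by (rule f2_algebraI) fact
  show ?thesis
    by unfold_locales (use assms(3) alg_hom_ring_hom in blast)
qed

lemma (in f2_algebra) alg_hom_alg_unit: "alg_unit A \<in> alg_hom F2 A"
proof -
  have "alg_unit A \<in> ring_hom F2 A"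
  proof (rule ring_hom_memI)
    fix c d :: bit
    show "alg_unit A (c \<otimes>\<^bsub>F2\<^esub> d) = alg_unit A c \<otimes> alg_unit A d"
      using bit_cases[of c] bit_cases[of d] by (auto simp: alg_unit_def smult_eq F2_def)
    show "alg_unit A (c \<oplus>\<^bsub>F2\<^esub> d) = alg_unit A c \<oplus> alg_unit A d"
      using bit_cases[of c] bit_cases[of d] by (auto simp: alg_unit_def smult_eq F2_def add_self)
  qed (auto simp: alg_unit_def smult_eq F2_def)
  then show ?thesis
    by (simp add: alg_hom_iff F2_algebra F2_algebra_F2) (simp add: F2_def extensional_def)
qed

text \<open>Serves both quotient constructions, the tensor product and the localization.
  Characteristic two is tested at the identity only, because a + a = (1 + 1) a.\<close>

lemma F2_algebra_alg_of:
  assumes "cring R" "\<eta> 1 = \<one>\<^bsub>R\<^esub>" "\<eta> 0 = \<zero>\<^bsub>R\<^esub>" "\<one>\<^bsub>R\<^esub> \<oplus>\<^bsub>R\<^esub> \<one>\<^bsub>R\<^esub> = \<zero>\<^bsub>R\<^esub>"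
  shows "F2_algebra (alg_of R \<eta>)"
proof -
  interpret cring R by fact
  have dbl: "a \<oplus>\<^bsub>R\<^esub> a = \<zero>\<^bsub>R\<^esub>" if "a \<in> carrier R" for a
  proof -
    have "a \<oplus>\<^bsub>R\<^esub> a = (\<one>\<^bsub>R\<^esub> \<oplus>\<^bsub>R\<^esub> \<one>\<^bsub>R\<^esub>) \<otimes>\<^bsub>R\<^esub> a"
      using that by (simp add: l_distr del: assms(4))
    then show ?thesis using that by (simp add: assms(4))
  qed
  show ?thesis
  proof (rule F2_algebraI)
    show "cring (alg_of R \<eta>)"
    proof (rule cringI)
      show "abelian_group (alg_of R \<eta>)"
        by (rule abelian_groupI) (auto simp: alg_of_def a_ac intro: l_neg)
      show "Group.comm_monoid (alg_of R \<eta>)"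
        by (rule comm_monoidI) (auto simp: alg_of_def m_ac)
    qed (auto simp: alg_of_def l_distr)
    show "c \<odot>\<^bsub>alg_of R \<eta>\<^esub> a = (if c = 1 then a else \<zero>\<^bsub>alg_of R \<eta>\<^esub>)"
      if "a \<in> carrier (alg_of R \<eta>)" for c a
      using that bit_cases[of c] assms(2,3) by (auto simp: alg_of_def)
  qed (auto simp: alg_of_def dbl)
qed

lemma carrier_alg_of [simp]: "carrier (alg_of R \<eta>) = carrier R"
  by (simp add: alg_of_def)

lemma ring_hom_alg_of [simp]:
  "ring_hom (alg_of R \<eta>) S = ring_hom R S" "ring_hom S (alg_of R \<eta>) = ring_hom S R"
  by (auto simp: alg_of_def ring_hom_def)


section \<open>Formal sums with coefficients in the field with two elements\<close>

text \<open>Addition is symmetric difference of supports; this is the case of a singleton.\<close>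

lemma keys_add_single:
  fixes p :: "'k \<Rightarrow>\<^sub>0 bit"
  shows "Poly_Mapping.keys (p + Poly_Mapping.single x 1) =
    (if x \<in> Poly_Mapping.keys p then Poly_Mapping.keys p - {x} else insert x (Poly_Mapping.keys p))"
proof -
  have "lookup p x = 0 \<or> lookup p x = 1" for lookup :: "('k \<Rightarrow>\<^sub>0 bit) \<Rightarrow> 'k \<Rightarrow> bit"
    by (rule bit_cases)
  from this[of Poly_Mapping.lookup] show ?thesis
    by (auto simp: in_keys_iff lookup_add lookup_single when_def split: if_splits)
qed

lemma poly_mapping_bit_add_self [simp]: "p + p = (0 :: 'k \<Rightarrow>\<^sub>0 bit)"
  by (rule poly_mapping_eqI) (simp add: lookup_add)

lemma poly_mapping_bit_uminus [simp]: "- p = (p :: 'k \<Rightarrow>\<^sub>0 bit)"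
  by (rule minus_unique) simp

lemma poly_mapping_bit_minus: "p - q = p + (q :: 'k \<Rightarrow>\<^sub>0 bit)"
  by (simp add: diff_conv_add_uminus del: add_uminus_conv_diff)

text \<open>The step allows \<open>x\<close> to occur in \<open>p\<close> already, so it is to be
  proved from formulas for adding a basis element that hold whether or not the element
  cancels.\<close>

lemma poly_mapping_bit_induct [consumes 1, case_names zero add]:
  fixes p :: "'k \<Rightarrow>\<^sub>0 bit"
  assumes "Poly_Mapping.keys p \<subseteq> S" "P 0"
    "\<And>p x. Poly_Mapping.keys p \<subseteq> S \<Longrightarrow> x \<in> S \<Longrightarrow> P p \<Longrightarrow> P (p + Poly_Mapping.single x 1)"
  shows "P p"
proof -
  have "\<forall>p :: 'k \<Rightarrow>\<^sub>0 bit. Poly_Mapping.keys p = K \<longrightarrow> K \<subseteq> S \<longrightarrow> P p" if "finite K" for K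
    using that
  proof (induction K rule: finite_induct)
    case empty
    then show ?case using assms(2) by (simp add: keys_eq_empty)
  next
    case (insert x K)
    show ?case
    proof (intro allI impI)
      fix p :: "'k \<Rightarrow>\<^sub>0 bit" assume p: "Poly_Mapping.keys p = insert x K" "insert x K \<subseteq> S"
      \<comment> \<open>Adding \<open>x\<close> removes it from the support; adding it a second time
        restores \<open>p\<close>, because twice a basis element is zero.\<close>
      have "Poly_Mapping.keys (p + Poly_Mapping.single x 1) = K"
        using p insert.hyps by (auto simp: keys_add_single)
      with p insert.IH have "P (p + Poly_Mapping.single x 1)" "Poly_Mapping.keys (p + Poly_Mapping.single x 1) \<subseteq> S"
        by auto
      with p have "P ((p + Poly_Mapping.single x 1) + Poly_Mapping.single x 1)"
        by (intro assms(3)[of "p + Poly_Mapping.single x 1"]) auto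
      then show "P p" by (simp add: add.assoc)
    qed
  qed
  then show ?thesis using assms(1) finite_keys by blast
qed

lemma keys_add_bit:
  "Poly_Mapping.keys p \<subseteq> S \<Longrightarrow> Poly_Mapping.keys q \<subseteq> S \<Longrightarrow> Poly_Mapping.keys (p + q :: 'k \<Rightarrow>\<^sub>0 bit) \<subseteq> S"
  using Poly_Mapping.keys_add by fastforce

section \<open>Linear extension of a map given on a basis\<close>

context f2_algebra
begin

text \<open>All coefficients on the support are 1, so the linear extension of \<open>h\<close> has
  no coefficients to multiply by.\<close>

definition lin :: "('k \<Rightarrow> 'a) \<Rightarrow> ('k \<Rightarrow>\<^sub>0 bit) \<Rightarrow> 'a" where
  "lin h p = (\<Oplus>x\<in>Poly_Mapping.keys p. h x)"

lemma lin_zero [simp]: "lin h 0 = \<zero>"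
  by (simp add: lin_def)

lemma lin_closed: "h \<in> S \<rightarrow> carrier A \<Longrightarrow> Poly_Mapping.keys p \<subseteq> S \<Longrightarrow> lin h p \<in> carrier A"
  unfolding lin_def by (rule finsum_closed) auto

lemma lin_single: "h x \<in> carrier A \<Longrightarrow> lin h (Poly_Mapping.single x 1) = h x"
  by (simp add: lin_def)

lemma lin_add_single:
  assumes h: "h \<in> S \<rightarrow> carrier A" and p: "Poly_Mapping.keys p \<subseteq> S" "x \<in> S"
  shows "lin h (p + Poly_Mapping.single x 1) = lin h p \<oplus> h x"
proof (cases "x \<in> Poly_Mapping.keys p")
  case True
  let ?K = "Poly_Mapping.keys p - {x}"
  have K: "h \<in> ?K \<rightarrow> carrier A" "h x \<in> carrier A" using assms by auto
  have "lin h p = h x \<oplus> finsum A h ?K"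
    unfolding lin_def using True K finsum_insert[of ?K x h] by (simp add: insert_absorb)
  \<comment> \<open>The two copies of \<open>h x\<close> cancel in characteristic two, just as
    \<open>x\<close> cancels in the support.\<close>
  then have "lin h p \<oplus> h x = finsum A h ?K"
    using K by (simp add: a_ac add_self finsum_closed)
      (metis a_assoc add_self finsum_closed r_zero)
  then show ?thesis
    using True by (simp add: lin_def keys_add_single)
next
  case False
  have K: "h \<in> Poly_Mapping.keys p \<rightarrow> carrier A" "h x \<in> carrier A" using assms by auto
  show ?thesis
    using False K by (simp add: lin_def keys_add_single finsum_insert finsum_closed a_comm)
qed

lemma lin_add:
  assumes h: "h \<in> S \<rightarrow> carrier A" and p: "Poly_Mapping.keys p \<subseteq> S" and q: "Poly_Mapping.keys q \<subseteq> S"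
  shows "lin h (p + q) = lin h p \<oplus> lin h q"
  using q
proof (induction q rule: poly_mapping_bit_induct)
  case zero
  then show ?case using lin_closed[OF h p] by simp
next
  case (add q x)
  have "lin h (p + q + Poly_Mapping.single x 1) = lin h p \<oplus> lin h q \<oplus> h x"
    using add p by (simp add: lin_add_single[OF h] keys_add_bit)
  then show ?case
    using add p funcset_mem[OF h] lin_closed[OF h]
    by (simp add: lin_add_single[OF h] a_assoc add.assoc[symmetric])
qed

text \<open>The product \<open>m\<close> is a parameter because the lemma is applied to two products
  of different origin: that of \<open>free_alg\<close> and the multiplication of Laurent
  polynomials. Of \<open>m\<close> it asks additivity and the values on basis elements, just enough
  for an induction on the left factor against one basis element, followed by an induction on the
  right factor.\<close>

lemma lin_mult:
  assumes h: "h \<in> S \<rightarrow> carrier A"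
    and hm: "\<And>x y. x \<in> S \<Longrightarrow> y \<in> S \<Longrightarrow> op x y \<in> S \<and> h (op x y) = h x \<otimes> h y"
    and mr: "\<And>p q x. Poly_Mapping.keys p \<subseteq> S \<Longrightarrow> Poly_Mapping.keys q \<subseteq> S \<Longrightarrow> x \<in> S \<Longrightarrow>
      m p (q + Poly_Mapping.single x 1) = m p q + m p (Poly_Mapping.single x 1)"
    and ml: "\<And>p x y. Poly_Mapping.keys p \<subseteq> S \<Longrightarrow> x \<in> S \<Longrightarrow> y \<in> S \<Longrightarrow>
      m (p + Poly_Mapping.single x 1) (Poly_Mapping.single y 1) =
        m p (Poly_Mapping.single y 1) + Poly_Mapping.single (op x y) 1"
    and m0: "\<And>p. m p 0 = 0" "\<And>p. m 0 p = 0"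
    and pq: "Poly_Mapping.keys p \<subseteq> S" "Poly_Mapping.keys q \<subseteq> S"
  shows "lin h (m p q) = lin h p \<otimes> lin h q"
proof -
  \<comment> \<open>The bound on the support is carried through the induction, since additivity of
    \<open>lin h\<close> is known only for supports inside \<open>S\<close>.\<close>
  have 1: "Poly_Mapping.keys (m p (Poly_Mapping.single y 1)) \<subseteq> S \<and>
      lin h (m p (Poly_Mapping.single y 1)) = lin h p \<otimes> h y" if y: "y \<in> S" for y
    using pq(1)
  proof (induction p rule: poly_mapping_bit_induct)
    case zero
    then show ?case using y funcset_mem[OF h] by (simp add: m0)
  next
    case (add p x)
    then have "lin h (m p (Poly_Mapping.single y 1)) \<in> carrier A" "lin h p \<in> carrier A"
        "h x \<in> carrier A" "h y \<in> carrier A"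
      using y funcset_mem[OF h] lin_closed[OF h] by auto
    then show ?case
      using add y hm by (auto simp: ml lin_add_single[OF h] l_distr keys_add_single)
  qed
  have "Poly_Mapping.keys (m p q) \<subseteq> S \<and> lin h (m p q) = lin h p \<otimes> lin h q"
    using pq(2)
  proof (induction q rule: poly_mapping_bit_induct)
    case zero
    then show ?case using lin_closed[OF h pq(1)] by (auto simp: m0)
  next
    case (add q x)
    then have "lin h p \<in> carrier A" "lin h q \<in> carrier A" "h x \<in> carrier A"
      using pq(1) funcset_mem[OF h] lin_closed[OF h] by auto
    then show ?case
      using add 1[of x] pq(1)
      by (simp add: mr keys_add_bit lin_add[OF h] lin_single r_distr)
  qed
  then show ?thesis ..
qed

end

section \<open>Morphisms out of quotient rings\<close>

text \<open>A representative is chosen in each coset; two representatives differ by an element of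
  \<open>I\<close>, where \<open>h\<close> vanishes. Extensionality is part of the conclusion so
  that the result can serve as an element of \<open>alg_hom\<close>, for tensor products as well as
  for localizations.\<close>

lemma quotient_hom_exists:
  assumes I: "ideal I R" and S: "ring S" and h: "h \<in> ring_hom R S"
    and I0: "\<And>x. x \<in> I \<Longrightarrow> h x = \<zero>\<^bsub>S\<^esub>"
  shows "\<exists>g \<in> ring_hom (R Quot I) S \<inter> extensional (carrier (R Quot I)).
    \<forall>x\<in>carrier R. g (I +>\<^bsub>R\<^esub> x) = h x"
proof -
  interpret R: ring R by (rule ideal.axioms(2)[OF I])
  interpret S: ring S by fact
  note p = ideal.rcos_ring_hom[OF I]
  define g where "g = (\<lambda>X\<in>carrier (R Quot I). h (SOME x. x \<in> carrier R \<and> X = I +>\<^bsub>R\<^esub> x))"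
  have car: "carrier (R Quot I) = (\<lambda>x. I +>\<^bsub>R\<^esub> x) ` carrier R"
    by (auto simp: FactRing_def A_RCOSETS_def')
  have g: "g (I +>\<^bsub>R\<^esub> x) = h x" if x: "x \<in> carrier R" for x
  proof -
    define y where "y = (SOME y. y \<in> carrier R \<and> I +>\<^bsub>R\<^esub> x = I +>\<^bsub>R\<^esub> y)"
    have y: "y \<in> carrier R \<and> I +>\<^bsub>R\<^esub> x = I +>\<^bsub>R\<^esub> y"
      unfolding y_def by (rule someI[of _ x]) (use x in simp)
    then have "y \<ominus>\<^bsub>R\<^esub> x \<in> I"
      using R.quotient_eq_iff_same_a_r_cos[OF I _ x] by metis
    then have "h (y \<ominus>\<^bsub>R\<^esub> x) = \<zero>\<^bsub>S\<^esub>" by (rule I0)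
    moreover have "h y = h ((y \<ominus>\<^bsub>R\<^esub> x) \<oplus>\<^bsub>R\<^esub> x)"
      using x y by (simp add: a_minus_def R.a_assoc R.l_neg)
    ultimately have "h y = h x"
      using x y ring_hom_closed[OF h] by (simp add: ring_hom_add[OF h])
    then show ?thesis
      using x car by (simp add: g_def y_def)
  qed
  have "g \<in> ring_hom (R Quot I) S"
  proof (rule ring_hom_memI)
    show "g X \<in> carrier S" if "X \<in> carrier (R Quot I)" for X
      using that ring_hom_closed[OF h] unfolding car by (auto simp: g)
    fix X Y assume "X \<in> carrier (R Quot I)" "Y \<in> carrier (R Quot I)"
    then obtain x y where xy: "x \<in> carrier R" "y \<in> carrier R" "X = I +>\<^bsub>R\<^esub> x" "Y = I +>\<^bsub>R\<^esub> y"
      unfolding car by auto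
    show "g (X \<otimes>\<^bsub>R Quot I\<^esub> Y) = g X \<otimes>\<^bsub>S\<^esub> g Y"
      using g[of "x \<otimes>\<^bsub>R\<^esub> y"] xy ring_hom_mult[OF p xy(1,2)] ring_hom_mult[OF h xy(1,2)] g
      by simp
    show "g (X \<oplus>\<^bsub>R Quot I\<^esub> Y) = g X \<oplus>\<^bsub>S\<^esub> g Y"
      using g[of "x \<oplus>\<^bsub>R\<^esub> y"] xy ring_hom_add[OF p xy(1,2)] ring_hom_add[OF h xy(1,2)] g
      by simp
  next
    show "g \<one>\<^bsub>R Quot I\<^esub> = \<one>\<^bsub>S\<^esub>"
      using g[of "\<one>\<^bsub>R\<^esub>"] ring_hom_one[OF p] ring_hom_one[OF h] by simp
  qed
  moreover have "g \<in> extensional (carrier (R Quot I))"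
    by (simp add: g_def)
  ultimately show ?thesis using g by blast
qed


section \<open>Tensor products\<close>

text \<open>The counterpart of \<open>lin\<close> for values that are formal sums themselves. With
  it the double sum in \<open>free_alg\<close> becomes visibly additive in both arguments.\<close>

definition bsum :: "('k \<Rightarrow> 'l \<Rightarrow>\<^sub>0 bit) \<Rightarrow> ('k \<Rightarrow>\<^sub>0 bit) \<Rightarrow> 'l \<Rightarrow>\<^sub>0 bit" where
  "bsum f p = (\<Sum>x\<in>Poly_Mapping.keys p. f x)"

lemma bsum_zero [simp]: "bsum f 0 = 0"
  by (simp add: bsum_def)

lemma bsum_single [simp]: "bsum f (Poly_Mapping.single x 1) = f x"
  by (simp add: bsum_def)

lemma bsum_add_single: "bsum f (p + Poly_Mapping.single x 1) = bsum f p + f x"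
proof (cases "x \<in> Poly_Mapping.keys p")
  case True
  then have "bsum f p = f x + (\<Sum>x\<in>Poly_Mapping.keys p - {x}. f x)"
    unfolding bsum_def by (intro sum.remove) auto
  then show ?thesis
    using True by (simp add: bsum_def keys_add_single ac_simps)
next
  case False
  then show ?thesis
    by (simp add: bsum_def keys_add_single ac_simps)
qed

lemma bsum_add: "bsum f (p + q) = bsum f p + bsum f q"
proof -
  have "Poly_Mapping.keys q \<subseteq> UNIV" by simp
  then show ?thesis
    by (induction q rule: poly_mapping_bit_induct)
      (simp_all add: bsum_add_single add.assoc[symmetric] del: One_nat_def)
qed

lemma bsum_plus: "bsum (\<lambda>x. f x + g x) p = bsum f p + bsum g p"
  by (simp add: bsum_def sum.distrib)

lemma bsum_0 [simp]: "bsum (\<lambda>x. 0) p = 0"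
  by (simp add: bsum_def)

lemma lookup_keys_bit: "x \<in> Poly_Mapping.keys p \<Longrightarrow> Poly_Mapping.lookup p x = (1 :: bit)"
  using bit_cases[of "Poly_Mapping.lookup p x"] by (auto simp: in_keys_iff)

text \<open>The product of two coefficients taken on the supports is always 1.\<close>

lemma free_alg_mult:
  "p \<otimes>\<^bsub>free_alg X Y\<^esub> q = bsum (\<lambda>x. bsum (\<lambda>y.
      Poly_Mapping.single (fst x \<otimes>\<^bsub>X\<^esub> fst y, snd x \<otimes>\<^bsub>Y\<^esub> snd y) 1) q) p"
  by (simp add: free_alg_def bsum_def lookup_keys_bit cong: sum.cong)

lemma free_alg_mult_add:
  "(p + p') \<otimes>\<^bsub>free_alg X Y\<^esub> q = p \<otimes>\<^bsub>free_alg X Y\<^esub> q + p' \<otimes>\<^bsub>free_alg X Y\<^esub> q"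
  "q \<otimes>\<^bsub>free_alg X Y\<^esub> (p + p') = q \<otimes>\<^bsub>free_alg X Y\<^esub> p + q \<otimes>\<^bsub>free_alg X Y\<^esub> p'"
  by (simp_all add: free_alg_mult bsum_add bsum_plus)

lemma free_alg_mult_zero [simp]:
  "0 \<otimes>\<^bsub>free_alg X Y\<^esub> q = 0" "q \<otimes>\<^bsub>free_alg X Y\<^esub> 0 = 0"
  by (simp_all add: free_alg_mult)

lemma free_alg_mult_single [simp]:
  "Poly_Mapping.single (a, b) 1 \<otimes>\<^bsub>free_alg X Y\<^esub> Poly_Mapping.single (a', b') 1 =
    Poly_Mapping.single (a \<otimes>\<^bsub>X\<^esub> a', b \<otimes>\<^bsub>Y\<^esub> b') 1"
  by (simp add: free_alg_mult)

lemma free_alg_simps [simp]: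
  "carrier (free_alg X Y) = {p. Poly_Mapping.keys p \<subseteq> carrier X \<times> carrier Y}"
  "\<one>\<^bsub>free_alg X Y\<^esub> = Poly_Mapping.single (\<one>\<^bsub>X\<^esub>, \<one>\<^bsub>Y\<^esub>) 1"
  "\<zero>\<^bsub>free_alg X Y\<^esub> = 0" "p \<oplus>\<^bsub>free_alg X Y\<^esub> q = p + q"
  by (simp_all add: free_alg_def)

section \<open>The monoid algebra of pairs and its quotient\<close>

locale f2_tensor = X: f2_algebra X + Y: f2_algebra Y
  for X :: "(bit, 'a) module" and Y :: "(bit, 'b) module"
begin

abbreviation "F \<equiv> free_alg X Y"

text \<open>This and the ring laws that follow hold on pairs by the laws of \<open>X\<close> and
  \<open>Y\<close>, and are extended to sums one argument at a time, beginning with the left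
  one.\<close>

lemma free_alg_closed:
  assumes p: "p \<in> carrier F" and q: "q \<in> carrier F"
  shows "p \<otimes>\<^bsub>F\<^esub> q \<in> carrier F"
proof -
  have 1: "p \<otimes>\<^bsub>F\<^esub> Poly_Mapping.single (a, b) 1 \<in> carrier F" if "a \<in> carrier X" "b \<in> carrier Y" for a b
    using p unfolding free_alg_simps mem_Collect_eq
  proof (induction p rule: poly_mapping_bit_induct)
    case (add p x)
    then show ?case
      using that by (cases x) (simp add: free_alg_mult_add keys_add_bit)
  qed simp
  show ?thesis
    using q unfolding free_alg_simps mem_Collect_eq
  proof (induction q rule: poly_mapping_bit_induct)
    case (add q x)
    then show ?case
      using 1 by (cases x) (simp add: free_alg_mult_add keys_add_bit)
  qed simp
qed

lemma free_alg_comm: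
  assumes p: "p \<in> carrier F" and q: "q \<in> carrier F"
  shows "p \<otimes>\<^bsub>F\<^esub> q = q \<otimes>\<^bsub>F\<^esub> p"
proof -
  have 1: "p \<otimes>\<^bsub>F\<^esub> Poly_Mapping.single (a, b) 1 = Poly_Mapping.single (a, b) 1 \<otimes>\<^bsub>F\<^esub> p"
    if "a \<in> carrier X" "b \<in> carrier Y" for a b
    using p unfolding free_alg_simps mem_Collect_eq
  proof (induction p rule: poly_mapping_bit_induct)
    case (add p x)
    then show ?case
      using that by (cases x) (simp add: free_alg_mult_add X.m_comm Y.m_comm)
  qed simp
  show ?thesis
    using q unfolding free_alg_simps mem_Collect_eq
  proof (induction q rule: poly_mapping_bit_induct)
    case (add q x)
    then show ?case
      using 1 by (cases x) (simp add: free_alg_mult_add)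
  qed simp
qed

lemma free_alg_assoc:
  assumes p: "p \<in> carrier F" and q: "q \<in> carrier F" and r: "r \<in> carrier F"
  shows "(p \<otimes>\<^bsub>F\<^esub> q) \<otimes>\<^bsub>F\<^esub> r = p \<otimes>\<^bsub>F\<^esub> (q \<otimes>\<^bsub>F\<^esub> r)"
proof -
  have 1: "(p \<otimes>\<^bsub>F\<^esub> Poly_Mapping.single (a, b) 1) \<otimes>\<^bsub>F\<^esub> Poly_Mapping.single (c, d) 1 =
      p \<otimes>\<^bsub>F\<^esub> (Poly_Mapping.single (a, b) 1 \<otimes>\<^bsub>F\<^esub> Poly_Mapping.single (c, d) 1)"
    if "a \<in> carrier X" "b \<in> carrier Y" "c \<in> carrier X" "d \<in> carrier Y" for a b c d
    using p unfolding free_alg_simps mem_Collect_eq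
  proof (induction p rule: poly_mapping_bit_induct)
    case (add p x)
    then show ?case
      using that by (cases x) (simp add: free_alg_mult_add X.m_assoc Y.m_assoc)
  qed simp
  have 2: "(p \<otimes>\<^bsub>F\<^esub> q) \<otimes>\<^bsub>F\<^esub> Poly_Mapping.single (c, d) 1 =
      p \<otimes>\<^bsub>F\<^esub> (q \<otimes>\<^bsub>F\<^esub> Poly_Mapping.single (c, d) 1)"
    if "c \<in> carrier X" "d \<in> carrier Y" for c d
    using q unfolding free_alg_simps mem_Collect_eq
  proof (induction q rule: poly_mapping_bit_induct)
    case (add q x)
    then show ?case
      using that 1 by (cases x) (auto simp: free_alg_mult_add simp del: free_alg_mult_single)
  qed simp
  show ?thesis
    using r unfolding free_alg_simps mem_Collect_eq
  proof (induction r rule: poly_mapping_bit_induct)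
    case (add r x)
    then show ?case
      using 2 by (cases x) (simp add: free_alg_mult_add)
  qed simp
qed

lemma free_alg_l_one:
  assumes "p \<in> carrier F"
  shows "\<one>\<^bsub>F\<^esub> \<otimes>\<^bsub>F\<^esub> p = p"
  using assms unfolding free_alg_simps mem_Collect_eq
proof (induction p rule: poly_mapping_bit_induct)
  case (add p x)
  then show ?case
    by (cases x) (simp add: free_alg_mult_add)
qed simp

lemma cring_free_alg: "cring F"
proof (rule cringI)
  show "abelian_group F"
  proof (rule abelian_groupI)
    show "\<exists>q\<in>carrier F. q \<oplus>\<^bsub>F\<^esub> p = \<zero>\<^bsub>F\<^esub>" if "p \<in> carrier F" for p
      using that by (intro bexI[of _ p]) simp_all
  qed (auto simp: keys_add_bit ac_simps)
  show "Group.comm_monoid F"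
    by (rule comm_monoidI)
      (use free_alg_closed free_alg_comm free_alg_assoc free_alg_l_one in auto)
qed (auto simp: free_alg_mult_add)

sublocale F: cring F
  by (rule cring_free_alg)

abbreviation "I \<equiv> tensor_ideal X Y"
abbreviation "T \<equiv> tensor X Y"

lemma bilinear_rels_closed: "bilinear_rels X Y \<subseteq> carrier F"
proof -
  have X: "c \<odot>\<^bsub>X\<^esub> a \<in> carrier X" if "a \<in> carrier X" for c a
    using that by (simp add: X.smult_eq)
  have Y: "c \<odot>\<^bsub>Y\<^esub> a \<in> carrier Y" if "a \<in> carrier Y" for c a
    using that by (simp add: Y.smult_eq)
  have K: "Poly_Mapping.keys (Poly_Mapping.single (a, b) c) \<subseteq> carrier X \<times> carrier Y"
    if "a \<in> carrier X" "b \<in> carrier Y" for a b and c :: bit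
    using that by simp
  \<comment> \<open>Differences are sums in characteristic two, so closure under addition suffices
    for all four kinds of relations.\<close>
  show ?thesis
    unfolding bilinear_rels_def poly_mapping_bit_minus free_alg_simps
    apply (intro Un_least; rule subsetI; rule CollectI)
    apply (elim CollectE exE conjE, hypsubst, intro keys_add_bit K; simp add: X Y)+
    done
qed

lemma ideal_I: "ideal I F"
  unfolding tensor_ideal_def by (rule F.genideal_ideal[OF bilinear_rels_closed])

lemma rels_in_I: "bilinear_rels X Y \<subseteq> I"
  unfolding tensor_ideal_def by (rule F.genideal_self[OF bilinear_rels_closed])


abbreviation "\<pi> \<equiv> (\<lambda>p. I +>\<^bsub>F\<^esub> p)"

lemma carrier_T: "carrier T = \<pi> ` carrier F"
  by (auto simp: tensor_def alg_of_def FactRing_def A_RCOSETS_def')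

lemma proj_ring_hom: "\<pi> \<in> ring_hom F T"
  using ideal.rcos_ring_hom[OF ideal_I] by (simp add: tensor_def)

lemma F2_algebra_tensor: "F2_algebra T"
  unfolding tensor_def
proof (rule F2_algebra_alg_of)
  interpret Q: cring "F Quot I"
    by (rule ideal.quotient_is_cring[OF ideal_I F.is_cring])
  note \<pi> = ideal.rcos_ring_hom[OF ideal_I]
  show "cring (F Quot I)" by (rule Q.is_cring)
  show "I +>\<^bsub>F\<^esub> Poly_Mapping.single (\<one>\<^bsub>X\<^esub>, \<one>\<^bsub>Y\<^esub>) 1 = \<one>\<^bsub>F Quot I\<^esub>"
    using ring_hom_one[OF \<pi>] by simp
  have 0: "\<pi> 0 = \<zero>\<^bsub>F Quot I\<^esub>"
    using ring_hom_zero[OF \<pi> F.ring_axioms Q.ring_axioms] by simp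
  then show "I +>\<^bsub>F\<^esub> Poly_Mapping.single (\<one>\<^bsub>X\<^esub>, \<one>\<^bsub>Y\<^esub>) 0 = \<zero>\<^bsub>F Quot I\<^esub>"
    by simp
  have "\<one>\<^bsub>F Quot I\<^esub> \<oplus>\<^bsub>F Quot I\<^esub> \<one>\<^bsub>F Quot I\<^esub> = \<pi> (\<one>\<^bsub>F\<^esub> \<oplus>\<^bsub>F\<^esub> \<one>\<^bsub>F\<^esub>)"
    using ring_hom_add[OF \<pi> F.one_closed F.one_closed] ring_hom_one[OF \<pi>] by simp
  then show "\<one>\<^bsub>F Quot I\<^esub> \<oplus>\<^bsub>F Quot I\<^esub> \<one>\<^bsub>F Quot I\<^esub> = \<zero>\<^bsub>F Quot I\<^esub>"
    using 0 by (simp only: free_alg_simps poly_mapping_bit_add_self)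
qed

sublocale T: f2_algebra T
  by (rule f2_algebraI[OF F2_algebra_tensor])

lemma single_closed: "a \<in> carrier X \<Longrightarrow> b \<in> carrier Y \<Longrightarrow> Poly_Mapping.single (a, b) 1 \<in> carrier F"
  by simp

lemma pure_closed [simp, intro]: "a \<in> carrier X \<Longrightarrow> b \<in> carrier Y \<Longrightarrow> pure X Y a b \<in> carrier T"
  using ring_hom_closed[OF proj_ring_hom single_closed] by (simp add: pure_def)

lemma pure_mult:
  assumes "a \<in> carrier X" "b \<in> carrier Y" "a' \<in> carrier X" "b' \<in> carrier Y"
  shows "pure X Y a b \<otimes>\<^bsub>T\<^esub> pure X Y a' b' = pure X Y (a \<otimes>\<^bsub>X\<^esub> a') (b \<otimes>\<^bsub>Y\<^esub> b')"
  using ring_hom_mult[OF proj_ring_hom single_closed[OF assms(1,2)] single_closed[OF assms(3,4)]]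
  by (simp add: pure_def)

lemma pure_one: "pure X Y \<one>\<^bsub>X\<^esub> \<one>\<^bsub>Y\<^esub> = \<one>\<^bsub>T\<^esub>"
  using ring_hom_one[OF proj_ring_hom] by (simp add: pure_def)

text \<open>The additivity relations have the shape p - q - r; this turns membership of such a
  difference in the ideal into an equation between cosets.\<close>

lemma proj_sum_eq:
  assumes "p \<in> carrier F" "q \<in> carrier F" "r \<in> carrier F" "p - q - r \<in> I"
  shows "\<pi> p = \<pi> q \<oplus>\<^bsub>T\<^esub> \<pi> r"
proof -
  have qr: "q + r \<in> carrier F"
    using F.a_closed[OF assms(2,3)] by simp
  have "\<ominus>\<^bsub>F\<^esub> (q + r) = q + r"
    using F.minus_equality[OF _ qr qr] by simp
  then have "p \<ominus>\<^bsub>F\<^esub> (q + r) \<in> I"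
    using assms(4) by (simp add: a_minus_def poly_mapping_bit_minus add.assoc)
  then have "\<pi> p = \<pi> (q \<oplus>\<^bsub>F\<^esub> r)"
    using F.quotient_eq_iff_same_a_r_cos[OF ideal_I assms(1) qr] by simp
  then show ?thesis
    using ring_hom_add[OF proj_ring_hom assms(2,3)] by (simp del: free_alg_simps)
qed

lemma pure_add_left:
  assumes "a \<in> carrier X" "a' \<in> carrier X" "b \<in> carrier Y"
  shows "pure X Y (a \<oplus>\<^bsub>X\<^esub> a') b = pure X Y a b \<oplus>\<^bsub>T\<^esub> pure X Y a' b"
  unfolding pure_def
  by (rule proj_sum_eq)
    (use assms in \<open>auto intro!: rels_in_I[THEN subsetD] simp: bilinear_rels_def\<close>)

lemma pure_add_right:
  assumes "a \<in> carrier X" "b \<in> carrier Y" "b' \<in> carrier Y"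
  shows "pure X Y a (b \<oplus>\<^bsub>Y\<^esub> b') = pure X Y a b \<oplus>\<^bsub>T\<^esub> pure X Y a b'"
  unfolding pure_def
  by (rule proj_sum_eq)
    (use assms in \<open>auto intro!: rels_in_I[THEN subsetD] simp: bilinear_rels_def\<close>)

text \<open>Over two scalars, pure tensors span by addition alone; the induction is inherited from
  that on formal sums.\<close>

lemma tensor_induct [consumes 1, case_names zero add]:
  assumes "t \<in> carrier T" "P \<zero>\<^bsub>T\<^esub>"
    "\<And>t a b. t \<in> carrier T \<Longrightarrow> a \<in> carrier X \<Longrightarrow> b \<in> carrier Y \<Longrightarrow> P t \<Longrightarrow>
      P (t \<oplus>\<^bsub>T\<^esub> pure X Y a b)"
  shows "P t"
proof -
  obtain p where p: "Poly_Mapping.keys p \<subseteq> carrier X \<times> carrier Y" "t = \<pi> p"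
    using assms(1) by (auto simp: carrier_T)
  have "P (\<pi> p)"
    using p(1)
  proof (induction p rule: poly_mapping_bit_induct)
    case zero
    then show ?case
      using assms(2) ring_hom_zero[OF proj_ring_hom F.ring_axioms T.ring_axioms] by simp
  next
    case (add p x)
    obtain a b where x: "x = (a, b)" by (cases x)
    have "\<pi> (p + Poly_Mapping.single x 1) = \<pi> p \<oplus>\<^bsub>T\<^esub> pure X Y a b"
      using ring_hom_add[OF proj_ring_hom, of p "Poly_Mapping.single x 1"] add x
      by (simp add: pure_def)
    moreover have "\<pi> p \<in> carrier T"
      using add ring_hom_closed[OF proj_ring_hom, of p] by simp
    ultimately show ?case
      using assms(3) add x by simp
  qed
  then show ?thesis using p by simp
qed

section \<open>The universal property of the tensor product\<close>

lemma tensor_hom_eqI: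
  assumes C: "F2_algebra C" and h: "h \<in> alg_hom T C" "h' \<in> alg_hom T C"
    and eq: "\<And>a b. a \<in> carrier X \<Longrightarrow> b \<in> carrier Y \<Longrightarrow> h (pure X Y a b) = h' (pure X Y a b)"
  shows "h = h'"
proof (rule alg_hom_eqI[OF h])
  interpret C: f2_algebra C by (rule f2_algebraI[OF C])
  note hh = h[THEN alg_hom_ring_hom]
  fix t assume "t \<in> carrier T"
  then show "h t = h' t"
  proof (induction t rule: tensor_induct)
    case zero
    show ?case
      using hh[THEN ring_hom_zero, OF T.ring_axioms C.ring_axioms] by simp
  next
    case (add t a b)
    then show ?case
      using hh[THEN ring_hom_add] eq by simp
  qed
qed

lemma tensor_pair_exists:
  assumes C: "F2_algebra C" and \<phi>: "\<phi> \<in> alg_hom X C" and \<psi>: "\<psi> \<in> alg_hom Y C"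
  shows "\<exists>h \<in> alg_hom T C. \<forall>a\<in>carrier X. \<forall>b\<in>carrier Y. h (pure X Y a b) = \<phi> a \<otimes>\<^bsub>C\<^esub> \<psi> b"
proof -
  interpret C: f2_algebra C by (rule f2_algebraI[OF C])
  note [simp] = alg_hom_closed[OF \<phi>] alg_hom_closed[OF \<psi>]
  note \<phi>r = \<phi>[THEN alg_hom_ring_hom] and \<psi>r = \<psi>[THEN alg_hom_ring_hom]
  define h where "h = (\<lambda>(a, b). \<phi> a \<otimes>\<^bsub>C\<^esub> \<psi> b)"
  define S where "S = carrier X \<times> carrier Y"
  have hS: "h \<in> S \<rightarrow> carrier C"
    by (auto simp: h_def S_def)
  have F: "p \<in> carrier F \<longleftrightarrow> Poly_Mapping.keys p \<subseteq> S" for p by (simp add: S_def)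
  have lin: "C.lin h \<in> ring_hom F C"
  proof (rule ring_hom_memI)
    show "C.lin h p \<in> carrier C" if "p \<in> carrier F" for p
      using C.lin_closed[OF hS] that F by simp
    show "C.lin h \<one>\<^bsub>F\<^esub> = \<one>\<^bsub>C\<^esub>"
      using ring_hom_one[OF \<phi>r] ring_hom_one[OF \<psi>r] by (simp add: C.lin_single h_def)
    fix p q assume pq: "p \<in> carrier F" "q \<in> carrier F"
    show "C.lin h (p \<oplus>\<^bsub>F\<^esub> q) = C.lin h p \<oplus>\<^bsub>C\<^esub> C.lin h q"
      using C.lin_add[OF hS] pq F by simp
    show "C.lin h (p \<otimes>\<^bsub>F\<^esub> q) = C.lin h p \<otimes>\<^bsub>C\<^esub> C.lin h q"
    proof (rule C.lin_mult[OF hS, where op = "\<lambda>x y. (fst x \<otimes>\<^bsub>X\<^esub> fst y, snd x \<otimes>\<^bsub>Y\<^esub> snd y)"])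
      fix x y assume "x \<in> S" "y \<in> S"
      then show "(fst x \<otimes>\<^bsub>X\<^esub> fst y, snd x \<otimes>\<^bsub>Y\<^esub> snd y) \<in> S \<and>
          h (fst x \<otimes>\<^bsub>X\<^esub> fst y, snd x \<otimes>\<^bsub>Y\<^esub> snd y) = h x \<otimes>\<^bsub>C\<^esub> h y"
        by (auto simp: S_def h_def ring_hom_mult[OF \<phi>r] ring_hom_mult[OF \<psi>r] C.m_ac)
    next
      fix p x y assume "x \<in> S" "y \<in> S"
      then show "(p + Poly_Mapping.single x 1) \<otimes>\<^bsub>F\<^esub> Poly_Mapping.single y 1 =
          p \<otimes>\<^bsub>F\<^esub> Poly_Mapping.single y 1 +
          Poly_Mapping.single (fst x \<otimes>\<^bsub>X\<^esub> fst y, snd x \<otimes>\<^bsub>Y\<^esub> snd y) 1"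
        by (cases x; cases y) (simp add: free_alg_mult_add)
    qed (use pq F in \<open>simp_all add: free_alg_mult_add\<close>)
  qed
  interpret lin: ring_hom_ring F C "C.lin h"
    by (rule ring_hom_ringI2[OF F.ring_axioms C.ring_axioms lin])
  have "I \<subseteq> a_kernel F C (C.lin h)"
    unfolding tensor_ideal_def
  proof (rule F.genideal_minimal)
    show "ideal (a_kernel F C (C.lin h)) F"
      by (rule lin.kernel_is_ideal)
    have s: "C.lin h (Poly_Mapping.single (a, b) 1) = \<phi> a \<otimes>\<^bsub>C\<^esub> \<psi> b"
      if "a \<in> carrier X" "b \<in> carrier Y" for a b
      using that by (simp add: C.lin_single h_def)
    have add: "C.lin h (p + q) = C.lin h p \<oplus>\<^bsub>C\<^esub> C.lin h q" if "p \<in> carrier F" "q \<in> carrier F" for p q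
      using C.lin_add[OF hS] that F by simp
    have k: "C.lin h r = \<zero>\<^bsub>C\<^esub>" if r: "r \<in> bilinear_rels X Y" for r
    proof -
      from r consider a a' b where "r = Poly_Mapping.single (a \<oplus>\<^bsub>X\<^esub> a', b) 1 - Poly_Mapping.single (a, b) 1
          - Poly_Mapping.single (a', b) 1" "a \<in> carrier X" "a' \<in> carrier X" "b \<in> carrier Y"
        | a b b' where "r = Poly_Mapping.single (a, b \<oplus>\<^bsub>Y\<^esub> b') 1 - Poly_Mapping.single (a, b) 1
          - Poly_Mapping.single (a, b') 1" "a \<in> carrier X" "b \<in> carrier Y" "b' \<in> carrier Y"
        | c a b where "r = Poly_Mapping.single (c \<odot>\<^bsub>X\<^esub> a, b) 1 - Poly_Mapping.single (a, b) c"
          "a \<in> carrier X" "b \<in> carrier Y"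
        | c a b where "r = Poly_Mapping.single (a, c \<odot>\<^bsub>Y\<^esub> b) 1 - Poly_Mapping.single (a, b) c"
          "a \<in> carrier X" "b \<in> carrier Y"
        unfolding bilinear_rels_def by blast
      then show ?thesis
      proof cases
        case 1
        then show ?thesis
          by (simp add: poly_mapping_bit_minus add s keys_add_bit ring_hom_add[OF \<phi>r] C.l_distr C.a_assoc)
            (simp add: C.a_ac C.add_self)
      next
        case 2
        then show ?thesis
          by (simp add: poly_mapping_bit_minus add s keys_add_bit ring_hom_add[OF \<psi>r] C.r_distr C.a_assoc)
            (simp add: C.a_ac C.add_self)
      next
        case 3
        then show ?thesis
          using bit_cases[of c] ring_hom_zero[OF \<phi>r X.ring_axioms C.ring_axioms]
          by (auto simp: poly_mapping_bit_minus X.smult_eq s)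
      next
        case 4
        then show ?thesis
          using bit_cases[of c] ring_hom_zero[OF \<psi>r Y.ring_axioms C.ring_axioms]
          by (auto simp: poly_mapping_bit_minus Y.smult_eq s)
      qed
    qed
    show "bilinear_rels X Y \<subseteq> a_kernel F C (C.lin h)"
      unfolding a_kernel_def' using k bilinear_rels_closed by blast
  qed
  then have "C.lin h p = \<zero>\<^bsub>C\<^esub>" if "p \<in> I" for p
    using that unfolding a_kernel_def' by blast
  from quotient_hom_exists[OF ideal_I C.ring_axioms lin this]
  obtain g where g: "g \<in> ring_hom (F Quot I) C" "g \<in> extensional (carrier (F Quot I))"
    "\<And>p. p \<in> carrier F \<Longrightarrow> g (\<pi> p) = C.lin h p"
    by blast
  have "g \<in> alg_hom T C"
    using g(1,2) by (simp add: alg_hom_iff[OF F2_algebra_tensor C]) (simp add: tensor_def)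
  moreover have "g (pure X Y a b) = \<phi> a \<otimes>\<^bsub>C\<^esub> \<psi> b" if "a \<in> carrier X" "b \<in> carrier Y" for a b
    using that g(3)[of "Poly_Mapping.single (a, b) 1"] by (simp add: pure_def C.lin_single h_def)
  ultimately show ?thesis by blast
qed


text \<open>The description in \<open>tensor_pair\<close> is proper: existence is
  \<open>tensor_pair_exists\<close>, and pure tensors determine a morphism.\<close>

lemma
  assumes C: "F2_algebra C" and \<phi>: "\<phi> \<in> alg_hom X C" and \<psi>: "\<psi> \<in> alg_hom Y C"
  shows tensor_pair_hom: "tensor_pair X Y C \<phi> \<psi> \<in> alg_hom T C"
    and tensor_pair_pure: "a \<in> carrier X \<Longrightarrow> b \<in> carrier Y \<Longrightarrow>
      tensor_pair X Y C \<phi> \<psi> (pure X Y a b) = \<phi> a \<otimes>\<^bsub>C\<^esub> \<psi> b"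
proof -
  have "\<exists>!h. h \<in> alg_hom T C \<and> (\<forall>a\<in>carrier X. \<forall>b\<in>carrier Y. h (pure X Y a b) = \<phi> a \<otimes>\<^bsub>C\<^esub> \<psi> b)"
    using tensor_pair_exists[OF assms] by (auto intro: tensor_hom_eqI[OF C])
  from theI'[OF this]
  show "tensor_pair X Y C \<phi> \<psi> \<in> alg_hom T C"
    and "a \<in> carrier X \<Longrightarrow> b \<in> carrier Y \<Longrightarrow>
      tensor_pair X Y C \<phi> \<psi> (pure X Y a b) = \<phi> a \<otimes>\<^bsub>C\<^esub> \<psi> b"
    unfolding tensor_pair_def by blast+
qed

lemma tensor_inl_hom: "tensor_inl X Y \<in> alg_hom X T"
  by (auto simp: alg_hom_iff[OF X.F2_algebra F2_algebra_tensor] tensor_inl_def pure_mult pure_one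
      pure_add_left intro!: ring_hom_memI)

lemma tensor_inr_hom: "tensor_inr X Y \<in> alg_hom Y T"
  by (auto simp: alg_hom_iff[OF Y.F2_algebra F2_algebra_tensor] tensor_inr_def pure_mult pure_one
      pure_add_right intro!: ring_hom_memI)

text \<open>Translates between prescribing a morphism on pure tensors and prescribing its
  restrictions to the two factors.\<close>

lemma pure_eq_inl_inr:
  "a \<in> carrier X \<Longrightarrow> b \<in> carrier Y \<Longrightarrow> tensor_inl X Y a \<otimes>\<^bsub>T\<^esub> tensor_inr X Y b = pure X Y a b"
  by (simp add: tensor_inl_def tensor_inr_def pure_mult)

text \<open>The tensor product as the coproduct of commutative algebras: on
  \<open>a \<otimes> 1\<close> the pairing takes the value \<open>\<phi> a\<close>, because
  \<open>\<psi>\<close> preserves the identity. This form composes well with classifying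
  morphisms.\<close>

lemma
  assumes C: "F2_algebra C" and \<phi>: "\<phi> \<in> alg_hom X C" and \<psi>: "\<psi> \<in> alg_hom Y C"
  shows tensor_pair_inl: "compose (carrier X) (tensor_pair X Y C \<phi> \<psi>) (tensor_inl X Y) = \<phi>"
    and tensor_pair_inr: "compose (carrier Y) (tensor_pair X Y C \<phi> \<psi>) (tensor_inr X Y) = \<psi>"
proof -
  interpret C: f2_algebra C by (rule f2_algebraI[OF C])
  note h = tensor_pair_hom[OF assms]
  show "compose (carrier X) (tensor_pair X Y C \<phi> \<psi>) (tensor_inl X Y) = \<phi>"
    using ring_hom_one[OF alg_hom_ring_hom[OF \<psi>]] alg_hom_closed[OF \<phi>]
    by (intro alg_hom_eqI[OF alg_hom_compose[OF tensor_inl_hom h X.F2_algebra] \<phi>])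
      (simp add: compose_eq tensor_inl_def tensor_pair_pure[OF assms])
  show "compose (carrier Y) (tensor_pair X Y C \<phi> \<psi>) (tensor_inr X Y) = \<psi>"
    using ring_hom_one[OF alg_hom_ring_hom[OF \<phi>]] alg_hom_closed[OF \<psi>]
    by (intro alg_hom_eqI[OF alg_hom_compose[OF tensor_inr_hom h Y.F2_algebra] \<psi>])
      (simp add: compose_eq tensor_inr_def tensor_pair_pure[OF assms])
qed

end

section \<open>Functoriality and associativity of the tensor product\<close>

lemma f2_tensorI: "F2_algebra X \<Longrightarrow> F2_algebra Y \<Longrightarrow> f2_tensor X Y"
  by (simp add: f2_tensor_def f2_algebraI)

lemmas F2_algebra_tensor = f2_tensor.F2_algebra_tensor[OF f2_tensorI]

text \<open>The two defining conditions are the same predicate, so the definite descriptions agree,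
  and all properties of \<open>tensor_map\<close> are inherited from the pairing.\<close>

lemma tensor_map_eq:
  assumes "F2_algebra X" "F2_algebra Y" "F2_algebra X'" "F2_algebra Y'"
    and f: "f \<in> alg_hom X X'" and g: "g \<in> alg_hom Y Y'"
  shows "tensor_map X Y X' Y' f g = tensor_pair X Y (tensor X' Y')
    (compose (carrier X) (tensor_inl X' Y') f) (compose (carrier Y) (tensor_inr X' Y') g)"
proof -
  interpret XY: f2_tensor X Y by (rule f2_tensorI) fact+
  interpret XY': f2_tensor X' Y' by (rule f2_tensorI) fact+
  have "compose (carrier X) (tensor_inl X' Y') f a \<otimes>\<^bsub>tensor X' Y'\<^esub> compose (carrier Y) (tensor_inr X' Y') g b
      = pure X' Y' (f a) (g b)"
    if "a \<in> carrier X" "b \<in> carrier Y" for a b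
    using that alg_hom_closed[OF f] alg_hom_closed[OF g] by (simp add: compose_eq XY'.pure_eq_inl_inr)
  then show ?thesis
    unfolding tensor_map_def tensor_pair_def
    by (intro arg_cong[where f = The] ext) (simp cong: ball_cong)
qed

lemma
  assumes A: "F2_algebra X" "F2_algebra Y" "F2_algebra X'" "F2_algebra Y'"
    and f: "f \<in> alg_hom X X'" and g: "g \<in> alg_hom Y Y'"
  shows tensor_map_hom: "tensor_map X Y X' Y' f g \<in> alg_hom (tensor X Y) (tensor X' Y')"
    and tensor_map_inl: "compose (carrier X) (tensor_map X Y X' Y' f g) (tensor_inl X Y) =
      compose (carrier X) (tensor_inl X' Y') f"
    and tensor_map_inr: "compose (carrier Y) (tensor_map X Y X' Y' f g) (tensor_inr X Y) =
      compose (carrier Y) (tensor_inr X' Y') g"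
proof -
  interpret XY: f2_tensor X Y by (rule f2_tensorI) fact+
  interpret XY': f2_tensor X' Y' by (rule f2_tensorI) fact+
  note i = alg_hom_compose[OF f XY'.tensor_inl_hom A(1)] alg_hom_compose[OF g XY'.tensor_inr_hom A(2)]
  note e = tensor_map_eq[OF assms]
  show "tensor_map X Y X' Y' f g \<in> alg_hom (tensor X Y) (tensor X' Y')"
    unfolding e by (rule XY.tensor_pair_hom[OF XY'.F2_algebra_tensor i])
  show "compose (carrier X) (tensor_map X Y X' Y' f g) (tensor_inl X Y) =
      compose (carrier X) (tensor_inl X' Y') f"
    unfolding e by (rule XY.tensor_pair_inl[OF XY'.F2_algebra_tensor i])
  show "compose (carrier Y) (tensor_map X Y X' Y' f g) (tensor_inr X Y) =
      compose (carrier Y) (tensor_inr X' Y') g"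
    unfolding e by (rule XY.tensor_pair_inr[OF XY'.F2_algebra_tensor i])
qed

text \<open>
  The embeddings of the three factors determine a morphism out of a triple tensor product; the
  associator is the one that preserves them.
\<close>

lemma
  assumes A: "F2_algebra X" "F2_algebra Y" "F2_algebra Z"
  defines "T \<equiv> tensor X (tensor Y Z)"
  shows tensor_assoc_hom: "tensor_assoc X Y Z \<in> alg_hom (tensor (tensor X Y) Z) T"
    and tensor_assoc_1: "a \<in> carrier X \<Longrightarrow> tensor_assoc X Y Z (tensor_inl (tensor X Y) Z (tensor_inl X Y a)) =
      tensor_inl X (tensor Y Z) a"
    and tensor_assoc_2: "b \<in> carrier Y \<Longrightarrow> tensor_assoc X Y Z (tensor_inl (tensor X Y) Z (tensor_inr X Y b)) =
      tensor_inr X (tensor Y Z) (tensor_inl Y Z b)"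
    and tensor_assoc_3: "c \<in> carrier Z \<Longrightarrow> tensor_assoc X Y Z (tensor_inr (tensor X Y) Z c) =
      tensor_inr X (tensor Y Z) (tensor_inr Y Z c)"
proof -
  interpret XY: f2_tensor X Y by (rule f2_tensorI) fact+
  interpret YZ: f2_tensor Y Z by (rule f2_tensorI) fact+
  interpret L: f2_tensor "tensor X Y" Z by (rule f2_tensorI[OF XY.F2_algebra_tensor A(3)])
  interpret R: f2_tensor X "tensor Y Z" by (rule f2_tensorI[OF A(1) YZ.F2_algebra_tensor])
  note ones = XY.X.one_closed XY.Y.one_closed YZ.Y.one_closed
  define \<phi> where "\<phi> = tensor_pair X Y T (tensor_inl X (tensor Y Z))
    (compose (carrier Y) (tensor_inr X (tensor Y Z)) (tensor_inl Y Z))"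
  define \<psi> where "\<psi> = compose (carrier Z) (tensor_inr X (tensor Y Z)) (tensor_inr Y Z)"
  note T = R.F2_algebra_tensor[folded T_def]
  note i1 = R.tensor_inl_hom[folded T_def]
  note i2 = alg_hom_compose[OF YZ.tensor_inl_hom R.tensor_inr_hom A(2), folded T_def]
  note \<phi> = XY.tensor_pair_hom[OF T i1 i2, folded \<phi>_def]
  note \<phi>p = XY.tensor_pair_pure[OF T i1 i2, folded \<phi>_def]
  note \<psi> = alg_hom_compose[OF YZ.tensor_inr_hom R.tensor_inr_hom A(3), folded T_def \<psi>_def]
  define h where "h = tensor_pair (tensor X Y) Z T \<phi> \<psi>"
  note h = L.tensor_pair_hom[OF T \<phi> \<psi>, folded h_def]
  note hp = L.tensor_pair_pure[OF T \<phi> \<psi>, folded h_def]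
  have in_T: "tensor_inr X (tensor Y Z) t \<in> carrier T" if "t \<in> carrier (tensor Y Z)" for t
    using alg_hom_closed[OF R.tensor_inr_hom that] by (simp add: T_def)
  note in_YZ = alg_hom_closed[OF YZ.tensor_inl_hom] alg_hom_closed[OF YZ.tensor_inr_hom]
  \<comment> \<open>On such a tensor, \<open>h\<close> is the product of the three embeddings; it
    remains to bracket it differently and to multiply the last two factors inside the inner tensor
    product.\<close>
  have hpp: "h (pure (tensor X Y) Z (pure X Y a b) c) = pure X (tensor Y Z) a (pure Y Z b c)"
    if "a \<in> carrier X" "b \<in> carrier Y" "c \<in> carrier Z" for a b c
  proof -
    have "h (pure (tensor X Y) Z (pure X Y a b) c) =
        (tensor_inl X (tensor Y Z) a \<otimes>\<^bsub>T\<^esub> tensor_inr X (tensor Y Z) (tensor_inl Y Z b)) \<otimes>\<^bsub>T\<^esub>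
        tensor_inr X (tensor Y Z) (tensor_inr Y Z c)"
      using that by (simp add: hp \<phi>p \<psi>_def compose_eq)
    also have "\<dots> = tensor_inl X (tensor Y Z) a \<otimes>\<^bsub>T\<^esub>
        tensor_inr X (tensor Y Z) (tensor_inl Y Z b \<otimes>\<^bsub>tensor Y Z\<^esub> tensor_inr Y Z c)"
      unfolding T_def ring_hom_mult[OF alg_hom_ring_hom[OF R.tensor_inr_hom] in_YZ(1)[OF that(2)] in_YZ(2)[OF that(3)]]
      by (rule R.T.m_assoc) (use that in_YZ alg_hom_closed[OF R.tensor_inl_hom] alg_hom_closed[OF R.tensor_inr_hom] in auto)
    also have "\<dots> = pure X (tensor Y Z) a (pure Y Z b c)"
      unfolding T_def YZ.pure_eq_inl_inr[OF that(2,3)]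
      by (rule R.pure_eq_inl_inr[OF that(1) YZ.pure_closed[OF that(2,3)]])
    finally show ?thesis .
  qed
  have eq: "tensor_assoc X Y Z = h"
    unfolding tensor_assoc_def
  proof (rule the_equality)
    fix k assume k: "k \<in> alg_hom (tensor (tensor X Y) Z) (tensor X (tensor Y Z)) \<and>
      (\<forall>a\<in>carrier X. \<forall>b\<in>carrier Y. \<forall>c\<in>carrier Z.
        k (pure (tensor X Y) Z (pure X Y a b) c) = pure X (tensor Y Z) a (pure Y Z b c))"
    then have k': "k \<in> alg_hom (tensor (tensor X Y) Z) T" by (simp add: T_def)
    show "k = h"
    proof (rule L.tensor_hom_eqI[OF T k' h])
      \<comment> \<open>The values of \<open>k\<close> are prescribed only for \<open>t\<close> a
        pure tensor; a general \<open>t\<close> is reached by a second induction, in the inner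
        tensor product.\<close>
      fix t c assume "t \<in> carrier (tensor X Y)" and c: "c \<in> carrier Z"
      from this(1) show "k (pure (tensor X Y) Z t c) = h (pure (tensor X Y) Z t c)"
      proof (induction t rule: XY.tensor_induct)
        case zero
        \<comment> \<open>By additivity this tensor equals its own double, which is zero in
          characteristic two.\<close>
        have "pure (tensor X Y) Z \<zero>\<^bsub>tensor X Y\<^esub> c = \<zero>\<^bsub>tensor (tensor X Y) Z\<^esub>"
          using L.pure_add_left[of "\<zero>\<^bsub>tensor X Y\<^esub>" "\<zero>\<^bsub>tensor X Y\<^esub>" c] c
          by (simp add: L.T.add_self)
        then show ?case
          using k'[THEN alg_hom_ring_hom, THEN ring_hom_zero] h[THEN alg_hom_ring_hom, THEN ring_hom_zero]
            L.T.ring_axioms R.T.ring_axioms by (simp add: T_def)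
      next
        case (add t a b)
        then show ?case
          using k hpp c
          by (simp add: L.pure_add_left ring_hom_add[OF alg_hom_ring_hom[OF k']]
              ring_hom_add[OF alg_hom_ring_hom[OF h]])
      qed
    qed
  qed (use h hpp in \<open>simp add: T_def\<close>)
  show "tensor_assoc X Y Z \<in> alg_hom (tensor (tensor X Y) Z) T"
    unfolding eq by (rule h)
  show "tensor_assoc X Y Z (tensor_inl (tensor X Y) Z (tensor_inl X Y a)) =
      tensor_inl X (tensor Y Z) a" if "a \<in> carrier X"
    using that hpp[OF that ones(2,3)]
    by (simp add: eq tensor_inl_def YZ.pure_one)
  show "tensor_assoc X Y Z (tensor_inl (tensor X Y) Z (tensor_inr X Y b)) =
      tensor_inr X (tensor Y Z) (tensor_inl Y Z b)" if "b \<in> carrier Y"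
    using that hpp[OF ones(1) that ones(3)]
    by (simp add: eq tensor_inl_def tensor_inr_def)
  show "tensor_assoc X Y Z (tensor_inr (tensor X Y) Z c) =
      tensor_inr X (tensor Y Z) (tensor_inr Y Z c)" if "c \<in> carrier Z"
    using that hpp[OF ones(1,2) that]
    by (simp add: eq tensor_inr_def XY.pure_one)
qed

section \<open>Additive polynomials\<close>

context cring
begin

text \<open>Iterated Frobenius: in each squaring the two mixed terms cancel. It is stated for rings
  because it will be applied to \<open>UP A\<close>, whose scalars are those of \<open>A\<close>, so
  that it does not fall under \<open>f2_algebra\<close>.\<close>

lemma char2_pow_add:
  assumes "\<And>a. a \<in> carrier R \<Longrightarrow> a \<oplus> a = \<zero>" "x \<in> carrier R" "y \<in> carrier R"
  shows "(x \<oplus> y) [^] (2 ^ t :: nat) = x [^] (2 ^ t :: nat) \<oplus> y [^] (2 ^ t :: nat)"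
proof (induction t)
  case (Suc t)
  have sq: "(a \<oplus> b) \<otimes> (a \<oplus> b) = a \<otimes> a \<oplus> b \<otimes> b" if "a \<in> carrier R" "b \<in> carrier R" for a b
  proof -
    have "(a \<oplus> b) \<otimes> (a \<oplus> b) = a \<otimes> a \<oplus> b \<otimes> b \<oplus> (a \<otimes> b \<oplus> a \<otimes> b)"
      using that by algebra
    then show ?thesis using that assms(1) by simp
  qed
  have d: "z [^] (2 ^ Suc t :: nat) = z [^] (2 ^ t :: nat) \<otimes> z [^] (2 ^ t :: nat)" if "z \<in> carrier R" for z
    using nat_pow_mult[OF that, of "2 ^ t" "2 ^ t"] by (simp add: mult_2)
  show ?case
    using assms by (simp only: d a_closed Suc.IH sq nat_pow_closed)
qed (use assms in simp)

lemma char2_pow_finsum: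
  assumes "\<And>a. a \<in> carrier R \<Longrightarrow> a \<oplus> a = \<zero>" "finite I" "f \<in> I \<rightarrow> carrier R"
  shows "(\<Oplus>i\<in>I. f i) [^] (2 ^ t :: nat) = (\<Oplus>i\<in>I. f i [^] (2 ^ t :: nat))"
  using assms(2,3)
proof (induction I rule: finite_induct)
  case empty
  then show ?case by (simp add: nat_pow_zero)
next
  case (insert i I)
  then have "f i \<in> carrier R" "f \<in> I \<rightarrow> carrier R" by auto
  then show ?case
    using insert by (simp add: finsum_insert char2_pow_add[OF assms(1)] Pi_def)
qed

end

text \<open>Both morphisms are evaluation at the common image of the variable. Through this lemma
  identities about composition need checking only for constants and the variable.\<close>

lemma up_hom_eqI:
  assumes R: "cring R" and S: "cring S" and f: "f \<in> ring_hom (UP R) S" and g: "g \<in> ring_hom (UP R) S"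
    and c: "\<And>r. r \<in> carrier R \<Longrightarrow> f (monom (UP R) r 0) = g (monom (UP R) r 0)"
    and X: "f (monom (UP R) \<one>\<^bsub>R\<^esub> 1) = g (monom (UP R) \<one>\<^bsub>R\<^esub> 1)"
    and p: "p \<in> carrier (UP R)"
  shows "f p = g p"
proof -
  interpret U: UP_cring R "UP R" by (simp add: UP_cring_def R)
  have h: "(\<lambda>r. f (monom (UP R) r 0)) \<in> ring_hom R S"
    using ring_hom_trans[OF U.const_ring_hom f] by (simp add: comp_def)
  interpret V: UP_pre_univ_prop R S "\<lambda>r. f (monom (UP R) r 0)" "UP R"
    using UP_pre_univ_propI[OF R S h] .
  show ?thesis
    by (rule V.UP_hom_unique[where s = "f (monom (UP R) \<one>\<^bsub>R\<^esub> (Suc 0))"])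
      (use c X p ring_hom_closed[OF f] ring_hom_closed[OF g] V.ring_homD[OF f] V.ring_homD[OF g] in simp_all)
qed

text \<open>
  The flag \<open>u\<close> requires the leading coefficient to be invertible, so that \<^const>\<open>M_set\<close> and
  \<^const>\<open>M_plus_set\<close> are treated together; likewise for \<^const>\<open>B\<close> and \<^const>\<open>B_plus\<close> below.
\<close>

definition add_polys :: "bool \<Rightarrow> (bit, 'a) module \<Rightarrow> nat \<Rightarrow> (nat \<Rightarrow> 'a) set" where
  "add_polys u A n = {p \<in> carrier (UP A). coeff (UP A) p 1 = \<one>\<^bsub>A\<^esub> \<and>
     (\<forall>k. k \<notin> (^) 2 ` {0..n} \<longrightarrow> coeff (UP A) p k = \<zero>\<^bsub>A\<^esub>) \<and>
     (u \<longrightarrow> coeff (UP A) p (2 ^ n) \<in> Units A)}"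

context f2_algebra
begin

abbreviation "P \<equiv> UP A"

sublocale U: UP_cring A P
  by (simp_all add: UP_cring_def is_cring)

lemma UP_add_self: "p \<in> carrier P \<Longrightarrow> p \<oplus>\<^bsub>P\<^esub> p = \<zero>\<^bsub>P\<^esub>"
  by (rule U.up_eqI) (simp_all add: add_self)

lemma additive_poly_closed:
  "(\<And>i. i \<le> n \<Longrightarrow> a i \<in> carrier A) \<Longrightarrow> additive_poly A n a \<in> carrier P"
  unfolding additive_poly_def by (rule U.P.finsum_closed) auto

text \<open>Distinct \<open>i\<close> give distinct exponents \<open>2 ^ i\<close>, so at most one
  monomial contributes to any coefficient.\<close>

lemma coeff_additive_poly:
  assumes a: "\<And>i. i \<le> n \<Longrightarrow> a i \<in> carrier A"
  shows "i \<le> n \<Longrightarrow> coeff P (additive_poly A n a) (2 ^ i) = a i"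
    and "k \<notin> (^) 2 ` {0..n} \<Longrightarrow> coeff P (additive_poly A n a) k = \<zero>"
proof -
  have *: "coeff P (additive_poly A n a) k = (\<Oplus>i\<in>{0..n}. if 2 ^ i = k then a i else \<zero>)" for k
    unfolding additive_poly_def
    by (subst U.coeff_finsum) (use a in \<open>auto intro!: finsum_cong'\<close>)
  show "coeff P (additive_poly A n a) (2 ^ i) = a i" if "i \<le> n"
    unfolding * using add.finprod_singleton_swap[of i "{0..n}" a] that a by (simp add: Pi_def)
  show "coeff P (additive_poly A n a) k = \<zero>" if "k \<notin> (^) 2 ` {0..n}"
    unfolding * by (rule add.finprod_one_eqI) (use that in auto)
qed

lemma additive_poly_coeff:
  assumes "p \<in> carrier P" "\<And>k. k \<notin> (^) 2 ` {0..n} \<Longrightarrow> coeff P p k = \<zero>"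
  shows "additive_poly A n (\<lambda>i. coeff P p (2 ^ i)) = p"
proof (rule U.up_eqI)
  have c: "i \<le> n \<Longrightarrow> coeff P p (2 ^ i) \<in> carrier A" for i
    using assms(1) by simp
  show "additive_poly A n (\<lambda>i. coeff P p (2 ^ i)) \<in> carrier P"
    using c by (rule additive_poly_closed)
  show "coeff P (additive_poly A n (\<lambda>i. coeff P p (2 ^ i))) k = coeff P p k" for k
  proof (cases "k \<in> (^) 2 ` {0..n}")
    case True
    then show ?thesis by (auto simp: coeff_additive_poly(1)[OF c])
  next
    case False
    then show ?thesis by (simp add: coeff_additive_poly(2)[OF c] assms(2))
  qed
qed (rule assms(1))

text \<open>Connects the conditions on coefficients, which do not depend on a chosen sequence
  \<open>a\<close> and are easy to transport, with the explicit sums in \<open>M_set\<close> and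
  \<open>M_plus_set\<close>.\<close>

lemma add_polys_eq:
  "add_polys u A n = {additive_poly A n a | a.
     (\<forall>i\<le>n. a i \<in> carrier A) \<and> a 0 = \<one> \<and> (u \<longrightarrow> a n \<in> Units A)}"
proof (intro equalityI subsetI)
  fix p assume "p \<in> add_polys u A n"
  then have p: "p \<in> carrier P" "coeff P p 1 = \<one>" "\<And>k. k \<notin> (^) 2 ` {0..n} \<Longrightarrow> coeff P p k = \<zero>"
    "u \<longrightarrow> coeff P p (2 ^ n) \<in> Units A"
    by (auto simp: add_polys_def)
  show "p \<in> {additive_poly A n a | a. (\<forall>i\<le>n. a i \<in> carrier A) \<and> a 0 = \<one> \<and> (u \<longrightarrow> a n \<in> Units A)}"
    unfolding mem_Collect_eq
    by (rule exI[of _ "\<lambda>i. coeff P p (2 ^ i)"]) (use p additive_poly_coeff[OF p(1,3)] in simp)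
next
  fix p assume "p \<in> {additive_poly A n a | a. (\<forall>i\<le>n. a i \<in> carrier A) \<and> a 0 = \<one> \<and> (u \<longrightarrow> a n \<in> Units A)}"
  then obtain a where a: "p = additive_poly A n a" "\<And>i. i \<le> n \<Longrightarrow> a i \<in> carrier A" "a 0 = \<one>" "u \<longrightarrow> a n \<in> Units A"
    by blast
  then show "p \<in> add_polys u A n"
    using coeff_additive_poly[where n = n and a = a, OF a(2)]
      coeff_additive_poly(1)[where n = n and a = a and i = 0, OF a(2)]
      additive_poly_closed[where n = n and a = a, OF a(2)]
    by (simp add: add_polys_def)
qed

lemma M_set_eq: "M_set A n = add_polys True A n" "M_plus_set A n = add_polys False A n"
  by (auto simp: add_polys_eq M_set_def M_plus_set_def)

text \<open>Substitution of \<open>g\<close> is evaluation at \<open>g\<close> over the inclusion of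
  constants, so these are instances of the universal property of \<open>P\<close> with target
  \<open>P\<close> itself.\<close>

lemma compose_ring_hom: "g \<in> carrier P \<Longrightarrow> (\<lambda>f. up_compose A f g) \<in> ring_hom P P"
  and compose_const: "g \<in> carrier P \<Longrightarrow> a \<in> carrier A \<Longrightarrow> up_compose A (monom P a 0) g = monom P a 0"
  and compose_monom: "g \<in> carrier P \<Longrightarrow> a \<in> carrier A \<Longrightarrow>
    up_compose A (monom P a n) g = monom P a 0 \<otimes>\<^bsub>P\<^esub> g [^]\<^bsub>P\<^esub> n"
  and compose_X: "g \<in> carrier P \<Longrightarrow> up_compose A (up_X A) g = g"
proof -
  interpret V: UP_pre_univ_prop A P "\<lambda>a. monom P a 0" P
    by (rule UP_pre_univ_propI[OF is_cring U.UP_cring U.const_ring_hom])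
  show "g \<in> carrier P \<Longrightarrow> (\<lambda>f. up_compose A f g) \<in> ring_hom P P"
    unfolding up_compose_def by (rule V.eval_ring_hom)
  show "g \<in> carrier P \<Longrightarrow> a \<in> carrier A \<Longrightarrow> up_compose A (monom P a 0) g = monom P a 0"
    unfolding up_compose_def by (rule V.eval_const)
  show "g \<in> carrier P \<Longrightarrow> a \<in> carrier A \<Longrightarrow>
    up_compose A (monom P a n) g = monom P a 0 \<otimes>\<^bsub>P\<^esub> g [^]\<^bsub>P\<^esub> n"
    unfolding up_compose_def by (rule V.eval_monom)
  show "g \<in> carrier P \<Longrightarrow> up_compose A (up_X A) g = g"
    unfolding up_compose_def up_X_def by (rule V.eval_monom1)
qed

lemma up_X_closed: "up_X A \<in> carrier P"
  by (simp add: up_X_def)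

lemma up_compose_closed: "f \<in> carrier P \<Longrightarrow> g \<in> carrier P \<Longrightarrow> up_compose A f g \<in> carrier P"
  using ring_hom_closed[OF compose_ring_hom] by simp

text \<open>Both sides are ring homomorphisms in the outer polynomial \<open>f\<close>. They fix
  constants and send the variable to \<open>up_compose A g h\<close>.\<close>

lemma up_compose_assoc:
  assumes "f \<in> carrier P" "g \<in> carrier P" "h \<in> carrier P"
  shows "up_compose A (up_compose A f g) h = up_compose A f (up_compose A g h)"
proof (rule up_hom_eqI[OF is_cring U.UP_cring _ _ _ _ assms(1),
      where f = "\<lambda>f. up_compose A (up_compose A f g) h"])
  note gh = up_compose_closed[OF assms(2,3)]
  show "(\<lambda>f. up_compose A (up_compose A f g) h) \<in> ring_hom P P"
    using ring_hom_trans[OF compose_ring_hom[OF assms(2)] compose_ring_hom[OF assms(3)]]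
    by (simp add: comp_def)
  show "(\<lambda>f. up_compose A f (up_compose A g h)) \<in> ring_hom P P"
    by (rule compose_ring_hom[OF gh])
  show "up_compose A (up_compose A (monom P r 0) g) h = up_compose A (monom P r 0) (up_compose A g h)"
    if "r \<in> carrier A" for r
    using that assms gh by (simp add: compose_const)
  show "up_compose A (up_compose A (monom P \<one> 1) g) h = up_compose A (monom P \<one> 1) (up_compose A g h)"
    using compose_X[OF assms(2)] compose_X[OF gh] by (simp only: up_X_def)
qed

lemma compose_X_right:
  assumes "f \<in> carrier P"
  shows "up_compose A f (up_X A) = f"
proof (rule up_hom_eqI[OF is_cring U.UP_cring _ _ _ _ assms, where f = "\<lambda>f. up_compose A f (up_X A)"])
  show "(\<lambda>f. f) \<in> ring_hom P P" by (simp add: ring_hom_def)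
qed (use compose_ring_hom[OF up_X_closed] compose_const[OF up_X_closed] compose_X[OF up_X_closed]
  in \<open>simp_all add: up_X_def\<close>)

lemma up_X_add_polys: "up_X A \<in> add_polys u A 0"
  by (auto simp: add_polys_def up_X_def)

text \<open>Raising to a power of two is additive, so the power of a sum has no mixed terms: each
  monomial of exponent \<open>2 ^ s\<close> moves to exponent \<open>2 ^ (s + t)\<close>.\<close>

lemma coeff_pow_add_polys:
  assumes "g \<in> add_polys u A m"
  shows "coeff P (g [^]\<^bsub>P\<^esub> (2 ^ t :: nat)) k =
    (\<Oplus>s\<in>{0..m}. if 2 ^ (s + t) = k then coeff P g (2 ^ s) [^] (2 ^ t :: nat) else \<zero>)"
proof -
  have g: "g \<in> carrier P" "\<And>k. k \<notin> (^) 2 ` {0..m} \<Longrightarrow> coeff P g k = \<zero>"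
    using assms by (auto simp: add_polys_def)
  have "g [^]\<^bsub>P\<^esub> (2 ^ t :: nat) = (\<Oplus>\<^bsub>P\<^esub>s\<in>{0..m}. monom P (coeff P g (2 ^ s)) (2 ^ s)) [^]\<^bsub>P\<^esub> (2 ^ t :: nat)"
    using additive_poly_coeff[OF g] by (simp add: additive_poly_def)
  also have "\<dots> = (\<Oplus>\<^bsub>P\<^esub>s\<in>{0..m}. monom P (coeff P g (2 ^ s)) (2 ^ s) [^]\<^bsub>P\<^esub> (2 ^ t :: nat))"
    by (rule U.P.char2_pow_finsum) (use UP_add_self g in auto)
  also have "\<dots> = (\<Oplus>\<^bsub>P\<^esub>s\<in>{0..m}. monom P (coeff P g (2 ^ s) [^] (2 ^ t :: nat)) (2 ^ (s + t)))"
    by (rule U.P.finsum_cong') (use g in \<open>auto simp: U.monom_pow power_add\<close>)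
  finally show ?thesis
    using g by (simp add: U.coeff_finsum Pi_def)
qed

text \<open>The source of the coproduct formula on generators: at \<open>k = 2 ^ r\<close> only the
  pairs with s + t = r survive, each contributing \<open>a_t\<close> times the
  \<open>2 ^ t\<close>-th power of \<open>b_s\<close>, for coefficients \<open>a\<close> of
  \<open>f\<close> and \<open>b\<close> of \<open>g\<close>.\<close>

lemma coeff_up_compose:
  assumes f: "f \<in> add_polys v A n" and g: "g \<in> add_polys u A m"
  shows "coeff P (up_compose A f g) k = (\<Oplus>t\<in>{0..n}. coeff P f (2 ^ t) \<otimes>
    (\<Oplus>s\<in>{0..m}. if 2 ^ (s + t) = k then coeff P g (2 ^ s) [^] (2 ^ t :: nat) else \<zero>))"
proof -
  have g': "g \<in> carrier P" using g by (simp add: add_polys_def)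
  have f': "f \<in> carrier P" "\<And>k. k \<notin> (^) 2 ` {0..n} \<Longrightarrow> coeff P f k = \<zero>"
    using f by (auto simp: add_polys_def)
  interpret h: ring_hom_cring P P "\<lambda>f. up_compose A f g"
    by (rule ring_hom_cringI[OF U.UP_cring U.UP_cring compose_ring_hom[OF g']])
  have "up_compose A f g = up_compose A (\<Oplus>\<^bsub>P\<^esub>t\<in>{0..n}. monom P (coeff P f (2 ^ t)) (2 ^ t)) g"
    using additive_poly_coeff[OF f'] by (simp add: additive_poly_def)
  also have "\<dots> = (\<Oplus>\<^bsub>P\<^esub>t\<in>{0..n}. up_compose A (monom P (coeff P f (2 ^ t)) (2 ^ t)) g)"
    by (subst h.hom_finsum) (use f' in \<open>auto simp: comp_def\<close>)
  also have "\<dots> = (\<Oplus>\<^bsub>P\<^esub>t\<in>{0..n}. coeff P f (2 ^ t) \<odot>\<^bsub>P\<^esub> g [^]\<^bsub>P\<^esub> (2 ^ t :: nat))"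
    by (rule U.P.finsum_cong') (use f' g' in \<open>auto simp: compose_monom U.monom_mult_is_smult\<close>)
  finally show ?thesis
    by (simp add: U.coeff_finsum f' g' Pi_def coeff_pow_add_polys[OF g])
qed

lemma Units_nat_pow: "x \<in> Units A \<Longrightarrow> x [^] (n::nat) \<in> Units A"
  by (induction n) auto

text \<open>Only exponents \<open>2 ^ (s + t)\<close> occur. At the two ends, 1 and
  \<open>2 ^ (m + n)\<close>, a single pair (s, t) contributes, so these coefficients are products
  and inherit being 1 or a unit. The inner degree comes first in \<open>m + n\<close>, as does the
  inner tensor factor in the coproduct.\<close>

lemma up_compose_add_polys:
  assumes f: "f \<in> add_polys u A n" and g: "g \<in> add_polys u A m"
  shows "up_compose A f g \<in> add_polys u A (m + n)"
proof -
  have g': "g \<in> carrier P" "coeff P g 1 = \<one>" "u \<longrightarrow> coeff P g (2 ^ m) \<in> Units A"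
    using g by (auto simp: add_polys_def)
  have f': "f \<in> carrier P" "coeff P f 1 = \<one>" "u \<longrightarrow> coeff P f (2 ^ n) \<in> Units A"
    using f by (auto simp: add_polys_def)
  note c = coeff_up_compose[OF f g]
  have inner: "(\<Oplus>s\<in>{0..m}. if 2 ^ (s + t) = (2::nat) ^ (s0 + t) then coeff P g (2 ^ s) [^] (2 ^ t :: nat) else \<zero>) =
      coeff P g (2 ^ s0) [^] (2 ^ t :: nat)" if "s0 \<le> m" for s0 t
    using add.finprod_singleton_swap[of s0 "{0..m}" "\<lambda>s. coeff P g (2 ^ s) [^] (2 ^ t :: nat)"] that g'
    by (simp add: Pi_def)
  \<comment> \<open>The uniqueness condition on (s0, t0) will be met by (0, 0) and by (m,
    n).\<close>
  have single: "coeff P (up_compose A f g) (2 ^ (s0 + t0)) = coeff P f (2 ^ t0) \<otimes> coeff P g (2 ^ s0) [^] (2 ^ t0 :: nat)"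
    if st: "s0 \<le> m" "t0 \<le> n" and u: "\<And>s t. s \<le> m \<Longrightarrow> t \<le> n \<Longrightarrow> s + t = s0 + t0 \<Longrightarrow> t = t0" for s0 t0
  proof -
    have "coeff P (up_compose A f g) (2 ^ (s0 + t0)) =
      (\<Oplus>t\<in>{0..n}. if t = t0 then coeff P f (2 ^ t) \<otimes> coeff P g (2 ^ s0) [^] (2 ^ t :: nat) else \<zero>)"
      unfolding c
    proof (rule finsum_cong')
      fix t assume t: "t \<in> {0..n}"
      show "coeff P f (2 ^ t) \<otimes> (\<Oplus>s\<in>{0..m}. if 2 ^ (s + t) = (2::nat) ^ (s0 + t0) then coeff P g (2 ^ s) [^] (2 ^ t :: nat) else \<zero>)
        = (if t = t0 then coeff P f (2 ^ t) \<otimes> coeff P g (2 ^ s0) [^] (2 ^ t :: nat) else \<zero>)"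
      proof (cases "t = t0")
        case True
        show ?thesis by (simp only: True refl if_True inner[OF st(1)])
      next
        case False
        have "(\<Oplus>s\<in>{0..m}. if 2 ^ (s + t) = (2::nat) ^ (s0 + t0) then coeff P g (2 ^ s) [^] (2 ^ t :: nat) else \<zero>) = \<zero>"
          by (rule add.finprod_one_eqI) (use False u t in auto)
        then show ?thesis using False f' by simp
      qed
    qed (use f' g' in auto)
    also have "\<dots> = coeff P f (2 ^ t0) \<otimes> coeff P g (2 ^ s0) [^] (2 ^ t0 :: nat)"
      by (rule add.finprod_singleton_swap) (use st f' g' in auto)
    finally show ?thesis .
  qed
  have "coeff P (up_compose A f g) 1 = \<one>"
    using single[of 0 0] f' g' by simp
  moreover have "coeff P (up_compose A f g) (2 ^ (m + n)) \<in> Units A" if u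
    using single[of m n] f' g' that by (simp add: Units_nat_pow)
  moreover have "coeff P (up_compose A f g) k = \<zero>" if "k \<notin> (^) 2 ` {0..m + n}" for k
  proof -
    have "coeff P f (2 ^ t) \<otimes> (\<Oplus>s\<in>{0..m}. if 2 ^ (s + t) = k then coeff P g (2 ^ s) [^] (2 ^ t :: nat) else \<zero>) = \<zero>"
      if "t \<in> {0..n}" for t
    proof -
      have "(\<Oplus>s\<in>{0..m}. if 2 ^ (s + t) = k then coeff P g (2 ^ s) [^] (2 ^ t :: nat) else \<zero>) = \<zero>"
        by (rule add.finprod_one_eqI) (use \<open>k \<notin> _\<close> that in auto)
      then show ?thesis using f' by simp
    qed
    then show ?thesis
      unfolding c by (rule add.finprod_one_eqI)
  qed
  ultimately show ?thesis
    using up_compose_closed[OF f'(1) g'(1)] by (simp add: add_polys_def)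
qed

end

section \<open>Change of coefficients along a morphism\<close>

lemma up_eqI:
  assumes "F2_algebra A" "p \<in> carrier (UP A)" "q \<in> carrier (UP A)"
    "\<And>k. coeff (UP A) p k = coeff (UP A) q k"
  shows "p = q"
proof -
  interpret f2_algebra A by (rule f2_algebraI) fact
  show ?thesis using assms by (intro U.up_eqI)
qed

lemma
  assumes A: "F2_algebra A" "F2_algebra A'" and f: "f \<in> alg_hom A A'"
  shows up_map_closed: "p \<in> carrier (UP A) \<Longrightarrow> up_map A f p \<in> carrier (UP A')"
    and coeff_up_map: "p \<in> carrier (UP A) \<Longrightarrow> coeff (UP A') (up_map A f p) k = f (coeff (UP A) p k)"
    and up_map_X: "up_map A f (up_X A) = up_X A'"
    and up_map_compose: "p \<in> carrier (UP A) \<Longrightarrow> q \<in> carrier (UP A) \<Longrightarrow>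
      up_map A f (up_compose A p q) = up_compose A' (up_map A f p) (up_map A f q)"
    and up_map_add_polys: "p \<in> add_polys u A m \<Longrightarrow> up_map A f p \<in> add_polys u A' m"
proof -
  interpret A: f2_algebra A by (rule f2_algebraI) fact
  interpret A': f2_algebra A' by (rule f2_algebraI) fact
  interpret f: ring_hom_cring A A' f by (rule ring_hom_cring_alg_hom) fact+
  have up: "up_map A f p \<in> up A'" if "p \<in> carrier (UP A)" for p
  proof -
    have p: "p \<in> up A" using that by (simp add: UP_def)
    then obtain n where "bound \<zero>\<^bsub>A\<^esub> n p" by auto
    then have "bound \<zero>\<^bsub>A'\<^esub> n (up_map A f p)"
      using p by (auto simp: up_map_def UP_def)
    then show ?thesis
      using p that by (auto simp: up_map_def intro!: mem_upI)
  qed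
  then show cl: "up_map A f p \<in> carrier (UP A')" if "p \<in> carrier (UP A)" for p
    using that by (simp add: UP_def)
  show co: "coeff (UP A') (up_map A f p) k = f (coeff (UP A) p k)" if "p \<in> carrier (UP A)" for p k
    using up[OF that] by (simp add: UP_def up_map_def)
  have hom: "up_map A f \<in> ring_hom (UP A) (UP A')"
  proof (rule ring_hom_memI)
    show "up_map A f \<one>\<^bsub>UP A\<^esub> = \<one>\<^bsub>UP A'\<^esub>"
      by (rule up_eqI[OF A(2)]) (simp_all add: cl co)
    fix p q assume pq: "p \<in> carrier (UP A)" "q \<in> carrier (UP A)"
    show "up_map A f (p \<oplus>\<^bsub>UP A\<^esub> q) = up_map A f p \<oplus>\<^bsub>UP A'\<^esub> up_map A f q"
      by (rule up_eqI[OF A(2)]) (use pq in \<open>simp_all add: cl co\<close>)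
    show "up_map A f (p \<otimes>\<^bsub>UP A\<^esub> q) = up_map A f p \<otimes>\<^bsub>UP A'\<^esub> up_map A f q"
      by (rule up_eqI[OF A(2)]) (use pq in \<open>simp_all add: cl co Pi_def comp_def\<close>)
  qed (rule cl)
  have mon: "up_map A f (monom (UP A) a n) = monom (UP A') (f a) n" if "a \<in> carrier A" for a n
    by (rule up_eqI[OF A(2)]) (use that in \<open>simp_all add: cl co\<close>)
  then show X: "up_map A f (up_X A) = up_X A'"
    by (simp add: up_X_def)
  show "up_map A f (up_compose A p q) = up_compose A' (up_map A f p) (up_map A f q)"
    if p: "p \<in> carrier (UP A)" and q: "q \<in> carrier (UP A)" for p q
  \<comment> \<open>As for associativity, both sides are ring homomorphisms in the outer
    polynomial.\<close>
  proof (rule up_hom_eqI[OF A.is_cring A'.U.UP_cring _ _ _ _ p, where f = "\<lambda>p. up_map A f (up_compose A p q)"])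
    note q' = cl[OF q]
    show "(\<lambda>p. up_map A f (up_compose A p q)) \<in> ring_hom (UP A) (UP A')"
      using ring_hom_trans[OF A.compose_ring_hom[OF q] hom] by (simp add: comp_def)
    show "(\<lambda>p. up_compose A' (up_map A f p) (up_map A f q)) \<in> ring_hom (UP A) (UP A')"
      using ring_hom_trans[OF hom A'.compose_ring_hom[OF q']] by (simp add: comp_def)
    show "up_map A f (up_compose A (monom (UP A) r 0) q) = up_compose A' (up_map A f (monom (UP A) r 0)) (up_map A f q)"
      if "r \<in> carrier A" for r
      using that q q' by (simp add: A.compose_const A'.compose_const mon)
    show "up_map A f (up_compose A (monom (UP A) \<one>\<^bsub>A\<^esub> 1) q) = up_compose A' (up_map A f (monom (UP A) \<one>\<^bsub>A\<^esub> 1)) (up_map A f q)"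
      using A.compose_X[OF q] A'.compose_X[OF q'] X by (simp only: up_X_def)
  qed
  show "up_map A f p \<in> add_polys u A' m" if "p \<in> add_polys u A m" for p
  proof -
    have "f x \<in> Units A'" if "x \<in> Units A" for x
    proof -
      have "f (inv\<^bsub>A\<^esub> x) \<otimes>\<^bsub>A'\<^esub> f x = \<one>\<^bsub>A'\<^esub>" "f x \<otimes>\<^bsub>A'\<^esub> f (inv\<^bsub>A\<^esub> x) = \<one>\<^bsub>A'\<^esub>"
        using that by (simp_all add: A.Units_closed A.Units_inv_closed f.hom_mult[symmetric] del: f.hom_mult)
      then show ?thesis
        unfolding Units_def using that by (auto simp: A.Units_closed intro!: bexI[of _ "f (inv\<^bsub>A\<^esub> x)"])
    qed
    then show ?thesis
      using that by (auto simp: add_polys_def cl co)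
  qed
qed

text \<open>\<open>compose\<close> is undefined off the carrier, but the coefficients of
  \<open>p\<close> never leave it.\<close>

lemma up_map_comp:
  assumes "F2_algebra A" "F2_algebra A'" "f \<in> alg_hom A A'" "p \<in> carrier (UP A)"
  shows "up_map A (compose (carrier A) g f) p = up_map A' g (up_map A f p)"
proof -
  interpret A: f2_algebra A by (rule f2_algebraI) fact
  show ?thesis
    by (simp only: up_map_def[of A "compose (carrier A) g f"] up_map_def[of A' g]
        coeff_up_map[OF assms] compose_eq[OF A.U.coeff_closed[OF assms(4)]])
qed

lemma up_map_id:
  assumes "F2_algebra A" "p \<in> carrier (UP A)"
  shows "up_map A (alg_id A) p = p"
proof -
  interpret A: f2_algebra A by (rule f2_algebraI) fact
  show ?thesis
    by (rule up_eqI[OF assms(1)])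
      (use assms(2) in \<open>simp_all add: up_map_closed[OF assms(1,1) alg_hom_alg_id[OF assms(1)]]
        coeff_up_map[OF assms(1,1) alg_hom_alg_id[OF assms(1)]]\<close>)
qed

section \<open>Laurent polynomials and their universal property\<close>

text \<open>A submonoid of the exponent vectors, whose monoid algebra is \<open>B n\<close> or
  \<open>B_plus n\<close> according to \<open>u\<close>. For \<open>n = 0\<close> it is trivial for
  either value of \<open>u\<close>, which gives connectedness.\<close>

definition exps :: "bool \<Rightarrow> nat \<Rightarrow> (nat \<Rightarrow>\<^sub>0 int) set" where
  "exps u n = {m. Poly_Mapping.keys m \<subseteq> {1..n} \<and>
     (\<forall>i. Poly_Mapping.lookup m i < 0 \<longrightarrow> u \<and> i = n)}"

definition rep_alg :: "bool \<Rightarrow> nat \<Rightarrow> (bit, laurent) module" where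
  "rep_alg u n = laurent_subalg {p. Poly_Mapping.keys p \<subseteq> exps u n}"

lemma B_eq: "B = rep_alg True"
proof
  fix n
  have "Poly_Mapping.keys m \<subseteq> {1..n} \<and> (\<forall>i<n. Poly_Mapping.lookup m i \<ge> 0) \<longleftrightarrow> m \<in> exps True n"
    for m :: "nat \<Rightarrow>\<^sub>0 int"
  proof -
    \<comment> \<open>The definition of \<open>B\<close> restricts signs only below
      \<open>n\<close>; above \<open>n\<close> exponents vanish because the support lies in
      \<open>{1..n}\<close>.\<close>
    have "Poly_Mapping.lookup m i = 0" if "Poly_Mapping.keys m \<subseteq> {1..n}" "i > n" for i
      using that by (metis atLeastAtMost_iff in_keys_iff linorder_not_le subsetD)
    then show ?thesis
      unfolding exps_def by (auto simp: not_less) (metis leD less_irrefl linorder_neqE_nat)+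
  qed
  then show "B n = rep_alg True n"
    unfolding B_def rep_alg_def by (simp add: Ball_def subset_iff del: atLeastAtMost_iff)
qed

lemma B_plus_eq: "B_plus = rep_alg False"
  by (auto simp: fun_eq_iff B_plus_def rep_alg_def exps_def subset_iff not_less
      intro!: arg_cong[where f = laurent_subalg])

lemma exps_0: "0 \<in> exps u n"
  by (simp add: exps_def)

lemma exps_add: "m \<in> exps u n \<Longrightarrow> m' \<in> exps u n \<Longrightarrow> m + m' \<in> exps u n"
proof -
  assume m: "m \<in> exps u n" "m' \<in> exps u n"
  then have "Poly_Mapping.keys (m + m') \<subseteq> {1..n}"
    using Poly_Mapping.keys_add[of m m'] unfolding exps_def by blast
  moreover have "u \<and> i = n" if "Poly_Mapping.lookup m i + Poly_Mapping.lookup m' i < 0" for i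
  proof -
    have "Poly_Mapping.lookup m i < 0 \<or> Poly_Mapping.lookup m' i < 0" using that by linarith
    then show ?thesis using m unfolding exps_def by blast
  qed
  ultimately show ?thesis
    by (simp add: exps_def lookup_add)
qed

lemma exps_single: "i \<in> {1..n} \<Longrightarrow> z < 0 \<longrightarrow> u \<and> i = n \<Longrightarrow> Poly_Mapping.single i z \<in> exps u n"
  by (auto simp: exps_def lookup_single when_def)

lemma laurent_subalg_simps [simp]:
  "carrier (laurent_subalg S) = S" "p \<otimes>\<^bsub>laurent_subalg S\<^esub> q = p * q"
  "\<one>\<^bsub>laurent_subalg S\<^esub> = 1" "\<zero>\<^bsub>laurent_subalg S\<^esub> = 0" "p \<oplus>\<^bsub>laurent_subalg S\<^esub> q = p + q"
  "c \<odot>\<^bsub>laurent_subalg S\<^esub> p = Poly_Mapping.single 0 c * p"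
  by (simp_all add: laurent_subalg_def)

lemma rep_alg_simps [simp]:
  "carrier (rep_alg u n) = {p. Poly_Mapping.keys p \<subseteq> exps u n}" "p \<otimes>\<^bsub>rep_alg u n\<^esub> q = p * q"
  "\<one>\<^bsub>rep_alg u n\<^esub> = 1" "\<zero>\<^bsub>rep_alg u n\<^esub> = 0" "p \<oplus>\<^bsub>rep_alg u n\<^esub> q = p + q"
  by (simp_all add: rep_alg_def)

lemma keys_mult_closed:
  assumes "\<And>m m'. m \<in> S \<Longrightarrow> m' \<in> S \<Longrightarrow> m + m' \<in> S"
    "Poly_Mapping.keys p \<subseteq> S" "Poly_Mapping.keys q \<subseteq> S"
  shows "Poly_Mapping.keys (p * q :: laurent) \<subseteq> S"
  using Poly_Mapping.keys_mult[of p q] assms by fastforce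

lemma F2_algebra_rep_alg: "F2_algebra (rep_alg u n)"
proof (rule F2_algebraI)
  show "cring (rep_alg u n)"
  proof (rule cringI)
    show "abelian_group (rep_alg u n)"
    proof (rule abelian_groupI)
      show "\<exists>q\<in>carrier (rep_alg u n). q \<oplus>\<^bsub>rep_alg u n\<^esub> p = \<zero>\<^bsub>rep_alg u n\<^esub>"
        if "p \<in> carrier (rep_alg u n)" for p
        using that by (intro bexI[of _ p]) simp_all
    qed (simp_all add: keys_add_bit ac_simps)
    show "Group.comm_monoid (rep_alg u n)"
      by (rule comm_monoidI)
        (simp_all add: keys_mult_closed exps_add exps_0 ac_simps)
  qed (simp add: algebra_simps)
  show "c \<odot>\<^bsub>rep_alg u n\<^esub> p = (if c = 1 then p else \<zero>\<^bsub>rep_alg u n\<^esub>)" for c p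
    using bit_cases[of c] by (auto simp: rep_alg_def)
qed simp

interpretation rep_alg: f2_algebra "rep_alg u n" for u n
  by (rule f2_algebraI[OF F2_algebra_rep_alg])

section \<open>Generators of the representing algebras\<close>

lemma laurent_monomial_add:
  "Poly_Mapping.single (m + m') 1 = Poly_Mapping.single m 1 * (Poly_Mapping.single m' 1 :: laurent)"
  by (simp add: mult_single)

lemma \<alpha>_closed: "i \<le> n \<Longrightarrow> \<alpha> i \<in> carrier (rep_alg u n)"
  by (simp add: \<alpha>_def exps_0 exps_single)

text \<open>The value at 0 mirrors \<alpha> 0 = 1, so that \<open>\<alpha>_mult_inv\<close> holds in
  degree 0 as well.\<close>

definition \<alpha>_inv :: "nat \<Rightarrow> laurent" where
  "\<alpha>_inv i = (if i = 0 then 1 else Poly_Mapping.single (Poly_Mapping.single i (- 1)) 1)"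

lemma \<alpha>_inv_closed: "\<alpha>_inv n \<in> carrier (rep_alg True n)"
  by (simp add: \<alpha>_inv_def exps_0 exps_single)

lemma \<alpha>_mult_inv: "\<alpha> n * \<alpha>_inv n = 1"
  by (simp add: \<alpha>_def \<alpha>_inv_def laurent_monomial_add[symmetric] single_add[symmetric] del: One_nat_def)

text \<open>Monomials are products of powers of single variables, and every element is a sum of
  monomials without coefficients. It will be applied to the set \<open>K\<close> on which two
  morphisms agree.\<close>

lemma rep_alg_generated:
  assumes one: "1 \<in> K" and mult: "\<And>p q. p \<in> K \<Longrightarrow> q \<in> K \<Longrightarrow> p * q \<in> K"
    and add: "\<And>p q. p \<in> K \<Longrightarrow> q \<in> K \<Longrightarrow> p + q \<in> K"
    and gen: "\<And>i. i \<in> {1..n} \<Longrightarrow> \<alpha> i \<in> K" and inv: "u \<Longrightarrow> \<alpha>_inv n \<in> K"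
  shows "carrier (rep_alg u n) \<subseteq> K"
proof -
  have pow: "Poly_Mapping.single (Poly_Mapping.single i z) 1 \<in> K"
    if i: "i \<in> {1..n}" and z: "z < 0 \<longrightarrow> u \<and> i = n" for i and z :: int
  proof (cases "z < 0")
    case False
    have "Poly_Mapping.single (Poly_Mapping.single i (int k)) 1 \<in> K" for k
    proof (induction k)
      case (Suc k)
      have "Poly_Mapping.single (Poly_Mapping.single i (int (Suc k))) 1 =
          Poly_Mapping.single (Poly_Mapping.single i (int k)) 1 * \<alpha> i"
        using i by (simp add: \<alpha>_def laurent_monomial_add[symmetric] single_add[symmetric] add.commute del: One_nat_def)
      then show ?case using mult[OF Suc gen[OF i]] by simp
    qed (use one in simp)
    from this[of "nat z"] show ?thesis using False by simp
  next
    case True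
    then have u: "u" "i = n" using z by auto
    have "Poly_Mapping.single (Poly_Mapping.single i (- int k)) 1 \<in> K" for k
    proof (induction k)
      case (Suc k)
      have "Poly_Mapping.single (Poly_Mapping.single i (- int (Suc k))) 1 =
          Poly_Mapping.single (Poly_Mapping.single i (- int k)) 1 * \<alpha>_inv n"
        using i u by (simp add: \<alpha>_inv_def laurent_monomial_add[symmetric] single_add[symmetric] add.commute del: One_nat_def)
      then show ?case using mult[OF Suc inv[OF u(1)]] by simp
    qed (use one in simp)
    from this[of "nat (- z)"] show ?thesis using True by simp
  qed
  have mono: "Poly_Mapping.single m 1 \<in> K" if m: "m \<in> exps u n" for m
  proof -
    have "Poly_Mapping.single (\<Sum>i\<in>I. Poly_Mapping.single i (Poly_Mapping.lookup m i)) 1 \<in> K"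
      if "finite I" "I \<subseteq> {1..n}" for I
      using that
    proof (induction I rule: finite_induct)
      case (insert i I)
      have "Poly_Mapping.lookup m i < 0 \<longrightarrow> u \<and> i = n"
        using m by (auto simp: exps_def)
      then show ?case
        using insert pow mult by (simp add: laurent_monomial_add)
    qed (use one in simp)
    moreover have "m = (\<Sum>i\<in>{1..n}. Poly_Mapping.single i (Poly_Mapping.lookup m i))"
    proof (rule poly_mapping_eqI)
      fix k
      have "(\<Sum>i\<in>{1..n}. Poly_Mapping.lookup (Poly_Mapping.single i (Poly_Mapping.lookup m i)) k) =
        (\<Sum>i\<in>{1..n}. if k = i then Poly_Mapping.lookup m i else 0)"
        by (rule sum.cong) (auto simp: lookup_single when_def)
      also have "\<dots> = Poly_Mapping.lookup m k"
        using m by (auto simp: exps_def in_keys_iff)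
      finally show "Poly_Mapping.lookup m k =
        Poly_Mapping.lookup (\<Sum>i\<in>{1..n}. Poly_Mapping.single i (Poly_Mapping.lookup m i)) k"
        by (simp add: lookup_sum)
    qed
    ultimately show ?thesis by fastforce
  qed
  show ?thesis
  proof
    fix p assume "p \<in> carrier (rep_alg u n)"
    then have "Poly_Mapping.keys p \<subseteq> exps u n" by simp
    then show "p \<in> K"
    proof (induction p rule: poly_mapping_bit_induct)
      case zero
      \<comment> \<open>Zero is obtained as 1 + 1.\<close>
      then show ?case using add[OF one one] by simp
    next
      case (add p m)
      then show ?case using mono assms(3) by blast
    qed
  qed
qed

text \<open>The generators \<alpha> 1, ..., \<alpha> n suffice even when \<alpha> n is inverted,
  since the image of the inverse is the unique inverse of the image.\<close>

lemma rep_alg_hom_eqI: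
  assumes A: "F2_algebra A" and h: "\<phi> \<in> alg_hom (rep_alg u n) A" "\<psi> \<in> alg_hom (rep_alg u n) A"
    and eq: "\<And>i. i \<in> {1..n} \<Longrightarrow> \<phi> (\<alpha> i) = \<psi> (\<alpha> i)"
  shows "\<phi> = \<psi>"
proof (rule alg_hom_eqI[OF h])
  interpret A: f2_algebra A by (rule f2_algebraI[OF A])
  note r = h[THEN alg_hom_ring_hom]
  note one = r[THEN ring_hom_one] and mult = r[THEN ring_hom_mult] and add = r[THEN ring_hom_add]
  note cl = h[THEN alg_hom_closed]
  have "\<phi> (\<alpha>_inv n) = \<psi> (\<alpha>_inv n)" if u
  proof (rule A.inv_unique)
    have i: "\<alpha>_inv n \<in> carrier (rep_alg u n)" using \<alpha>_inv_closed that by simp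
    have a: "\<alpha> n \<in> carrier (rep_alg u n)" by (rule \<alpha>_closed) simp
    show "\<phi> (\<alpha>_inv n) \<otimes>\<^bsub>A\<^esub> \<phi> (\<alpha> n) = \<one>\<^bsub>A\<^esub>"
      using mult(1)[OF i a] one \<alpha>_mult_inv[of n] by (simp add: mult.commute)
    \<comment> \<open>In degree 0 the element \<alpha> n is not among the generators compared; it is
      1 and has image 1.\<close>
    have e: "\<phi> (\<alpha> n) = \<psi> (\<alpha> n)"
      using eq one by (cases "n = 0") (auto simp: \<alpha>_def)
    show "\<phi> (\<alpha> n) \<otimes>\<^bsub>A\<^esub> \<psi> (\<alpha>_inv n) = \<one>\<^bsub>A\<^esub>"
      unfolding e using mult(2)[OF a i] one \<alpha>_mult_inv[of n] by simp
  qed (use cl \<alpha>_closed[of n n u] \<alpha>_inv_closed[of n] that in auto)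
  then have "carrier (rep_alg u n) \<subseteq> {p \<in> carrier (rep_alg u n). \<phi> p = \<psi> p}"
    using one mult add eq \<alpha>_closed[of _ n u] \<alpha>_inv_closed[of n]
    by (intro rep_alg_generated) (auto simp: keys_mult_closed exps_add exps_0 keys_add_bit)
  then show "\<phi> a = \<psi> a" if "a \<in> carrier (rep_alg u n)" for a
    using that by auto
qed

section \<open>Evaluation of Laurent polynomials\<close>

context f2_algebra
begin

text \<open>Nonnegative exponents are allowed at every element, negative ones are meaningful at
  units; the images of the generators include elements of both kinds.\<close>

definition zpow :: "'a \<Rightarrow> int \<Rightarrow> 'a" where
  "zpow x z = (if z \<ge> 0 then x [^] nat z else inv x [^] nat (- z))"

lemma zpow_closed: "x \<in> carrier A \<Longrightarrow> z < 0 \<longrightarrow> x \<in> Units A \<Longrightarrow> zpow x z \<in> carrier A"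
  by (simp add: zpow_def del: pow_nat)

lemma zpow_Suc: "x \<in> Units A \<Longrightarrow> zpow x (z + 1) = zpow x z \<otimes> x"
proof -
  assume x: "x \<in> Units A"
  then have c: "x \<in> carrier A" "inv x \<in> carrier A" by auto
  \<comment> \<open>At \<open>z = -1\<close> the successor passes from powers of the inverse to
    powers of \<open>x\<close>, hence a case of its own.\<close>
  consider "z \<ge> 0" | "z = -1" | k where "z = - int (Suc (Suc k))"
  proof -
    have "z = - int (Suc (Suc (nat (- z) - 2)))" if "z < 0" "z \<noteq> -1" using that by auto
    then show thesis using that by fastforce
  qed
  then show ?thesis
  proof cases
    case 1
    then show ?thesis using c by (simp add: zpow_def nat_add_distrib)
  next
    case 2
    then show ?thesis using c x by (simp add: zpow_def)
  next
    case 3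
    then have "zpow x (z + 1) = inv x [^] Suc k" "zpow x z = inv x [^] Suc (Suc k)"
      by (simp_all add: zpow_def nat_add_distrib del: nat_pow_Suc)
    then show ?thesis using c x by (simp add: m_assoc)
  qed
qed

lemma zpow_add:
  assumes x: "x \<in> carrier A" and u: "x \<in> Units A \<or> (z \<ge> 0 \<and> w \<ge> 0)"
  shows "zpow x (z + w) = zpow x z \<otimes> zpow x w"
proof (cases "x \<in> Units A")
  case False
  then show ?thesis
    using x u by (simp add: zpow_def nat_add_distrib nat_pow_mult del: pow_nat)
next
  case True
  note cl = zpow_closed[OF x]
  show ?thesis
  proof (induction w rule: int_induct[where k = 0])
    case base
    then show ?case using True cl by (simp add: zpow_def)
  next
    case (step1 w)
    then show ?case
      using True x cl zpow_Suc[OF True, of "z + w"] zpow_Suc[OF True, of w] by (simp add: add.assoc m_assoc)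
  next
    case (step2 w)
    \<comment> \<open>For the downward step both sides are multiplied by the unit \<open>x\<close>,
      which is cancelled afterwards.\<close>
    have "zpow x (z + (w - 1)) \<otimes> x = (zpow x z \<otimes> zpow x (w - 1)) \<otimes> x"
      using True x cl zpow_Suc[OF True, of "z + (w - 1)"] zpow_Suc[OF True, of "w - 1"] step2
      by (simp add: m_assoc)
    then show ?case
      using True x cl by (metis Units_inv_closed Units_r_inv m_assoc m_closed r_one)
  qed
qed

text \<open>Evaluation of monomials is a homomorphism \<open>h\<close> from the exponent monoid to
  the multiplicative monoid of \<open>A\<close>; its linear extension is the morphism. Only the last
  variable can have negative exponents, so only \<open>a n\<close> has to be invertible.\<close>

lemma rep_alg_hom_exists:
  assumes a: "\<And>i. i \<in> {1..n} \<Longrightarrow> a i \<in> carrier A" and un: "u \<Longrightarrow> n > 0 \<Longrightarrow> a n \<in> Units A"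
  shows "\<exists>\<phi> \<in> alg_hom (rep_alg u n) A. \<forall>i\<in>{1..n}. \<phi> (\<alpha> i) = a i"
proof -
  define h where "h m = (\<Otimes>i\<in>{1..n}. zpow (a i) (Poly_Mapping.lookup m i))" for m
  have zpow: "zpow (a i) (Poly_Mapping.lookup m i) \<in> carrier A" if "m \<in> exps u n" "i \<in> {1..n}" for m i
    using that a un by (intro zpow_closed) (auto simp: exps_def)
  have hS: "h \<in> exps u n \<rightarrow> carrier A"
    unfolding h_def by (auto intro!: finprod_closed zpow)
  have h0: "h 0 = \<one>"
    unfolding h_def by (rule finprod_one_eqI) (simp add: zpow_def)
  have hm: "h (m + m') = h m \<otimes> h m'" if m: "m \<in> exps u n" "m' \<in> exps u n" for m m'
  proof -
    have "h (m + m') = (\<Otimes>i\<in>{1..n}. zpow (a i) (Poly_Mapping.lookup m i) \<otimes> zpow (a i) (Poly_Mapping.lookup m' i))"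
      unfolding h_def
    proof (rule finprod_cong')
      fix i assume i: "i \<in> {1..n}"
      \<comment> \<open>This is the alternative under which exponents add: the base is a unit or
        neither exponent is negative.\<close>
      have "a i \<in> Units A \<or> Poly_Mapping.lookup m i \<ge> 0 \<and> Poly_Mapping.lookup m' i \<ge> 0"
      proof (cases "u \<and> i = n")
        case False
        then show ?thesis using m by (auto simp: exps_def not_less[symmetric])
      qed (use un i in auto)
      then show "zpow (a i) (Poly_Mapping.lookup (m + m') i) =
          zpow (a i) (Poly_Mapping.lookup m i) \<otimes> zpow (a i) (Poly_Mapping.lookup m' i)"
        using zpow_add[OF a[OF i]] by (simp add: lookup_add)
    qed (use m in \<open>auto intro!: zpow m_closed\<close>)
    also have "\<dots> = h m \<otimes> h m'"
      unfolding h_def by (rule finprod_multf) (use m in \<open>auto intro!: zpow\<close>)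
    finally show ?thesis .
  qed
  have lin: "lin h \<in> ring_hom (rep_alg u n) A"
  proof (rule ring_hom_memI)
    show "lin h p \<in> carrier A" if "p \<in> carrier (rep_alg u n)" for p
      using lin_closed[OF hS] that by simp
    show "lin h \<one>\<^bsub>rep_alg u n\<^esub> = \<one>"
      using lin_single[of h 0] h0 by (simp add: single_one[symmetric] del: single_one)
    fix p q assume pq: "p \<in> carrier (rep_alg u n)" "q \<in> carrier (rep_alg u n)"
    show "lin h (p \<oplus>\<^bsub>rep_alg u n\<^esub> q) = lin h p \<oplus> lin h q"
      using lin_add[OF hS] pq by simp
    have "lin h (p * q) = lin h p \<otimes> lin h q"
      by (rule lin_mult[OF hS, where op = "(+)"])
        (use pq hm exps_add in \<open>auto simp: distrib_left distrib_right laurent_monomial_add\<close>)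
    then show "lin h (p \<otimes>\<^bsub>rep_alg u n\<^esub> q) = lin h p \<otimes> lin h q" by simp
  qed
  define \<phi> where "\<phi> = restrict (lin h) (carrier (rep_alg u n))"
  have "\<phi> \<in> ring_hom (rep_alg u n) A"
  proof (rule ring_hom_memI)
    show "\<phi> (p \<otimes>\<^bsub>rep_alg u n\<^esub> q) = \<phi> p \<otimes> \<phi> q" "\<phi> (p \<oplus>\<^bsub>rep_alg u n\<^esub> q) = \<phi> p \<oplus> \<phi> q"
      if "p \<in> carrier (rep_alg u n)" "q \<in> carrier (rep_alg u n)" for p q
      using that rep_alg.m_closed[OF that] rep_alg.a_closed[OF that]
        ring_hom_mult[OF lin that] ring_hom_add[OF lin that]
      by (simp_all add: \<phi>_def)
  qed (use ring_hom_closed[OF lin] ring_hom_one[OF lin] rep_alg.one_closed[of u n] in \<open>simp_all add: \<phi>_def\<close>)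
  then have "\<phi> \<in> alg_hom (rep_alg u n) A"
    by (simp add: alg_hom_iff[OF F2_algebra_rep_alg F2_algebra]) (simp add: \<phi>_def)
  moreover have "\<phi> (\<alpha> i) = a i" if i: "i \<in> {1..n}" for i
  proof -
    have "\<phi> (\<alpha> i) = h (Poly_Mapping.single i 1)"
      using \<alpha>_closed[of i n u] i lin_single[of h "Poly_Mapping.single i 1"] hS exps_single[OF i, of 1 u]
      by (auto simp: \<phi>_def \<alpha>_def)
    also have "\<dots> = (\<Otimes>j\<in>{1..n}. if j = i then a j else \<one>)"
      unfolding h_def using a
      by (intro finprod_cong') (auto simp: lookup_single zpow_def when_def)
    also have "\<dots> = a i"
      by (rule finprod_singleton_swap) (use i a in auto)
    finally show ?thesis .
  qed
  ultimately show ?thesis by blast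
qed

end

section \<open>Polynomials classified by morphisms\<close>

lemma univ_poly_add_polys: "univ_poly (rep_alg u) n \<in> add_polys u (rep_alg u n) n"
proof -
  have "\<alpha> n \<in> Units (rep_alg u n)" if u
    unfolding Units_def
    using \<alpha>_closed[of n n u] \<alpha>_inv_closed[of n] \<alpha>_mult_inv[of n] that
    by (auto simp: mult.commute intro!: bexI[of _ "\<alpha>_inv n"])
  then show ?thesis
    unfolding univ_poly_def rep_alg.add_polys_eq using \<alpha>_closed[of _ n u]
    by (intro CollectI exI[of _ \<alpha>]) (simp add: \<alpha>_def)
qed

lemma add_polys_carrier: "p \<in> add_polys u A n \<Longrightarrow> p \<in> carrier (UP A)"
  by (simp add: add_polys_def)

lemmas univ_poly_closed = univ_poly_add_polys[THEN add_polys_carrier]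

lemma coeff_univ_poly:
  "i \<le> n \<Longrightarrow> coeff (UP (rep_alg u n)) (univ_poly (rep_alg u) n) (2 ^ i) = \<alpha> i"
  "k \<notin> (^) 2 ` {0..n} \<Longrightarrow> coeff (UP (rep_alg u n)) (univ_poly (rep_alg u) n) k = 0"
  unfolding univ_poly_def
  using rep_alg.coeff_additive_poly[of n \<alpha> u n, OF \<alpha>_closed] by simp_all

lemma
  assumes A: "F2_algebra A" and \<phi>: "\<phi> \<in> alg_hom (rep_alg u n) A"
  shows classified_add_polys: "classified (rep_alg u) A n \<phi> \<in> add_polys u A n"
    and coeff_classified: "i \<le> n \<Longrightarrow> coeff (UP A) (classified (rep_alg u) A n \<phi>) (2 ^ i) = \<phi> (\<alpha> i)"
  unfolding classified_def
  by (rule up_map_add_polys[OF F2_algebra_rep_alg A \<phi> univ_poly_add_polys])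
    (simp add: coeff_up_map[OF F2_algebra_rep_alg A \<phi> univ_poly_closed] coeff_univ_poly)

text \<open>The coefficients at the exponents \<open>2 ^ i\<close> are the images of the generators.
  All identities between coproducts and counits on tensor products are proved through this
  injectivity.\<close>

lemma classified_inj:
  assumes A: "F2_algebra A" and h: "\<phi> \<in> alg_hom (rep_alg u n) A" "\<psi> \<in> alg_hom (rep_alg u n) A"
    and eq: "classified (rep_alg u) A n \<phi> = classified (rep_alg u) A n \<psi>"
  shows "\<phi> = \<psi>"
  by (rule rep_alg_hom_eqI[OF A h])
    (metis atLeastAtMost_iff coeff_classified[OF A h(1)] coeff_classified[OF A h(2)] eq)

lemma classified_bij:
  assumes A: "F2_algebra A"
  shows "bij_betw (classified (rep_alg u) A n) (alg_hom (rep_alg u n) A) (add_polys u A n)"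
proof (rule bij_betw_imageI)
  interpret A: f2_algebra A by (rule f2_algebraI[OF A])
  show "inj_on (classified (rep_alg u) A n) (alg_hom (rep_alg u n) A)"
    using classified_inj[OF A] by (auto intro: inj_onI)
  show "classified (rep_alg u) A n ` alg_hom (rep_alg u n) A = add_polys u A n"
  proof (intro equalityI subsetI)
    fix p assume p: "p \<in> add_polys u A n"
    obtain \<phi> where \<phi>: "\<phi> \<in> alg_hom (rep_alg u n) A" "\<And>i. i \<in> {1..n} \<Longrightarrow> \<phi> (\<alpha> i) = coeff (UP A) p (2 ^ i)"
      using A.rep_alg_hom_exists[of n "\<lambda>i. coeff (UP A) p (2 ^ i)" u] p by (auto simp: add_polys_def)
    note c = classified_add_polys[OF A \<phi>(1)]
    \<comment> \<open>The coefficient at exponent 1 was not prescribed to \<phi>; it agrees because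
      both polynomials are normalised.\<close>
    have 0: "\<phi> (\<alpha> 0) = \<one>\<^bsub>A\<^esub>"
      using ring_hom_one[OF alg_hom_ring_hom[OF \<phi>(1)]] by (simp add: \<alpha>_def)
    have "classified (rep_alg u) A n \<phi> = p"
    proof (rule up_eqI[OF A])
      fix k
      show "coeff (UP A) (classified (rep_alg u) A n \<phi>) k = coeff (UP A) p k"
      proof (cases "k \<in> (^) 2 ` {0..n}")
        case True
        then obtain i where i: "k = 2 ^ i" "i \<le> n" by auto
        show ?thesis
          unfolding i(1) coeff_classified[OF A \<phi>(1) i(2)]
          using 0 p \<phi>(2)[of i] i by (cases "i = 0") (auto simp: add_polys_def)
      next
        case False
        then show ?thesis using c p by (simp add: add_polys_def)
      qed
    qed (use c p in \<open>auto simp: add_polys_def\<close>)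
    then show "p \<in> classified (rep_alg u) A n ` alg_hom (rep_alg u n) A"
      using \<phi>(1) by blast
  qed (auto intro: classified_add_polys[OF A])
qed

lemma classified_compose:
  assumes "F2_algebra A" "\<phi> \<in> alg_hom (rep_alg u n) A"
  shows "classified (rep_alg u) A' n (compose (carrier (rep_alg u n)) f \<phi>) =
    up_map A f (classified (rep_alg u) A n \<phi>)"
  unfolding classified_def
  by (rule up_map_comp[OF F2_algebra_rep_alg assms univ_poly_closed])

section \<open>The bialgebra structure\<close>

text \<open>Settles every statement about units: a morphism out of the degree 0 component classifies
  the variable, whatever the morphism is.\<close>

lemma add_polys_0:
  assumes A: "F2_algebra A" and p: "p \<in> add_polys u A 0"
  shows "p = up_X A"
proof -
  interpret A: f2_algebra A by (rule f2_algebraI[OF A])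
  show ?thesis
  proof (rule up_eqI[OF A])
    show "coeff (UP A) p k = coeff (UP A) (up_X A) k" for k
      using p by (cases "k = 1") (auto simp: add_polys_def up_X_def)
  qed (use p A.up_X_closed in \<open>auto simp: add_polys_def\<close>)
qed

text \<open>Makes the definite descriptions in \<open>comult\<close> and \<open>counit\<close>
  proper.\<close>

lemma classified_ex1:
  assumes A: "F2_algebra A" and p: "p \<in> add_polys u A n"
  shows "\<exists>!\<phi>. \<phi> \<in> alg_hom (rep_alg u n) A \<and> classified (rep_alg u) A n \<phi> = p"
proof -
  have "p \<in> classified (rep_alg u) A n ` alg_hom (rep_alg u n) A"
    unfolding bij_betw_imp_surj_on[OF classified_bij[OF A]] by (rule p)
  then obtain \<phi> where \<phi>: "p = classified (rep_alg u) A n \<phi>" "\<phi> \<in> alg_hom (rep_alg u n) A"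
    by (rule imageE)
  show ?thesis
  proof (rule ex1I)
    show "\<phi> \<in> alg_hom (rep_alg u n) A \<and> classified (rep_alg u) A n \<phi> = p"
      using \<phi> by simp
    show "\<psi> = \<phi>" if "\<psi> \<in> alg_hom (rep_alg u n) A \<and> classified (rep_alg u) A n \<psi> = p" for \<psi>
      by (rule classified_inj[OF A _ \<phi>(2)]) (use that \<phi>(1) in simp_all)
  qed
qed

lemmas rep_tensorI = f2_tensorI[OF F2_algebra_rep_alg F2_algebra_rep_alg]

lemma
  defines "T \<equiv> \<lambda>u i j. tensor (rep_alg u i) (rep_alg u j)"
  shows comult_hom: "comult (rep_alg u) i j \<in> alg_hom (rep_alg u (i + j)) (T u i j)"
    and classified_comult: "classified (rep_alg u) (T u i j) (i + j) (comult (rep_alg u) i j) =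
      up_compose (T u i j) (classified (rep_alg u) (T u i j) j (tensor_inr (rep_alg u i) (rep_alg u j)))
        (classified (rep_alg u) (T u i j) i (tensor_inl (rep_alg u i) (rep_alg u j)))"
proof -
  interpret T: f2_tensor "rep_alg u i" "rep_alg u j" by (rule rep_tensorI)
  define q where "q = up_compose (T u i j)
    (classified (rep_alg u) (T u i j) j (tensor_inr (rep_alg u i) (rep_alg u j)))
    (classified (rep_alg u) (T u i j) i (tensor_inl (rep_alg u i) (rep_alg u j)))"
  have "q \<in> add_polys u (T u i j) (i + j)"
    unfolding q_def T_def
    by (intro T.T.up_compose_add_polys classified_add_polys[OF T.F2_algebra_tensor]
        T.tensor_inl_hom T.tensor_inr_hom)
  from theI'[OF classified_ex1[OF T.F2_algebra_tensor this[unfolded T_def]]]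
  show "comult (rep_alg u) i j \<in> alg_hom (rep_alg u (i + j)) (T u i j)"
    "classified (rep_alg u) (T u i j) (i + j) (comult (rep_alg u) i j) =
      up_compose (T u i j) (classified (rep_alg u) (T u i j) j (tensor_inr (rep_alg u i) (rep_alg u j)))
        (classified (rep_alg u) (T u i j) i (tensor_inl (rep_alg u i) (rep_alg u j)))"
    unfolding comult_def T_def q_def[symmetric, unfolded T_def] by simp_all
qed

lemma counit_hom: "counit (rep_alg u) \<in> alg_hom (rep_alg u 0) F2"
proof -
  interpret F2: f2_algebra F2 by (rule f2_algebraI[OF F2_algebra_F2])
  from theI'[OF classified_ex1[OF F2_algebra_F2 F2.up_X_add_polys[of u]]] show ?thesis
    unfolding counit_def by simp
qed

text \<open>
  By this lemma, identities between iterated coproducts become identities between composites of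
  polynomials.
\<close>

lemma classified_compose_comult:
  assumes A: "F2_algebra A" and h: "h \<in> alg_hom (tensor (rep_alg u i) (rep_alg u j)) A"
  shows "classified (rep_alg u) A (i + j) (compose (carrier (rep_alg u (i + j))) h (comult (rep_alg u) i j)) =
    up_compose A
      (classified (rep_alg u) A j (compose (carrier (rep_alg u j)) h (tensor_inr (rep_alg u i) (rep_alg u j))))
      (classified (rep_alg u) A i (compose (carrier (rep_alg u i)) h (tensor_inl (rep_alg u i) (rep_alg u j))))"
proof -
  interpret T: f2_tensor "rep_alg u i" "rep_alg u j" by (rule rep_tensorI)
  note cp = classified_add_polys[OF T.F2_algebra_tensor, THEN add_polys_carrier]
  show ?thesis
    by (simp only: classified_compose[OF T.F2_algebra_tensor] comult_hom classified_comult
        up_map_compose[OF T.F2_algebra_tensor A h] cp T.tensor_inl_hom T.tensor_inr_hom)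
qed

lemma alg_hom_funcset: "f \<in> alg_hom A A' \<Longrightarrow> f \<in> carrier A \<rightarrow> carrier A'"
  by (auto intro: alg_hom_closed)

lemma compose_alg_id_right: "f \<in> alg_hom A A' \<Longrightarrow> compose (carrier A) f (alg_id A) = f"
  by (auto simp: alg_hom_def alg_id_def compose_def extensional_def fun_eq_iff)

text \<open>Let \<open>p1\<close>, \<open>p2\<close>, \<open>p3\<close> be the universal polynomials
  of the three factors, transported to the triple tensor product, \<open>p1\<close> being innermost.
  The left side classifies \<open>p3\<close> after (\<open>p2\<close> after \<open>p1\<close>), the
  right side (\<open>p3\<close> after \<open>p2\<close>) after \<open>p1\<close>.\<close>

lemma comult_coassoc:
  assumes b: "b \<in> carrier (rep_alg u (i + j + k))"
  shows "tensor_assoc (rep_alg u i) (rep_alg u j) (rep_alg u k)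
      (tensor_map (rep_alg u (i + j)) (rep_alg u k) (tensor (rep_alg u i) (rep_alg u j)) (rep_alg u k)
        (comult (rep_alg u) i j) (alg_id (rep_alg u k)) (comult (rep_alg u) (i + j) k b)) =
    tensor_map (rep_alg u i) (rep_alg u (j + k)) (rep_alg u i) (tensor (rep_alg u j) (rep_alg u k))
      (alg_id (rep_alg u i)) (comult (rep_alg u) j k) (comult (rep_alg u) i (j + k) b)"
proof -
  let ?C = "rep_alg u" let ?\<Delta> = "comult (rep_alg u)"
  note C = F2_algebra_rep_alg and id = alg_hom_alg_id[OF F2_algebra_rep_alg]
  interpret ij: f2_tensor "?C i" "?C j" by (rule rep_tensorI)
  interpret jk: f2_tensor "?C j" "?C k" by (rule rep_tensorI)
  interpret ij_k: f2_tensor "?C (i + j)" "?C k" by (rule rep_tensorI)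
  interpret L: f2_tensor "tensor (?C i) (?C j)" "?C k" by (rule f2_tensorI[OF ij.F2_algebra_tensor C])
  interpret R: f2_tensor "?C i" "tensor (?C j) (?C k)" by (rule f2_tensorI[OF C jk.F2_algebra_tensor])
  define T where "T = tensor (?C i) (tensor (?C j) (?C k))"
  have T: "F2_algebra T" unfolding T_def by (rule R.F2_algebra_tensor)
  interpret T: f2_algebra T by (rule f2_algebraI[OF T])
  define as where "as = tensor_assoc (?C i) (?C j) (?C k)"
  note as = tensor_assoc_hom[of "?C i" "?C j" "?C k", OF C C C, folded as_def T_def]
  note as1 = tensor_assoc_1[of "?C i" "?C j" "?C k", OF C C C, folded as_def T_def]
    and as2 = tensor_assoc_2[of "?C i" "?C j" "?C k", OF C C C, folded as_def T_def]
    and as3 = tensor_assoc_3[of "?C i" "?C j" "?C k", OF C C C, folded as_def T_def]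
  define l where "l = tensor_map (?C (i + j)) (?C k) (tensor (?C i) (?C j)) (?C k) (?\<Delta> i j) (alg_id (?C k))"
  note la = C C ij.F2_algebra_tensor C comult_hom id
  note l = tensor_map_hom[of "?C (i + j)" "?C k" "tensor (?C i) (?C j)" "?C k" "?\<Delta> i j" "alg_id (?C k)", OF la, folded l_def] and l_inl = tensor_map_inl[of "?C (i + j)" "?C k" "tensor (?C i) (?C j)" "?C k" "?\<Delta> i j" "alg_id (?C k)", OF la, folded l_def]
    and l_inr = tensor_map_inr[of "?C (i + j)" "?C k" "tensor (?C i) (?C j)" "?C k" "?\<Delta> i j" "alg_id (?C k)", OF la, folded l_def]
  define r where "r = tensor_map (?C i) (?C (j + k)) (?C i) (tensor (?C j) (?C k)) (alg_id (?C i)) (?\<Delta> j k)"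
  note ra = C C C jk.F2_algebra_tensor id comult_hom
  note r = tensor_map_hom[of "?C i" "?C (j + k)" "?C i" "tensor (?C j) (?C k)" "alg_id (?C i)" "?\<Delta> j k", OF ra, folded r_def T_def] and r_inl = tensor_map_inl[of "?C i" "?C (j + k)" "?C i" "tensor (?C j) (?C k)" "alg_id (?C i)" "?\<Delta> j k", OF ra, folded r_def]
    and r_inr = tensor_map_inr[of "?C i" "?C (j + k)" "?C i" "tensor (?C j) (?C k)" "alg_id (?C i)" "?\<Delta> j k", OF ra, folded r_def]
  note inl = R.tensor_inl_hom[folded T_def] and inr = R.tensor_inr_hom[folded T_def]
  let ?inl = "tensor_inl (?C i) (tensor (?C j) (?C k))"
  let ?inr = "tensor_inr (?C i) (tensor (?C j) (?C k))"
  define p1 where "p1 = classified ?C T i ?inl"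
  define p2 where "p2 = classified ?C T j (compose (carrier (?C j)) ?inr (tensor_inl (?C j) (?C k)))"
  define p3 where "p3 = classified ?C T k (compose (carrier (?C k)) ?inr (tensor_inr (?C j) (?C k)))"
  have car: "p1 \<in> carrier (UP T)" "p2 \<in> carrier (UP T)" "p3 \<in> carrier (UP T)"
    unfolding p1_def p2_def p3_def
    by (intro classified_add_polys[OF T, THEN add_polys_carrier] inl
        alg_hom_compose[OF jk.tensor_inl_hom inr C] alg_hom_compose[OF jk.tensor_inr_hom inr C])+
  define asl where "asl = compose (carrier (tensor (?C (i + j)) (?C k))) as l"
  have asl: "asl \<in> alg_hom (tensor (?C (i + j)) (?C k)) T"
    unfolding asl_def by (rule alg_hom_compose[OF l as ij_k.F2_algebra_tensor])
  \<comment> \<open>The restriction of the associator to the first two factors. Being a morphism out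
    of a tensor product, it allows the inner coproduct to be treated in the same way as the outer
    one.\<close>
  define asi where "asi = compose (carrier (tensor (?C i) (?C j))) as (tensor_inl (tensor (?C i) (?C j)) (?C k))"
  have asi: "asi \<in> alg_hom (tensor (?C i) (?C j)) T"
    unfolding asi_def by (rule alg_hom_compose[OF L.tensor_inl_hom as ij.F2_algebra_tensor])
  have "classified ?C T (i + j + k) (compose (carrier (?C (i + j + k))) asl (?\<Delta> (i + j) k)) =
      up_compose T p3 (up_compose T p2 p1)"
  proof -
    have "compose (carrier (?C k)) asl (tensor_inr (?C (i + j)) (?C k)) =
        compose (carrier (?C k)) as (compose (carrier (?C k)) l (tensor_inr (?C (i + j)) (?C k)))"
      unfolding asl_def by (rule compose_assoc[symmetric, OF alg_hom_funcset[OF ij_k.tensor_inr_hom]])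
    also have "\<dots> = compose (carrier (?C k)) ?inr (tensor_inr (?C j) (?C k))"
      unfolding l_inr compose_alg_id_right[OF L.tensor_inr_hom]
      by (rule ext) (simp add: compose_def as3)
    finally have 3: "classified ?C T k (compose (carrier (?C k)) asl (tensor_inr (?C (i + j)) (?C k))) = p3"
      by (simp only: p3_def)
    have "compose (carrier (?C (i + j))) asl (tensor_inl (?C (i + j)) (?C k)) =
        compose (carrier (?C (i + j))) as (compose (carrier (?C (i + j))) l (tensor_inl (?C (i + j)) (?C k)))"
      unfolding asl_def by (rule compose_assoc[symmetric, OF alg_hom_funcset[OF ij_k.tensor_inl_hom]])
    also have "\<dots> = compose (carrier (?C (i + j))) asi (?\<Delta> i j)"
      unfolding l_inl asi_def by (rule compose_assoc[OF alg_hom_funcset[OF comult_hom]])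
    \<comment> \<open>On the first factor the composite is again of the form morphism after
      coproduct, now with \<open>asi\<close> and \<open>?\<Delta> i j\<close>.\<close>
    finally have 12: "compose (carrier (?C (i + j))) asl (tensor_inl (?C (i + j)) (?C k)) =
        compose (carrier (?C (i + j))) asi (?\<Delta> i j)" .
    have 1: "compose (carrier (?C i)) asi (tensor_inl (?C i) (?C j)) = ?inl"
    proof (rule alg_hom_eqI[OF alg_hom_compose[OF ij.tensor_inl_hom asi C] inl])
      fix a assume "a \<in> carrier (?C i)"
      then show "compose (carrier (?C i)) asi (tensor_inl (?C i) (?C j)) a = ?inl a"
        using as1 alg_hom_closed[OF ij.tensor_inl_hom] by (simp add: compose_def asi_def del: rep_alg_simps)
    qed
    have 2: "compose (carrier (?C j)) asi (tensor_inr (?C i) (?C j)) =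
        compose (carrier (?C j)) ?inr (tensor_inl (?C j) (?C k))"
      using as2 alg_hom_closed[OF ij.tensor_inr_hom]
      by (intro ext) (simp add: compose_def asi_def del: rep_alg_simps)
    show ?thesis
      unfolding classified_compose_comult[OF T asl] 12 classified_compose_comult[OF T asi] 1 2 3
      by (simp only: p1_def p2_def)
  qed
  moreover have "classified ?C T (i + (j + k)) (compose (carrier (?C (i + (j + k)))) r (?\<Delta> i (j + k))) =
      up_compose T (up_compose T p3 p2) p1"
    unfolding classified_compose_comult[OF T r] r_inl r_inr compose_alg_id_right[OF R.tensor_inl_hom]
      classified_compose_comult[OF T inr]
    by (simp only: p1_def p2_def p3_def)
  ultimately have "classified ?C T (i + j + k) (compose (carrier (?C (i + j + k))) asl (?\<Delta> (i + j) k)) =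
      classified ?C T (i + j + k) (compose (carrier (?C (i + j + k))) r (?\<Delta> i (j + k)))"
    using T.up_compose_assoc[OF car(3,2,1)] by (simp only: add.assoc)
  then have "compose (carrier (?C (i + j + k))) asl (?\<Delta> (i + j) k) =
      compose (carrier (?C (i + j + k))) r (?\<Delta> i (j + k))"
    using alg_hom_compose[OF comult_hom[of u "i + j" k] asl C]
      alg_hom_compose[OF comult_hom[of u i "j + k"] r C]
    by (intro classified_inj[OF T]) (simp_all only: add.assoc)
  from fun_cong[OF this, of b] show ?thesis
    using b alg_hom_closed[OF comult_hom b] by (simp add: compose_eq asl_def as_def l_def r_def del: rep_alg_simps)
qed

text \<open>The inner polynomial, coming from degree 0, is the variable, and substituting it changes
  nothing. What remains is classified by the embedding of the second factor.\<close>

lemma comult_counit_left: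
  assumes b: "b \<in> carrier (rep_alg u n)"
  shows "tensor_map (rep_alg u 0) (rep_alg u n) F2 (rep_alg u n) (counit (rep_alg u)) (alg_id (rep_alg u n))
    (comult (rep_alg u) 0 n b) = pure F2 (rep_alg u n) 1 b"
proof -
  let ?C = "rep_alg u"
  note C = F2_algebra_rep_alg and id = alg_hom_alg_id[OF F2_algebra_rep_alg]
  interpret S: f2_tensor "?C 0" "?C n" by (rule rep_tensorI)
  interpret T: f2_tensor F2 "?C n" by (rule f2_tensorI[OF F2_algebra_F2 C])
  note T = T.F2_algebra_tensor
  define h where "h = tensor_map (?C 0) (?C n) F2 (?C n) (counit ?C) (alg_id (?C n))"
  note ha = C C F2_algebra_F2 C counit_hom id
  note h = tensor_map_hom[of "?C 0" "?C n" F2 "?C n" "counit ?C" "alg_id (?C n)", OF ha, folded h_def] and h_inr = tensor_map_inr[of "?C 0" "?C n" F2 "?C n" "counit ?C" "alg_id (?C n)", OF ha, folded h_def]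
  note c = classified_add_polys[OF T alg_hom_compose[OF S.tensor_inl_hom h C]]
  have "classified ?C (tensor F2 (?C n)) (0 + n) (compose (carrier (?C (0 + n))) h (comult ?C 0 n)) =
      classified ?C (tensor F2 (?C n)) n (tensor_inr F2 (?C n))"
    unfolding classified_compose_comult[OF T h] h_inr compose_alg_id_right[OF T.tensor_inr_hom]
      add_polys_0[OF T c]
    by (rule T.T.compose_X_right) (rule classified_add_polys[OF T T.tensor_inr_hom, THEN add_polys_carrier])
  then have "compose (carrier (?C n)) h (comult ?C 0 n) = tensor_inr F2 (?C n)"
    using alg_hom_compose[OF comult_hom[of u 0 n] h C] T.tensor_inr_hom
    by (intro classified_inj[OF T]) (simp_all only: add_0)
  from fun_cong[OF this, of b] show ?thesis
    using b by (simp add: compose_eq h_def tensor_inr_def F2_def del: rep_alg_simps)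
qed

text \<open>Here the variable is the outer polynomial and the first factor remains.\<close>

lemma comult_counit_right:
  assumes b: "b \<in> carrier (rep_alg u n)"
  shows "tensor_map (rep_alg u n) (rep_alg u 0) (rep_alg u n) F2 (alg_id (rep_alg u n)) (counit (rep_alg u))
    (comult (rep_alg u) n 0 b) = pure (rep_alg u n) F2 b 1"
proof -
  let ?C = "rep_alg u"
  note C = F2_algebra_rep_alg and id = alg_hom_alg_id[OF F2_algebra_rep_alg]
  interpret S: f2_tensor "?C n" "?C 0" by (rule rep_tensorI)
  interpret T: f2_tensor "?C n" F2 by (rule f2_tensorI[OF C F2_algebra_F2])
  note T = T.F2_algebra_tensor
  define h where "h = tensor_map (?C n) (?C 0) (?C n) F2 (alg_id (?C n)) (counit ?C)"
  note ha = C C C F2_algebra_F2 id counit_hom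
  note h = tensor_map_hom[of "?C n" "?C 0" "?C n" F2 "alg_id (?C n)" "counit ?C", OF ha, folded h_def] and h_inl = tensor_map_inl[of "?C n" "?C 0" "?C n" F2 "alg_id (?C n)" "counit ?C", OF ha, folded h_def]
  note c = classified_add_polys[OF T alg_hom_compose[OF S.tensor_inr_hom h C]]
  have "classified ?C (tensor (?C n) F2) (n + 0) (compose (carrier (?C (n + 0))) h (comult ?C n 0)) =
      classified ?C (tensor (?C n) F2) n (tensor_inl (?C n) F2)"
    unfolding classified_compose_comult[OF T h] h_inl compose_alg_id_right[OF T.tensor_inl_hom]
      add_polys_0[OF T c]
    by (rule T.T.compose_X) (rule classified_add_polys[OF T T.tensor_inl_hom, THEN add_polys_carrier])
  then have "compose (carrier (?C n)) h (comult ?C n 0) = tensor_inl (?C n) F2"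
    using alg_hom_compose[OF comult_hom[of u n 0] h C] T.tensor_inl_hom
    by (intro classified_inj[OF T]) (simp_all only: add_0_right)
  from fun_cong[OF this, of b] show ?thesis
    using b by (simp add: compose_eq h_def tensor_inl_def F2_def del: rep_alg_simps)
qed

lemma graded_bialgebra_rep_alg:
  "graded_bialgebra (rep_alg u) (comult (rep_alg u)) (counit (rep_alg u))"
  unfolding graded_bialgebra_def
  by (intro conjI allI ballI F2_algebra_rep_alg comult_hom counit_hom comult_coassoc
      comult_counit_left comult_counit_right)

text \<open>Counit and unit map are mutually inverse: the degree 0 component has no generators on
  which two morphisms could differ, and a ring endomorphism of \<open>F2\<close> fixes 0 and
  1.\<close>

lemma connected_rep_alg: "connected_bialgebra (rep_alg u)"
proof -
  let ?\<epsilon> = "counit (rep_alg u)" let ?\<eta> = "alg_unit (rep_alg u 0)"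
  note \<epsilon> = counit_hom[of u] and \<eta> = rep_alg.alg_hom_alg_unit[of u 0]
  have "?\<eta> (?\<epsilon> b) = b" if b: "b \<in> carrier (rep_alg u 0)" for b
  proof -
    have "compose (carrier (rep_alg u 0)) ?\<eta> ?\<epsilon> = alg_id (rep_alg u 0)"
      by (rule rep_alg_hom_eqI[OF F2_algebra_rep_alg alg_hom_compose[OF \<epsilon> \<eta> F2_algebra_rep_alg]
            alg_hom_alg_id[OF F2_algebra_rep_alg]]) simp
    from fun_cong[OF this, of b] show ?thesis
      using b by (simp add: compose_eq del: rep_alg_simps)
  qed
  moreover have "?\<epsilon> (?\<eta> c) = c" for c
  proof -
    interpret F2: f2_algebra F2 by (rule f2_algebraI[OF F2_algebra_F2])
    note h = alg_hom_compose[OF \<eta> \<epsilon> F2_algebra_F2, THEN alg_hom_ring_hom]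
    show ?thesis
      using bit_cases[of c] ring_hom_one[OF h] ring_hom_zero[OF h F2.ring_axioms F2.ring_axioms]
      by (auto simp: F2_def compose_def)
  qed
  ultimately have "bij_betw ?\<epsilon> (carrier (rep_alg u 0)) (carrier F2)"
    using alg_hom_closed[OF \<epsilon>] alg_hom_closed[OF \<eta>]
    by (intro bij_betw_byWitness[where f' = ?\<eta>]) (auto simp del: rep_alg_simps)
  then show ?thesis
    unfolding connected_bialgebra_def alg_iso_def using \<epsilon> by blast
qed

section \<open>Comparison of the two bialgebras\<close>

lemma alg_id_rep_alg_hom: "alg_id (rep_alg False n) \<in> alg_hom (rep_alg False n) (rep_alg True n)"
proof -
  have "exps False n \<subseteq> exps True n" by (auto simp: exps_def)
  then have sub: "p \<in> carrier (rep_alg True n)" if "p \<in> carrier (rep_alg False n)" for p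
    using that by (simp add: subset_trans)
  have "alg_id (rep_alg False n) \<in> ring_hom (rep_alg False n) (rep_alg True n)"
  proof (rule ring_hom_memI)
    fix p q assume pq: "p \<in> carrier (rep_alg False n)" "q \<in> carrier (rep_alg False n)"
    show "alg_id (rep_alg False n) (p \<otimes>\<^bsub>rep_alg False n\<^esub> q) =
        alg_id (rep_alg False n) p \<otimes>\<^bsub>rep_alg True n\<^esub> alg_id (rep_alg False n) q"
      unfolding alg_id_apply[OF rep_alg.m_closed[OF pq]] alg_id_apply[OF pq(1)] alg_id_apply[OF pq(2)] by simp
    show "alg_id (rep_alg False n) (p \<oplus>\<^bsub>rep_alg False n\<^esub> q) =
        alg_id (rep_alg False n) p \<oplus>\<^bsub>rep_alg True n\<^esub> alg_id (rep_alg False n) q"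
      unfolding alg_id_apply[OF rep_alg.a_closed[OF pq]] alg_id_apply[OF pq(1)] alg_id_apply[OF pq(2)] by simp
  next
    show "alg_id (rep_alg False n) \<one>\<^bsub>rep_alg False n\<^esub> = \<one>\<^bsub>rep_alg True n\<^esub>"
      unfolding alg_id_apply[OF rep_alg.one_closed] by simp
    show "alg_id (rep_alg False n) p \<in> carrier (rep_alg True n)" if "p \<in> carrier (rep_alg False n)" for p
      unfolding alg_id_apply[OF that] by (rule sub[OF that])
  qed
  then show ?thesis
    unfolding alg_hom_iff[OF F2_algebra_rep_alg F2_algebra_rep_alg] by (simp add: alg_id_def)
qed

text \<open>The inclusion fixes every \<alpha> i, and coefficients at other exponents vanish on both
  sides. Beyond \<open>represents_inclusion\<close>, this yields the compatibility of the
  coproducts.\<close>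

lemma classified_restrict:
  assumes A: "F2_algebra A" and \<phi>: "\<phi> \<in> alg_hom (rep_alg True n) A"
  shows "classified (rep_alg False) A n (compose (carrier (rep_alg False n)) \<phi> (alg_id (rep_alg False n))) =
    classified (rep_alg True) A n \<phi>"
proof (rule up_eqI[OF A])
  note i = alg_hom_compose[OF alg_id_rep_alg_hom \<phi> F2_algebra_rep_alg]
  note c = classified_add_polys[OF A i] classified_add_polys[OF A \<phi>]
  show "classified (rep_alg False) A n (compose (carrier (rep_alg False n)) \<phi> (alg_id (rep_alg False n))) \<in> carrier (UP A)"
    "classified (rep_alg True) A n \<phi> \<in> carrier (UP A)"
    using c by (auto simp: add_polys_def)
  fix k
  show "coeff (UP A) (classified (rep_alg False) A n (compose (carrier (rep_alg False n)) \<phi> (alg_id (rep_alg False n)))) k =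
    coeff (UP A) (classified (rep_alg True) A n \<phi>) k"
  proof (cases "k \<in> (^) 2 ` {0..n}")
    case True
    then obtain j where j: "k = 2 ^ j" "j \<le> n" by auto
    show ?thesis
      unfolding j(1) coeff_classified[OF A i j(2)] coeff_classified[OF A \<phi> j(2)]
      using \<alpha>_closed[OF j(2), of False] by (simp add: compose_eq del: rep_alg_simps)
  next
    case False
    then show ?thesis using c by (simp add: add_polys_def)
  qed
qed

text \<open>As morphisms out of the smaller algebra, both sides classify the composite of the
  universal polynomials of the two larger factors.\<close>

lemma comult_restrict:
  assumes b: "b \<in> carrier (rep_alg False (i + j))"
  shows "tensor_map (rep_alg False i) (rep_alg False j) (rep_alg True i) (rep_alg True j)
      (alg_id (rep_alg False i)) (alg_id (rep_alg False j)) (comult (rep_alg False) i j b) =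
    comult (rep_alg True) i j b"
proof -
  note C = F2_algebra_rep_alg
  interpret S: f2_tensor "rep_alg False i" "rep_alg False j" by (rule rep_tensorI)
  interpret T: f2_tensor "rep_alg True i" "rep_alg True j" by (rule rep_tensorI)
  note T = T.F2_algebra_tensor
  define h where "h = tensor_map (rep_alg False i) (rep_alg False j) (rep_alg True i) (rep_alg True j)
    (alg_id (rep_alg False i)) (alg_id (rep_alg False j))"
  note ha = C C C C alg_id_rep_alg_hom alg_id_rep_alg_hom
  note h = tensor_map_hom[of "rep_alg False i" "rep_alg False j" "rep_alg True i" "rep_alg True j" "alg_id (rep_alg False i)" "alg_id (rep_alg False j)", OF ha, folded h_def] and h_inl = tensor_map_inl[of "rep_alg False i" "rep_alg False j" "rep_alg True i" "rep_alg True j" "alg_id (rep_alg False i)" "alg_id (rep_alg False j)", OF ha, folded h_def]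
    and h_inr = tensor_map_inr[of "rep_alg False i" "rep_alg False j" "rep_alg True i" "rep_alg True j" "alg_id (rep_alg False i)" "alg_id (rep_alg False j)", OF ha, folded h_def]
  have "compose (carrier (rep_alg False (i + j))) h (comult (rep_alg False) i j) =
      compose (carrier (rep_alg False (i + j))) (comult (rep_alg True) i j) (alg_id (rep_alg False (i + j)))"
  proof (rule classified_inj[OF T])
    show "classified (rep_alg False) (tensor (rep_alg True i) (rep_alg True j)) (i + j)
        (compose (carrier (rep_alg False (i + j))) h (comult (rep_alg False) i j)) =
      classified (rep_alg False) (tensor (rep_alg True i) (rep_alg True j)) (i + j)
        (compose (carrier (rep_alg False (i + j))) (comult (rep_alg True) i j) (alg_id (rep_alg False (i + j))))"
      unfolding classified_restrict[OF T comult_hom] classified_comult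
        classified_compose_comult[OF T h] h_inl h_inr
        classified_restrict[OF T T.tensor_inl_hom] classified_restrict[OF T T.tensor_inr_hom] ..
  qed (rule alg_hom_compose[OF comult_hom h C] alg_hom_compose[OF alg_id_rep_alg_hom comult_hom C])+
  from fun_cong[OF this, of b] show ?thesis
    using b by (simp add: compose_eq h_def del: rep_alg_simps)
qed

lemma sub_graded_bialgebra_rep_alg:
  "sub_graded_bialgebra (rep_alg False) (comult (rep_alg False)) (counit (rep_alg False))
    (rep_alg True) (comult (rep_alg True)) (counit (rep_alg True))"
proof -
  have "counit (rep_alg False) b = counit (rep_alg True) b" if b: "b \<in> carrier (rep_alg False 0)" for b
  proof -
    have "counit (rep_alg False) =
        compose (carrier (rep_alg False 0)) (counit (rep_alg True)) (alg_id (rep_alg False 0))"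
      by (rule rep_alg_hom_eqI[OF F2_algebra_F2 counit_hom
            alg_hom_compose[OF alg_id_rep_alg_hom counit_hom F2_algebra_rep_alg]]) simp
    from fun_cong[OF this, of b] show ?thesis
      using b by (simp add: compose_eq del: rep_alg_simps)
  qed
  then show ?thesis
    unfolding sub_graded_bialgebra_def
    by (intro conjI allI ballI graded_bialgebra_rep_alg alg_id_rep_alg_hom comult_restrict)
qed


section \<open>The functors and their representations\<close>

lemma graded_monoid_functor_add_polys:
  fixes F :: "('a, nat \<Rightarrow> 'a) gm_functor"
  assumes [simp]: "gm_map F = up_map" "gm_mult F = up_compose" "gm_unit F = up_X"
    and obj: "\<And>A n. F2_algebra A \<Longrightarrow> gm_obj F A n = add_polys u A n"
  shows "graded_monoid_functor F"
proof -
  have "graded_monoid (gm_obj F A) (gm_mult F A) (gm_unit F A)" if A: "F2_algebra A" for A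
  proof -
    interpret A: f2_algebra A by (rule f2_algebraI[OF A])
    show ?thesis
      unfolding graded_monoid_def assms(1-3) obj[OF A]
    proof (intro conjI allI ballI)
      fix i j k p q r
      assume p: "p \<in> add_polys u A i" and q: "q \<in> add_polys u A j"
      show "up_compose A p q \<in> add_polys u A (i + j)"
        \<comment> \<open>The left factor of the product is the outer polynomial, so the degrees
          come out in the order \<open>j + i\<close>.\<close>
        using A.up_compose_add_polys[OF p q] by (simp only: add.commute)
      assume r: "r \<in> add_polys u A k"
      show "up_compose A (up_compose A p q) r = up_compose A p (up_compose A q r)"
        using p q r by (intro A.up_compose_assoc add_polys_carrier)
    qed (use A.up_X_add_polys A.compose_X A.compose_X_right add_polys_carrier in blast)+
  qed
  then show ?thesis
    unfolding graded_monoid_functor_def assms(1-3)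
    by (intro conjI allI impI ballI)
      (simp_all add: obj up_map_add_polys up_map_X up_map_compose[OF _ _ _ add_polys_carrier add_polys_carrier]
        up_map_comp[OF _ _ _ add_polys_carrier] up_map_id[OF _ add_polys_carrier])
qed

lemma represents_add_polys:
  fixes F :: "('a, nat \<Rightarrow> 'a) gm_functor"
  assumes F [simp]: "gm_map F = up_map" "gm_mult F = up_compose" "gm_unit F = up_X"
    and obj: "\<And>A n. F2_algebra A \<Longrightarrow> gm_obj F A n = add_polys u A n"
  shows "represents (rep_alg u) (comult (rep_alg u)) (counit (rep_alg u)) (classified (rep_alg u)) F"
proof -
  have 3: "classified (rep_alg u) A 0 (compose (carrier (rep_alg u 0)) (alg_unit A) (counit (rep_alg u))) = up_X A"
    if A: "F2_algebra A" for A :: "(bit, 'a) module"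
    by (rule add_polys_0[OF A classified_add_polys[OF A alg_hom_compose[OF counit_hom _ F2_algebra_rep_alg]]])
      (rule f2_algebra.alg_hom_alg_unit[OF f2_algebraI[OF A]])
  have 4: "classified (rep_alg u) A (i + j) (compose (carrier (rep_alg u (i + j)))
        (tensor_pair (rep_alg u i) (rep_alg u j) A \<phi> \<psi>) (comult (rep_alg u) i j)) =
      up_compose A (classified (rep_alg u) A j \<psi>) (classified (rep_alg u) A i \<phi>)"
    if A: "F2_algebra A" and h: "\<phi> \<in> alg_hom (rep_alg u i) A" "\<psi> \<in> alg_hom (rep_alg u j) A"
    for A :: "(bit, 'a) module" and i j \<phi> \<psi>
  proof -
    interpret T: f2_tensor "rep_alg u i" "rep_alg u j" by (rule rep_tensorI)
    show ?thesis
      unfolding classified_compose_comult[OF A T.tensor_pair_hom[OF A h]]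
        T.tensor_pair_inl[OF A h] T.tensor_pair_inr[OF A h] ..
  qed
  show ?thesis
    unfolding represents_def F
    by (intro conjI allI impI ballI) (simp_all only: obj classified_bij classified_compose 3 4)
qed

section \<open>The grading\<close>

text \<open>The weight of \<alpha> i is dictated by homogeneity: together with \<open>2 ^ i\<close>
  from the power of the variable it has to add up to 1.\<close>

definition mdeg :: "nat \<Rightarrow> (nat \<Rightarrow>\<^sub>0 int) \<Rightarrow> int" where
  "mdeg n m = (\<Sum>i\<in>{1..n}. Poly_Mapping.lookup m i * (1 - 2 ^ i))"

definition hom_part :: "bool \<Rightarrow> nat \<Rightarrow> int \<Rightarrow> laurent set" where
  "hom_part u n d = {p \<in> carrier (rep_alg u n). \<forall>m\<in>Poly_Mapping.keys p. mdeg n m = d}"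

lemma mdeg_0 [simp]: "mdeg n 0 = 0"
  by (simp add: mdeg_def)

lemma mdeg_add: "mdeg n (m + m') = mdeg n m + mdeg n m'"
  by (simp add: mdeg_def lookup_add sum.distrib distrib_right)

lemma \<alpha>_hom_part: "i \<le> n \<Longrightarrow> \<alpha> i \<in> hom_part u n (1 - 2 ^ i)"
proof (cases "i = 0")
  case False
  assume i: "i \<le> n"
  have "mdeg n (Poly_Mapping.single i 1) = (\<Sum>j\<in>{1..n}. if j = i then 1 - 2 ^ i else 0)"
    unfolding mdeg_def by (rule sum.cong) (auto simp: lookup_single)
  also have "\<dots> = 1 - 2 ^ i"
    using i False by simp
  finally show ?thesis
    using False \<alpha>_closed[OF i, of u] by (simp add: hom_part_def \<alpha>_def)
qed (simp add: hom_part_def \<alpha>_def exps_0)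

lemma finsum_rep_alg:
  assumes "finite I" "\<And>i. i \<in> I \<Longrightarrow> f i \<in> carrier (rep_alg u n)"
  shows "finsum (rep_alg u n) f I = (\<Sum>i\<in>I. f i)"
  using assms
proof (induction I rule: finite_induct)
  case (insert i I)
  then have "finsum (rep_alg u n) f (insert i I) = f i \<oplus>\<^bsub>rep_alg u n\<^esub> finsum (rep_alg u n) f I"
    by (intro rep_alg.finsum_insert) (auto simp del: rep_alg_simps)
  then show ?case using insert by simp
qed (simp add: rep_alg.finsum_empty)

lemma hom_part_lookup: "p \<in> hom_part u n d \<Longrightarrow> mdeg n m \<noteq> d \<Longrightarrow> Poly_Mapping.lookup p m = 0"
  by (auto simp: hom_part_def in_keys_iff)

text \<open>Monomials are homogeneous, so components arise by splitting the support by degree. They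
  are unique since, in any decomposition, the coefficient of \<open>m\<close> is read off from the
  component of degree \<open>mdeg n m\<close>.\<close>

lemma graded_algebra_rep_alg: "graded_algebra (rep_alg u n) (hom_part u n)"
proof -
  have "submodule (hom_part u n d) F2 (rep_alg u n)" for d
  proof (rule submodule.intro)
    show "subgroup (hom_part u n d) (add_monoid (rep_alg u n))"
    proof (rule rep_alg.add.subgroupI)
      show "\<ominus>\<^bsub>rep_alg u n\<^esub> p \<in> hom_part u n d" if "p \<in> hom_part u n d" for p
        using that rep_alg.minus_eq_self[of p u n] by (simp add: hom_part_def)
      show "p \<oplus>\<^bsub>rep_alg u n\<^esub> q \<in> hom_part u n d" if "p \<in> hom_part u n d" "q \<in> hom_part u n d" for p q
        using that keys_add_bit[of p "{m \<in> exps u n. mdeg n m = d}" q] by (auto simp: hom_part_def)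
      show "hom_part u n d \<noteq> {}" by (auto simp: hom_part_def intro!: exI[of _ 0])
    qed (auto simp: hom_part_def)
    have "c \<odot>\<^bsub>rep_alg u n\<^esub> p \<in> hom_part u n d" if "p \<in> hom_part u n d" for c p
      using that rep_alg.smult_eq[of p u n c] by (auto simp: hom_part_def)
    then show "submodule_axioms (hom_part u n d) F2 (rep_alg u n)"
      by (rule submodule_axioms.intro)
  qed
  moreover have "\<exists>!c. (\<forall>d. c d \<in> hom_part u n d) \<and> finite {d. c d \<noteq> \<zero>\<^bsub>rep_alg u n\<^esub>} \<and>
      p = (\<Oplus>\<^bsub>rep_alg u n\<^esub>d\<in>{d. c d \<noteq> \<zero>\<^bsub>rep_alg u n\<^esub>}. c d)"
    if p: "p \<in> carrier (rep_alg u n)" for p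
  proof -
    have sum: "Poly_Mapping.lookup (\<Oplus>\<^bsub>rep_alg u n\<^esub>d\<in>{d. c d \<noteq> 0}. c d) m = Poly_Mapping.lookup (c (mdeg n m)) m"
      if c: "\<And>d. c d \<in> hom_part u n d" and fin: "finite {d. c d \<noteq> 0}" for c m
    proof -
      have "Poly_Mapping.lookup (\<Oplus>\<^bsub>rep_alg u n\<^esub>d\<in>{d. c d \<noteq> 0}. c d) m =
          (\<Sum>d\<in>{d. c d \<noteq> 0}. Poly_Mapping.lookup (c d) m)"
        using c by (subst finsum_rep_alg[OF fin]) (auto simp: hom_part_def lookup_sum)
      also have "\<dots> = (\<Sum>d\<in>{d. c d \<noteq> 0}. if d = mdeg n m then Poly_Mapping.lookup (c (mdeg n m)) m else 0)"
        by (rule sum.cong) (use hom_part_lookup[OF c] in auto)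
      also have "\<dots> = Poly_Mapping.lookup (c (mdeg n m)) m"
        using fin by (subst sum.delta) auto
      finally show ?thesis .
    qed
    define c :: "int \<Rightarrow> laurent" where "c d = Poly_Mapping.mapp (\<lambda>m x. if mdeg n m = d then x else 0) p" for d
    have lc: "Poly_Mapping.lookup (c d) m = (if mdeg n m = d then Poly_Mapping.lookup p m else 0)" for d m
      by (simp add: c_def lookup_mapp when_def in_keys_iff)
    have keys: "Poly_Mapping.keys (c d) \<subseteq> Poly_Mapping.keys p" for d
      unfolding c_def by (rule keys_mapp_subset)
    have "mdeg n m = d" if "m \<in> Poly_Mapping.keys (c d)" for d m
      using that by (simp add: in_keys_iff lc split: if_splits)
    then have ch: "c d \<in> hom_part u n d" for d
      using p keys[of d] by (simp add: hom_part_def subset_trans)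
    have "d \<in> mdeg n ` Poly_Mapping.keys p" if "c d \<noteq> 0" for d
    proof -
      from that obtain m where "Poly_Mapping.lookup (c d) m \<noteq> 0"
        by (metis lookup_zero poly_mapping_eqI)
      then show ?thesis by (auto simp: lc in_keys_iff split: if_splits)
    qed
    then have "{d. c d \<noteq> 0} \<subseteq> mdeg n ` Poly_Mapping.keys p" by blast
    then have fin: "finite {d. c d \<noteq> 0}" by (rule finite_subset) simp
    show ?thesis
    proof (rule ex1I[of _ c])
      have "p = (\<Oplus>\<^bsub>rep_alg u n\<^esub>d\<in>{d. c d \<noteq> 0}. c d)"
        by (rule poly_mapping_eqI) (simp add: sum[OF ch fin] lc)
      then show "(\<forall>d. c d \<in> hom_part u n d) \<and> finite {d. c d \<noteq> \<zero>\<^bsub>rep_alg u n\<^esub>} \<and>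
          p = (\<Oplus>\<^bsub>rep_alg u n\<^esub>d\<in>{d. c d \<noteq> \<zero>\<^bsub>rep_alg u n\<^esub>}. c d)"
        using ch fin by simp
    next
      fix c' assume "(\<forall>d. c' d \<in> hom_part u n d) \<and> finite {d. c' d \<noteq> \<zero>\<^bsub>rep_alg u n\<^esub>} \<and>
          p = (\<Oplus>\<^bsub>rep_alg u n\<^esub>d\<in>{d. c' d \<noteq> \<zero>\<^bsub>rep_alg u n\<^esub>}. c' d)"
      then have c': "\<And>d. c' d \<in> hom_part u n d" "finite {d. c' d \<noteq> 0}"
        and p: "p = (\<Oplus>\<^bsub>rep_alg u n\<^esub>d\<in>{d. c' d \<noteq> 0}. c' d)" by auto
      show "c' = c"
      proof (rule ext, rule poly_mapping_eqI)
        fix d m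
        have "Poly_Mapping.lookup p m = Poly_Mapping.lookup (c' (mdeg n m)) m"
          by (subst p) (rule sum[OF c'])
        then show "Poly_Mapping.lookup (c' d) m = Poly_Mapping.lookup (c d) m"
          using hom_part_lookup[OF c'(1)[of d], of m] by (auto simp: lc)
      qed
    qed
  qed
  moreover have "p \<otimes>\<^bsub>rep_alg u n\<^esub> q \<in> hom_part u n (d + e)"
    if "p \<in> hom_part u n d" "q \<in> hom_part u n e" for p q d e
  proof -
    have "mdeg n m = d + e" if m: "m \<in> Poly_Mapping.keys (p * q)" for m
    proof -
      obtain a b where "a \<in> Poly_Mapping.keys p" "b \<in> Poly_Mapping.keys q" "m = a + b"
        using m Poly_Mapping.keys_mult[of p q] by blast
      then show ?thesis
        using \<open>p \<in> _\<close> \<open>q \<in> _\<close> by (simp add: hom_part_def mdeg_add)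
    qed
    then show ?thesis
      using that rep_alg.m_closed[of p u n q] by (simp add: hom_part_def)
  qed
  moreover have "\<one>\<^bsub>rep_alg u n\<^esub> \<in> hom_part u n 0"
    by (simp add: hom_part_def exps_0)
  ultimately show ?thesis
    unfolding graded_algebra_def
    by (intro conjI allI ballI F2_algebra_rep_alg) assumption+
qed

lemma homogeneous_univ_poly:
  "homogeneous_poly (rep_alg u n) (hom_part u n) 1 (univ_poly (rep_alg u) n)"
  unfolding homogeneous_poly_def
proof (intro conjI allI)
  fix k
  show "coeff (UP (rep_alg u n)) (univ_poly (rep_alg u) n) k \<in> hom_part u n (1 - int k)"
  proof (cases "k \<in> (^) 2 ` {0..n}")
    case True
    then obtain i where i: "k = 2 ^ i" "i \<le> n" by auto
    show ?thesis
      using \<alpha>_hom_part[OF i(2)] by (simp add: i coeff_univ_poly(1)[OF i(2)])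
  next
    case False
    then show ?thesis by (simp add: coeff_univ_poly(2) hom_part_def)
  qed
qed (rule univ_poly_closed)

text \<open>Exponents are nonnegative and all weights are negative, because
  \<open>i \<ge> 1\<close>. A sum of nonpositive terms vanishes only if each term does.\<close>

lemma
  assumes m: "m \<in> exps False n"
  shows mdeg_nonpos: "mdeg n m \<le> 0" and mdeg_eq_0_imp: "mdeg n m = 0 \<Longrightarrow> m = 0"
proof -
  have pos: "Poly_Mapping.lookup m i \<ge> 0" for i
    using m by (auto simp: exps_def not_less[symmetric])
  have neg: "1 - 2 ^ i < (0 :: int)" if "i \<in> {1..n}" for i
    using that by (simp add: one_less_power)
  have le: "Poly_Mapping.lookup m i * (1 - 2 ^ i) \<le> 0" if "i \<in> {1..n}" for i
    using pos neg[OF that] by (simp add: mult_nonneg_nonpos)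
  then show "mdeg n m \<le> 0"
    unfolding mdeg_def by (rule sum_nonpos)
  show "m = 0" if "mdeg n m = 0"
  proof (rule poly_mapping_eqI)
    fix i
    show "Poly_Mapping.lookup m i = Poly_Mapping.lookup 0 i"
    proof (cases "i \<in> {1..n}")
      case True
      have "\<forall>i\<in>{1..n}. - (Poly_Mapping.lookup m i * (1 - 2 ^ i)) = 0"
        using that le by (subst sum_nonneg_eq_0_iff[symmetric]) (auto simp: mdeg_def sum_negf)
      then have "Poly_Mapping.lookup m i * (1 - 2 ^ i) = 0"
        using True by (metis neg_equal_0_iff_equal)
      with neg[OF True] show ?thesis by (metis less_irrefl lookup_zero mult_eq_0_iff)
    next
      case False
      then show ?thesis using m by (auto simp: exps_def in_keys_iff)
    qed
  qed
qed

lemma coconnected_rep_alg: "coconnected (rep_alg False n) (hom_part False n)"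
  unfolding coconnected_def
proof (intro conjI allI impI)
  fix d :: int assume d: "d > 0"
  have "p = 0" if "p \<in> hom_part False n d" for p
  proof -
    have "Poly_Mapping.keys p = {}"
      using that d mdeg_nonpos by (fastforce simp: hom_part_def)
    then show ?thesis by simp
  qed
  then show "hom_part False n d = {\<zero>\<^bsub>rep_alg False n\<^esub>}"
    by (auto simp: hom_part_def)
next
  have u: "alg_unit (rep_alg False n) c = Poly_Mapping.single 0 c" for c
    by (simp add: alg_unit_def rep_alg_def)
  have "p \<in> range (Poly_Mapping.single 0)" if p: "p \<in> hom_part False n 0" for p
  proof (rule image_eqI[of _ _ "Poly_Mapping.lookup p 0"])
    have "Poly_Mapping.lookup p m = 0" if "m \<noteq> 0" for m
    proof (rule ccontr)
      assume "Poly_Mapping.lookup p m \<noteq> 0"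
      then have "m \<in> Poly_Mapping.keys p" by (simp add: in_keys_iff)
      then have "m \<in> exps False n" "mdeg n m = 0"
        using p by (auto simp: hom_part_def)
      then show False using mdeg_eq_0_imp that by blast
    qed
    then show "p = Poly_Mapping.single 0 (Poly_Mapping.lookup p 0)"
      by (intro poly_mapping_eqI) (auto simp: lookup_single when_def)
  qed simp
  moreover have "Poly_Mapping.single 0 c \<in> hom_part False n 0" for c
    by (auto simp: hom_part_def exps_0)
  ultimately show "bij_betw (alg_unit (rep_alg False n)) (carrier F2) (hom_part False n 0)"
    by (auto simp: bij_betw_def u F2_def inj_on_def dest: injD[OF inj_single])
qed


section \<open>Localization\<close>

context f2_algebra
begin

context
  fixes s assumes s: "s \<in> carrier A"
begin

abbreviation "L \<equiv> localization A s"
abbreviation "J \<equiv> loc_ideal A s"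

lemma loc_gen_closed: "monom P s 1 \<ominus>\<^bsub>P\<^esub> \<one>\<^bsub>P\<^esub> \<in> carrier P"
  using s by simp

lemma ideal_loc: "ideal J P"
  unfolding loc_ideal_def by (rule U.P.cgenideal_ideal[OF loc_gen_closed])

lemma loc_coset_hom: "(\<lambda>p. J +>\<^bsub>P\<^esub> p) \<in> ring_hom P L"
  using ideal.rcos_ring_hom[OF ideal_loc] by (simp add: localization_def)

lemma carrier_localization: "carrier L = (\<lambda>p. J +>\<^bsub>P\<^esub> p) ` carrier P"
  by (auto simp: localization_def FactRing_def A_RCOSETS_def')

lemma loc_map_ring_hom: "loc_map A s \<in> ring_hom A L"
proof -
  have "loc_map A s = (\<lambda>a. J +>\<^bsub>P\<^esub> monom P a 0)"
    by (rule ext) (simp add: loc_map_def)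
  then show ?thesis
    using ring_hom_trans[OF U.const_ring_hom loc_coset_hom] by (simp add: comp_def)
qed

lemma F2_algebra_localization: "F2_algebra L"
  unfolding localization_def
proof (rule F2_algebra_alg_of)
  interpret Q: cring "P Quot J"
    by (rule ideal.quotient_is_cring[OF ideal_loc U.UP_cring])
  show "cring (P Quot J)" by (rule Q.is_cring)
  have h: "loc_map A s \<in> ring_hom A (P Quot J)"
    using loc_map_ring_hom by (simp add: localization_def)
  show "loc_map A s (alg_unit A 1) = \<one>\<^bsub>P Quot J\<^esub>"
    using ring_hom_one[OF h] by (simp add: alg_unit_def smult_eq)
  have 0: "loc_map A s \<zero> = \<zero>\<^bsub>P Quot J\<^esub>"
    by (rule ring_hom_zero[OF h ring_axioms Q.ring_axioms])
  then show "loc_map A s (alg_unit A 0) = \<zero>\<^bsub>P Quot J\<^esub>"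
    by (simp add: alg_unit_def smult_eq)
  show "\<one>\<^bsub>P Quot J\<^esub> \<oplus>\<^bsub>P Quot J\<^esub> \<one>\<^bsub>P Quot J\<^esub> = \<zero>\<^bsub>P Quot J\<^esub>"
    using ring_hom_add[OF h one_closed one_closed] 0 ring_hom_one[OF h] by (simp add: add_self)
qed

text \<open>The class of the variable becomes the inverse of the image of \<open>s\<close>, as s T -
  1 generates the ideal.\<close>

lemma loc_map_unit:
  "loc_map A s s \<otimes>\<^bsub>L\<^esub> (J +>\<^bsub>P\<^esub> monom P \<one> 1) = \<one>\<^bsub>L\<^esub>"
proof -
  have "monom P s 1 \<ominus>\<^bsub>P\<^esub> \<one>\<^bsub>P\<^esub> \<in> J"
    unfolding loc_ideal_def by (rule U.P.cgenideal_self[OF loc_gen_closed])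
  then have "J +>\<^bsub>P\<^esub> monom P s 1 = \<one>\<^bsub>L\<^esub>"
    using U.P.quotient_eq_iff_same_a_r_cos[OF ideal_loc, of "monom P s 1" "\<one>\<^bsub>P\<^esub>"] s
      ring_hom_one[OF loc_coset_hom] by simp
  then show ?thesis
    using ring_hom_mult[OF loc_coset_hom, of "monom P s 0" "monom P \<one> 1"] s U.monom_mult[of s \<one> 0 1]
    by (simp add: loc_map_def)
qed

text \<open>Evaluation of polynomials at the inverse of \<open>\<phi> s\<close> kills s T - 1, hence
  all its multiples, and so factors through the quotient.\<close>

lemma localization_hom_exists:
  assumes C: "F2_algebra C" and \<phi>: "\<phi> \<in> alg_hom A C" and u: "\<phi> s \<in> Units C"
  shows "\<exists>\<theta> \<in> alg_hom L C. \<forall>a\<in>carrier A. \<theta> (loc_map A s a) = \<phi> a"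
proof -
  interpret C: f2_algebra C by (rule f2_algebraI[OF C])
  interpret V: UP_pre_univ_prop A C \<phi> P
    by (rule UP_pre_univ_propI[OF is_cring C.is_cring alg_hom_ring_hom[OF \<phi>]])
  define E where "E = eval A C \<phi> (inv\<^bsub>C\<^esub> \<phi> s)"
  have i: "inv\<^bsub>C\<^esub> \<phi> s \<in> carrier C" using u by simp
  have E: "E \<in> ring_hom P C"
    unfolding E_def by (rule V.eval_ring_hom[OF i])
  interpret E: ring_hom_cring P C E
    by (rule ring_hom_cringI[OF U.UP_cring C.is_cring E])
  have "E (monom P s 1) = \<one>\<^bsub>C\<^esub>"
    using V.eval_monom[OF s i, of 1] u i by (simp add: E_def)
  then have g: "E (monom P s 1 \<ominus>\<^bsub>P\<^esub> \<one>\<^bsub>P\<^esub>) = \<zero>\<^bsub>C\<^esub>"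
    using s by (simp add: a_minus_def C.minus_eq_self C.add_self)
  have "E p = \<zero>\<^bsub>C\<^esub>" if "p \<in> J" for p
    using that g loc_gen_closed by (auto simp: loc_ideal_def cgenideal_def)
  from quotient_hom_exists[OF ideal_loc C.ring_axioms E this]
  obtain \<theta> where \<theta>: "\<theta> \<in> ring_hom (P Quot J) C" "\<theta> \<in> extensional (carrier (P Quot J))"
    "\<And>p. p \<in> carrier P \<Longrightarrow> \<theta> (J +>\<^bsub>P\<^esub> p) = E p"
    by blast
  have "\<theta> \<in> alg_hom L C"
    unfolding alg_hom_iff[OF F2_algebra_localization C] using \<theta>(1,2) by (simp add: localization_def)
  moreover have "\<theta> (loc_map A s a) = \<phi> a" if "a \<in> carrier A" for a
    using that \<theta>(3)[of "monom P a 0"] V.eval_const[OF i that] by (simp add: loc_map_def E_def)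
  ultimately show ?thesis by blast
qed

text \<open>The value at the class of the variable is forced, being inverse to the image of
  \<open>s\<close>; constants and the variable then determine everything.\<close>

lemma localization_hom_eqI:
  assumes C: "F2_algebra C" and h: "\<theta> \<in> alg_hom L C" "\<theta>' \<in> alg_hom L C"
    and eq: "\<And>a. a \<in> carrier A \<Longrightarrow> \<theta> (loc_map A s a) = \<theta>' (loc_map A s a)"
  shows "\<theta> = \<theta>'"
proof (rule alg_hom_eqI[OF h])
  interpret C: f2_algebra C by (rule f2_algebraI[OF C])
  interpret L: f2_algebra L by (rule f2_algebraI[OF F2_algebra_localization])
  note r = h[THEN alg_hom_ring_hom]
  note tr = r[THEN ring_hom_trans[OF loc_coset_hom], unfolded comp_def]
  let ?x = "J +>\<^bsub>P\<^esub> monom P \<one> 1"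
  have x: "?x \<in> carrier L"
    by (rule ring_hom_closed[OF loc_coset_hom]) simp
  note ls = ring_hom_closed[OF loc_map_ring_hom s]
  have X: "\<theta> ?x = \<theta>' ?x"
  proof (rule C.inv_unique)
    show "\<theta> ?x \<otimes>\<^bsub>C\<^esub> \<theta> (loc_map A s s) = \<one>\<^bsub>C\<^esub>"
      using ring_hom_mult[OF r(1) x ls] loc_map_unit ring_hom_one[OF r(1)] L.m_comm[OF x ls] by simp
    show "\<theta> (loc_map A s s) \<otimes>\<^bsub>C\<^esub> \<theta>' ?x = \<one>\<^bsub>C\<^esub>"
      using ring_hom_mult[OF r(2) ls x] loc_map_unit ring_hom_one[OF r(2)] eq[OF s] by simp
  qed (rule ring_hom_closed[OF r(1) x] ring_hom_closed[OF r(1) ls] ring_hom_closed[OF r(2) x])+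
  fix t assume "t \<in> carrier L"
  then obtain p where p: "p \<in> carrier P" "t = J +>\<^bsub>P\<^esub> p"
    unfolding carrier_localization by blast
  have "\<theta> (J +>\<^bsub>P\<^esub> p) = \<theta>' (J +>\<^bsub>P\<^esub> p)"
    by (rule up_hom_eqI[OF is_cring C.is_cring tr _ X p(1)]) (use eq in \<open>simp add: loc_map_def\<close>)
  then show "\<theta> t = \<theta>' t" by (simp add: p)
qed

end

end

lemma localization_iso:
  "\<exists>\<theta>\<in>alg_iso (localization (rep_alg False n) (\<alpha> n)) (rep_alg True n).
    \<forall>a\<in>carrier (rep_alg False n). \<theta> (loc_map (rep_alg False n) (\<alpha> n) a) = a"
proof -
  note C = F2_algebra_rep_alg
  define R where "R = rep_alg False n"
  define L where "L = localization R (\<alpha> n)"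
  define l where "l = loc_map R (\<alpha> n)"
  have R: "F2_algebra R" unfolding R_def by (rule C)
  interpret R: f2_algebra R by (rule f2_algebraI[OF R])
  have \<alpha>n: "\<alpha> n \<in> carrier R" unfolding R_def by (rule \<alpha>_closed) simp
  have L: "F2_algebra L" unfolding L_def by (rule R.F2_algebra_localization[OF \<alpha>n])
  interpret L: f2_algebra L by (rule f2_algebraI[OF L])
  note lhom = R.loc_map_ring_hom[OF \<alpha>n, folded L_def l_def]
  note incl = alg_id_rep_alg_hom[of n, folded R_def]
  \<comment> \<open>It is a unit as the leading coefficient of the universal polynomial of
    \<open>B n\<close>.\<close>
  have "alg_id R (\<alpha> n) \<in> Units (rep_alg True n)"
    using univ_poly_add_polys[of True n] coeff_univ_poly(1)[of n n True] \<alpha>n by (simp add: add_polys_def)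
  from R.localization_hom_exists[OF \<alpha>n C incl this, folded L_def l_def]
  obtain \<theta> where \<theta>: "\<theta> \<in> alg_hom L (rep_alg True n)" "\<And>a. a \<in> carrier R \<Longrightarrow> \<theta> (l a) = a"
    by auto
  have "l (\<alpha> n) \<in> Units L"
  proof -
    let ?x = "loc_ideal R (\<alpha> n) +>\<^bsub>UP R\<^esub> monom (UP R) \<one>\<^bsub>R\<^esub> 1"
    have x: "?x \<in> carrier L"
      unfolding L_def by (rule ring_hom_closed[OF R.loc_coset_hom[OF \<alpha>n]]) simp
    note e = R.loc_map_unit[OF \<alpha>n, folded L_def l_def]
    show ?thesis
      unfolding Units_def using x ring_hom_closed[OF lhom \<alpha>n] e L.m_comm[OF x ring_hom_closed[OF lhom \<alpha>n]]
      by auto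
  qed
  moreover have \<alpha>R: "\<alpha> i \<in> carrier R" if "i \<in> {1..n}" for i
    unfolding R_def by (rule \<alpha>_closed) (use that in simp)
  ultimately obtain \<psi> where \<psi>: "\<psi> \<in> alg_hom (rep_alg True n) L" "\<And>i. i \<in> {1..n} \<Longrightarrow> \<psi> (\<alpha> i) = l (\<alpha> i)"
    using L.rep_alg_hom_exists[of n "\<lambda>i. l (\<alpha> i)" True] ring_hom_closed[OF lhom] by auto
  have "restrict l (carrier R) \<in> ring_hom R L"
    using lhom R.ring_simprules by (auto simp: ring_hom_def)
  then have lalg: "restrict l (carrier R) \<in> alg_hom R L"
    unfolding alg_hom_iff[OF R L] by simp
  \<comment> \<open>On the subalgebra \<open>R\<close>, the morphism \<open>\<psi>\<close> is the
    localization map, since the two agree on generators. This makes \<open>\<theta>\<close> its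
    inverse on either side.\<close>
  have "compose (carrier R) \<psi> (alg_id R) = restrict l (carrier R)"
    by (rule rep_alg_hom_eqI[OF L alg_hom_compose[OF incl \<psi>(1) R, unfolded R_def] lalg[unfolded R_def], folded R_def])
      (use \<alpha>R \<psi>(2) in \<open>simp add: compose_eq\<close>)
  then have \<psi>l: "\<psi> a = l a" if "a \<in> carrier R" for a
    using that by (metis alg_id_apply compose_eq restrict_apply')
  have "compose (carrier (rep_alg True n)) \<theta> \<psi> = alg_id (rep_alg True n)"
  proof (rule rep_alg_hom_eqI[OF C alg_hom_compose[OF \<psi>(1) \<theta>(1) C] alg_hom_alg_id[OF C]])
    fix i assume i: "i \<in> {1..n}"
    then show "compose (carrier (rep_alg True n)) \<theta> \<psi> (\<alpha> i) = alg_id (rep_alg True n) (\<alpha> i)"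
      using \<alpha>_closed[of i n True] \<psi>(2)[OF i] \<theta>(2)[OF \<alpha>R[OF i]] by (simp add: compose_eq del: rep_alg_simps)
  qed
  then have 1: "\<theta> (\<psi> p) = p" if "p \<in> carrier (rep_alg True n)" for p
    using that by (metis alg_id_apply compose_eq)
  have "compose (carrier L) \<psi> \<theta> = alg_id L"
  proof (rule R.localization_hom_eqI[OF \<alpha>n L, folded L_def l_def])
    show "compose (carrier L) \<psi> \<theta> (l a) = alg_id L (l a)" if "a \<in> carrier R" for a
      using that ring_hom_closed[OF lhom that] by (simp add: compose_eq \<theta>(2) \<psi>l)
  qed (rule alg_hom_compose[OF \<theta>(1) \<psi>(1) L] alg_hom_alg_id[OF L])+
  then have 2: "\<psi> (\<theta> t) = t" if "t \<in> carrier L" for t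
    using that by (metis alg_id_apply compose_eq)
  have "bij_betw \<theta> (carrier L) (carrier (rep_alg True n))"
    using 1 2 alg_hom_closed[OF \<theta>(1)] alg_hom_closed[OF \<psi>(1)]
    by (intro bij_betw_byWitness[where f' = \<psi>]) (auto simp del: rep_alg_simps)
  then have "\<theta> \<in> alg_iso L (rep_alg True n)"
    using \<theta>(1) by (simp add: alg_iso_def)
  then show ?thesis
    using \<theta>(2) unfolding L_def l_def R_def by blast
qed

theorem proposition4p2p2:
  shows
    "(graded_monoid_functor (M :: ('a, nat \<Rightarrow> 'a) gm_functor) \<and>
      graded_bialgebra B (comult B) (counit B) \<and>
      connected_bialgebra B \<and>
      (\<forall>n. univ_poly B n \<in> gm_obj M (B n) n) \<and>
      represents B (comult B) (counit B) (classified B) (M :: ('a, nat \<Rightarrow> 'a) gm_functor))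
     \<and>
     (\<forall>n. \<exists>G. graded_algebra (B n) G \<and>
        (\<forall>i\<in>{1..n}. \<alpha> i \<in> G (1 - 2 ^ i)) \<and>
        homogeneous_poly (B n) G 1 (univ_poly B n))
     \<and>
     (graded_monoid_functor (M_plus :: ('a, nat \<Rightarrow> 'a) gm_functor) \<and>
      gm_subfunctor (M :: ('a, nat \<Rightarrow> 'a) gm_functor) M_plus \<and>
      sub_graded_bialgebra B_plus (comult B_plus) (counit B_plus) B (comult B) (counit B) \<and>
      (\<forall>n. univ_poly B_plus n \<in> gm_obj M_plus (B_plus n) n) \<and>
      represents B_plus (comult B_plus) (counit B_plus) (classified B_plus)
        (M_plus :: ('a, nat \<Rightarrow> 'a) gm_functor) \<and>
      represents_inclusion B_plus
        (classified B_plus :: (bit, 'a) module \<Rightarrow> nat \<Rightarrow> (laurent \<Rightarrow> 'a) \<Rightarrow> nat \<Rightarrow> 'a)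
        B (classified B))
     \<and>
     (\<forall>n. (\<exists>G. graded_algebra (B_plus n) G \<and>
        (\<forall>i\<in>{1..n}. \<alpha> i \<in> G (1 - 2 ^ i)) \<and>
        coconnected (B_plus n) G) \<and>
       (\<exists>\<theta>\<in>alg_iso (localization (B_plus n) (\<alpha> n)) (B n).
          \<forall>a\<in>carrier (B_plus n). \<theta> (loc_map (B_plus n) (\<alpha> n) a) = a))"
proof -
  have M: "gm_map M = up_map" "gm_mult M = up_compose" "gm_unit M = up_X"
    "\<And>A n. F2_algebra A \<Longrightarrow> gm_obj M A n = add_polys True A n"
    by (simp_all add: M_def f2_algebra.M_set_eq[OF f2_algebraI])
  have M_plus: "gm_map M_plus = up_map" "gm_mult M_plus = up_compose" "gm_unit M_plus = up_X"
    "\<And>A n. F2_algebra A \<Longrightarrow> gm_obj M_plus A n = add_polys False A n"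
    by (simp_all add: M_plus_def f2_algebra.M_set_eq[OF f2_algebraI])
  \<comment> \<open>Both functors have the same maps, products and unit; only the condition on the
    top coefficient differs.\<close>
  have "gm_subfunctor (M :: ('a, nat \<Rightarrow> 'a) gm_functor) M_plus"
    unfolding gm_subfunctor_def by (auto simp: M M_plus add_polys_def)
  moreover have "represents_inclusion B_plus
      (classified B_plus :: (bit, 'a) module \<Rightarrow> nat \<Rightarrow> (laurent \<Rightarrow> 'a) \<Rightarrow> nat \<Rightarrow> 'a) B (classified B)"
    unfolding represents_inclusion_def B_eq B_plus_eq using classified_restrict by blast
  \<comment> \<open>The witness for \<open>G\<close> is \<open>hom_part True n\<close>, and
    \<open>hom_part False n\<close> for the subalgebra below.\<close>
  moreover have "\<forall>n. \<exists>G. graded_algebra (B n) G \<and> (\<forall>i\<in>{1..n}. \<alpha> i \<in> G (1 - 2 ^ i)) \<and>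
      homogeneous_poly (B n) G 1 (univ_poly B n)"
    unfolding B_eq
    using graded_algebra_rep_alg homogeneous_univ_poly \<alpha>_hom_part by (metis atLeastAtMost_iff)
  moreover have "\<forall>n. \<exists>G. graded_algebra (B_plus n) G \<and> (\<forall>i\<in>{1..n}. \<alpha> i \<in> G (1 - 2 ^ i)) \<and>
      coconnected (B_plus n) G"
    unfolding B_plus_eq
    using graded_algebra_rep_alg coconnected_rep_alg \<alpha>_hom_part by (metis atLeastAtMost_iff)
  ultimately show ?thesis
    using graded_monoid_functor_add_polys[OF M] graded_monoid_functor_add_polys[OF M_plus]
      represents_add_polys[OF M] represents_add_polys[OF M_plus]
      graded_bialgebra_rep_alg[of True] connected_rep_alg[of True] sub_graded_bialgebra_rep_alg
      univ_poly_add_polys[of True] univ_poly_add_polys[of False] localization_iso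
    by (simp only: B_eq B_plus_eq M(4)[OF F2_algebra_rep_alg] M_plus(4)[OF F2_algebra_rep_alg]) blast
qed

end
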